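(* Fix $\kappa>1$, $\alpha\ge4$ and $\beta\ge4$, and let $\eta$ be a thresholding function as in the context. There exist a sufficiently small absolute constant $c>0$, a sufficiently small constant $c'>0$ depending only on $\kappa$, and a constant $C>0$ depending only on $\kappa$ and $\beta$, such that the following holds for all sufficiently large $m$ and $n$. Let $m,n,k,l,r,d,\sigma$ satisfy the following condition: $m\ge n$, $\log(d/\sigma)\le cm$, $c\le \log m/\log n\le 1/c$, $\log m\le c[(m-k)\wedge(n-l)]$, $k\vee l\le c(m\wedge n)$, and $$\frac{\sigma^2 r}{d^2}\left(k\sqrt{n\log m}+l\sqrt{m\log m}\right)\le c'.$$ Let $\mathbf X=\mathbf M+\mathbf Z$ with $\mathbf M\in\mathcal F(m,n,k,l,r,d,\kappa)$ and $\mathbf Z\in\mathbb R^{m\times n}$ having i.i.d. $N(0,\sigma^2)$ entries. Let $\widehat{\mathbf M}$ be the output of the two-way iterative thresholding algorithm described in the context, with initial matrix $\mathbf V^{(0)}$, threshold levels $\gamma_u=\gamma_v=\gamma$, and stopping after $\widehat T$ iterations, as defined there. Then, uniformly over $\mathbf M\in\mathcal F(m,n,k,l,r,d,\kappa)$, with probability at least $1-O(m^{-2})$, one has $\widehat T\in[T,3T]$ and, for all $q\in[1,2]$, $$\|\widehat{\mathbf M}-\mathbf M\|_{\mathrm s_q}^2\le C\sigma^2\left[r^{\frac2q}(k+l+\log m)+r^{\frac2q-1}(k+l)\log m\right].$$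
   Context: Notation. $a\wedge b=\min(a,b)$, $a\vee b=\max(a,b)$; $a_m=O(b_m)$ means $a_m\le C_0b_m$ for an absolute constant $C_0$. $\|\mathbf A\|_{\mathrm s_q}=(\sum_i\sigma_i(\mathbf A)^q)^{1/q}$ is the Schatten-$q$ norm, $\|\cdot\|$ the Euclidean norm of a vector. $\mathbf A_{i*}$, $\mathbf A_{*j}$ are the $i$th row and $j$th column; $\mathrm{supp}(\mathbf A)$ is the set of indices of nonzero rows. A matrix is orthonormal if its columns are orthonormal vectors. Parameter space. For integers $m\ge k\ge r\ge1$, $n\ge l\ge r$ and $d>0$, $\mathcal F(m,n,k,l,r,d,\kappa)$ is the set of all $\mathbf M\in\mathbb R^{m\times n}$ of rank $r$ whose SVD $\mathbf M=\mathbf U\mathbf D\mathbf V'$ ($\mathbf U$ $m\times r$ orthonormal, $\mathbf V$ $n\times r$ orthonormal, $\mathbf D=\mathrm{diag}(d_1,\dots,d_r)$) satisfies $|\mathrm{supp}(\mathbf U)|\le k$, $|\mathrm{supp}(\mathbf V)|\le l$, $d\le d_r\le\cdots\le d_1\le\kappa d$. Thresholding function. $\eta$ satisfies $|\eta(x,t)-x|\le t$ for all $x\ge0,t>0$, and $\eta(x,t)=0$ for all $t>0$, $x\in[0,t]$. Initialization ($r$, $\sigma$ known). Let $I^0=\{i:\|\mathbf X_{i*}\|^2\ge\sigma^2(n+\alpha\sqrt{n\log m})\}$ and $J^0=\{j:\|\mathbf X_{*j}\|^2\ge\sigma^2(m+\alpha\sqrt{m\log m})\}$; let $\mathbf X^{(0)}=(x_{ij}\mathbf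 1_{i\in I^0}\mathbf 1_{j\in J^0})$; let $\mathbf V^{(0)}$ be the $n\times r$ matrix whose columns are the $r$ leading right singular vectors of $\mathbf X^{(0)}$. Let $d_r^{(0)}$ be the $r$th largest singular value of $\mathbf X^{(0)}$. Iteration. For $t=1,2,\dots$: (1) $\mathbf U^{(t),\mathrm{mul}}=\mathbf X\mathbf V^{(t-1)}$; (2) $\mathbf U^{(t),\mathrm{thr}}$ has rows $\mathbf U^{(t),\mathrm{thr}}_{i*}=\frac{\mathbf U^{(t),\mathrm{mul}}_{i*}}{\|\mathbf U^{(t),\mathrm{mul}}_{i*}\|}\eta(\|\mathbf U^{(t),\mathrm{mul}}_{i*}\|,\gamma_u)$ (a zero row stays zero); (3) QR decomposition $\mathbf U^{(t)}\mathbf R_u^{(t)}=\mathbf U^{(t),\mathrm{thr}}$ with $\mathbf U^{(t)}$ $m\times r$ orthonormal; (4) $\mathbf V^{(t),\mathrm{mul}}=\mathbf X'\mathbf U^{(t)}$; (5) $\mathbf V^{(t),\mathrm{thr}}$ has rows $\frac{\mathbf V^{(t),\mathrm{mul}}_{i*}}{\|\mathbf V^{(t),\mathrm{mul}}_{i*}\|}\eta(\|\mathbf V^{(t),\mathrm{mul}}_{i*}\|,\gamma_v)$; (6) QR decomposition $\mathbf V^{(t)}\mathbf R_v^{(t)}=\mathbf V^{(t),\mathrm{thr}}$. After $\widehat T$ iterations (rounded up to an integer) put $\widehat{\mathbf U}=\mathbf U^{(\widehat T)}$, $\widehat{\mathbf V}=\mathbf V^{(\widehat T)}$ and output $\widehat{\mathbf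 M}=\widehat{\mathbf U}\widehat{\mathbf U}'\,\mathbf X\,\widehat{\mathbf V}\widehat{\mathbf V}'$. Thresholds and iteration counts: $$\gamma_u^2=\gamma_v^2=\gamma^2=1.01\,\sigma^2\left(r+2\sqrt{r\beta\log m}+2\beta\log m\right),$$ $$\widehat T=\frac{1.1}{2}\left[\frac{\log m}{\log2}+\log\frac{(d_r^{(0)})^2}{\gamma^2}\right],\qquad T=\frac{1.01}{2}\left[\frac{\log m}{\log 2}+\log\frac{d_r^2}{k\gamma_u^2\vee l\gamma_v^2}\right].$$
   Formalization: The constant c' is allowed to depend on κ and on the fixed α, not on κ alone: for a c' depending only on κ, a large α makes I⁰ empty with high probability for flat rank-one M, so X⁽⁰⁾ = 0 and the claim fails. *)

theory Defs
  imports
    "HOL-Probability.Probability"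
    "Jordan_Normal_Form.Char_Poly"
    "Jordan_Normal_Form.DL_Rank"
begin

(* Matrices are Jordan_Normal_Form matrices, because m, n and r vary inside the statement.
   Matrix indices start at 0. *)

section \<open>Singular values and Schatten norms\<close>

definition orthonormal_cols :: "real mat \<Rightarrow> bool" where
  "orthonormal_cols A \<longleftrightarrow> transpose_mat A * A = 1\<^sub>m (dim_col A)"

definition vnorm :: "real vec \<Rightarrow> real" where
  "vnorm v = sqrt (scalar_prod v v)"

definition row_supp :: "real mat \<Rightarrow> nat set" where
  "row_supp A = {i. i < dim_row A \<and> row A i \<noteq> 0\<^sub>v (dim_col A)}"

(* SVD with p singular triples, A = U diag(d 0, ..., d (p - 1)) V'. *)
definition is_svd :: "real mat \<Rightarrow> nat \<Rightarrow> real mat \<Rightarrow> (nat \<Rightarrow> real) \<Rightarrow> real mat \<Rightarrow> bool" where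
  "is_svd A p U d V \<longleftrightarrow>
     U \<in> carrier_mat (dim_row A) p \<and> orthonormal_cols U \<and>
     V \<in> carrier_mat (dim_col A) p \<and> orthonormal_cols V \<and>
     (\<forall>i j. i \<le> j \<and> j < p \<longrightarrow> d j \<le> d i) \<and> (\<forall>i<p. 0 \<le> d i) \<and>
     A = U * mat_diag p d * transpose_mat V"

(* Square roots of the eigenvalues of A'A, with multiplicity, in decreasing order.  The list has
   length dim_col A, so for a wide matrix it is padded with zeros. *)
definition singular_values :: "real mat \<Rightarrow> real list" where
  "singular_values A =
     rev (sorted_list_of_multiset (image_mset sqrt (proots (char_poly (transpose_mat A * A)))))"

(* The i-th largest singular value, for 1 \<le> i \<le> dim_col A. *)
definition sing_val :: "real mat \<Rightarrow> nat \<Rightarrow> real" where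
  "sing_val A i = singular_values A ! (i - 1)"

definition schatten_norm :: "real \<Rightarrow> real mat \<Rightarrow> real" where
  "schatten_norm q A = (\<Sum>s\<leftarrow>singular_values A. s powr q) powr (1 / q)"

(* The columns of V are r leading right singular vectors of A.  They are unique only up to sign,
   and up to rotation when singular values coincide, hence a predicate. *)
definition leading_right_sv :: "real mat \<Rightarrow> nat \<Rightarrow> real mat \<Rightarrow> bool" where
  "leading_right_sv A r V \<longleftrightarrow>
     (\<exists>U d W. is_svd A (min (dim_row A) (dim_col A)) U d W \<and>
              V = mat (dim_col A) r (\<lambda>(i, j). W $$ (i, j)))"

(* Reduced QR decomposition; Q need not be unique when A is rank deficient. *)
definition is_qr :: "real mat \<Rightarrow> real mat \<Rightarrow> real mat \<Rightarrow> bool" where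
  "is_qr A Q R \<longleftrightarrow>
     Q \<in> carrier_mat (dim_row A) (dim_col A) \<and> orthonormal_cols Q \<and>
     R \<in> carrier_mat (dim_col A) (dim_col A) \<and> upper_triangular R \<and> Q * R = A"

section \<open>The model\<close>

definition param_space ::
  "nat \<Rightarrow> nat \<Rightarrow> nat \<Rightarrow> nat \<Rightarrow> nat \<Rightarrow> real \<Rightarrow> real \<Rightarrow> real mat set" where
  "param_space m n k l r d \<kappa> =
     {M \<in> carrier_mat m n. vec_space.rank m M = r \<and>
        (\<exists>U D V. is_svd M r U D V \<and> card (row_supp U) \<le> k \<and> card (row_supp V) \<le> l \<and>
                 d \<le> D (r - 1) \<and> D 0 \<le> \<kappa> * d)}"

(* Law of the m n independent N(0, \<sigma>\<^sup>2) entries of the noise; normal_density takes the standard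
   deviation as its second argument. *)
definition gaussian_noise :: "nat \<Rightarrow> nat \<Rightarrow> real \<Rightarrow> (nat \<times> nat \<Rightarrow> real) measure" where
  "gaussian_noise m n \<sigma> =
     PiM ({..<m} \<times> {..<n}) (\<lambda>_. density lborel (\<lambda>x. ennreal (normal_density 0 \<sigma> x)))"

section \<open>Two-way iterative thresholding\<close>

(* The Borel condition is what makes the estimator a random variable. *)
definition thresholding_fun :: "(real \<Rightarrow> real \<Rightarrow> real) \<Rightarrow> bool" where
  "thresholding_fun \<eta> \<longleftrightarrow>
     (\<forall>x t. 0 \<le> x \<and> 0 < t \<longrightarrow> \<bar>\<eta> x t - x\<bar> \<le> t) \<and>
     (\<forall>x t. 0 < t \<and> 0 \<le> x \<and> x \<le> t \<longrightarrow> \<eta> x t = 0) \<and>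
     (\<forall>t>0. (\<lambda>x. \<eta> x t) \<in> borel_measurable (restrict_space borel {0..}))"

(* A zero row stays zero because 0 / 0 = 0. *)
definition row_threshold :: "(real \<Rightarrow> real \<Rightarrow> real) \<Rightarrow> real \<Rightarrow> real mat \<Rightarrow> real mat" where
  "row_threshold \<eta> \<gamma> A =
     mat (dim_row A) (dim_col A)
       (\<lambda>(i, j). A $$ (i, j) / vnorm (row A i) * \<eta> (vnorm (row A i)) \<gamma>)"

definition init_rows :: "real \<Rightarrow> real \<Rightarrow> real mat \<Rightarrow> nat set" where
  "init_rows \<alpha> \<sigma> X =
     {i. i < dim_row X \<and>
         (vnorm (row X i))\<^sup>2 \<ge> \<sigma>\<^sup>2 * (dim_col X + \<alpha> * sqrt (dim_col X * ln (dim_row X)))}"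

(* The logarithm is that of the number of rows here as well. *)
definition init_cols :: "real \<Rightarrow> real \<Rightarrow> real mat \<Rightarrow> nat set" where
  "init_cols \<alpha> \<sigma> X =
     {j. j < dim_col X \<and>
         (vnorm (col X j))\<^sup>2 \<ge> \<sigma>\<^sup>2 * (dim_row X + \<alpha> * sqrt (dim_row X * ln (dim_row X)))}"

definition init_mat :: "real \<Rightarrow> real \<Rightarrow> real mat \<Rightarrow> real mat" where
  "init_mat \<alpha> \<sigma> X =
     mat (dim_row X) (dim_col X)
       (\<lambda>(i, j). if i \<in> init_rows \<alpha> \<sigma> X \<and> j \<in> init_cols \<alpha> \<sigma> X then X $$ (i, j) else 0)"

definition threshold_level :: "nat \<Rightarrow> nat \<Rightarrow> real \<Rightarrow> real \<Rightarrow> real" where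
  "threshold_level m r \<beta> \<sigma> =
     sqrt (1.01 * \<sigma>\<^sup>2 * (r + 2 * sqrt (r * \<beta> * ln m) + 2 * \<beta> * ln m))"

(* Data-driven iteration count, before rounding; meaningful if the logarithm's argument is
   positive. *)
definition T_hat :: "nat \<Rightarrow> real \<Rightarrow> real \<Rightarrow> real \<Rightarrow> real mat \<Rightarrow> real" where
  "T_hat r \<alpha> \<beta> \<sigma> X =
     1.1 / 2 * (ln (dim_row X) / ln 2 +
       ln ((sing_val (init_mat \<alpha> \<sigma> X) r)\<^sup>2 / (threshold_level (dim_row X) r \<beta> \<sigma>)\<^sup>2))"

definition T_oracle :: "nat \<Rightarrow> nat \<Rightarrow> nat \<Rightarrow> real \<Rightarrow> real \<Rightarrow> real mat \<Rightarrow> real" where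
  "T_oracle k l r \<beta> \<sigma> M =
     (let \<gamma>u = threshold_level (dim_row M) r \<beta> \<sigma>; \<gamma>v = threshold_level (dim_row M) r \<beta> \<sigma> in
      1.01 / 2 * (ln (dim_row M) / ln 2 +
        ln ((sing_val M r)\<^sup>2 / max (k * \<gamma>u\<^sup>2) (l * \<gamma>v\<^sup>2))))"

(* U 1, ..., U N and V 0, ..., V N are iterates started from V 0; U 0 plays no role. *)
definition iterates ::
  "(real \<Rightarrow> real \<Rightarrow> real) \<Rightarrow> real \<Rightarrow> real \<Rightarrow> real mat \<Rightarrow> nat \<Rightarrow>
     (nat \<Rightarrow> real mat) \<Rightarrow> (nat \<Rightarrow> real mat) \<Rightarrow> bool" where
  "iterates \<eta> \<gamma>u \<gamma>v X N U V \<longleftrightarrow>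
     (\<forall>t\<in>{1..N}.
        (\<exists>R. is_qr (row_threshold \<eta> \<gamma>u (X * V (t - 1))) (U t) R) \<and>
        (\<exists>R. is_qr (row_threshold \<eta> \<gamma>v (transpose_mat X * U t)) (V t) R))"

(* Mhat is an output of the algorithm on data X, for some choice of the singular vectors and of
   the QR factors. *)
definition algorithm_output ::
  "(real \<Rightarrow> real \<Rightarrow> real) \<Rightarrow> nat \<Rightarrow> real \<Rightarrow> real \<Rightarrow> real \<Rightarrow> real mat \<Rightarrow> real mat \<Rightarrow> bool" where
  "algorithm_output \<eta> r \<alpha> \<beta> \<sigma> X Mhat \<longleftrightarrow>
     (let \<gamma> = threshold_level (dim_row X) r \<beta> \<sigma>; N = nat \<lceil>T_hat r \<alpha> \<beta> \<sigma> X\<rceil> in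
      \<exists>U V. leading_right_sv (init_mat \<alpha> \<sigma> X) r (V 0) \<and>
            iterates \<eta> \<gamma> \<gamma> X N U V \<and>
            Mhat = U N * transpose_mat (U N) * X * (V N * transpose_mat (V N)))"

end

theory Submission
  imports
    Defs
    "Jordan_Normal_Form.Schur_Decomposition"
begin

text \<open>
  Rows of \<open>X V\<close> survive the thresholding either because of the signal or because the noise row
  \<open>(Z V)\<^sub>i\<close> exceeds the threshold.  The energy of the noise rows above the threshold is bounded, for
  all sparse contractions \<open>V\<close> at once, by \<open>\<sigma>\<^sup>2 (r + log m)\<close> times the number of nonzero
  rows of \<open>V\<close>: for fixed \<open>V\<close> this is a Chernoff bound for truncated chi-squared variables, and a
  net extends it to all \<open>V\<close>.  On this event everything is deterministic, whatever the dependence of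
  the iterates on the data.  The iteration preserves the property of being an orthonormal frame close
  to the true one with few and small rows outside its support, each step already reaches the final
  accuracy, and the initial singular vectors have this property because all rows and columns kept
  by the screening belong to the support while the discarded ones carry little signal.
\<close>

text \<open>The energy bound allows \<open>C1 * \<sigma>^2 * (r + ln m)\<close> per nonzero row of
  the frame, up to a large constant the squared threshold. Used alone it would let the number of
  false rows multiply by a constant at every half-step. What prevents this is that the part of the
  frame off the true support has small norm, so that its contribution to the energy carries a small
  factor. The factor 1.01 in the threshold is the whole margin for such splittings: it covers a tail
  bound at 1.005 and two losses of 999/1000 in the level, one for the net and one for splitting the
  frame. A step forgets how accurate its input was: the projection onto the complement of the new
  frame annihilates the thresholded matrix, so only the thresholding error is left, and the old
  frame merely has to make a bounded angle with the true one. The smallness constant of the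
  signal-to-noise condition must not depend on \<beta>. Factors that do are paid by
  \<open>ln m / n\<close>, which is small for large n because \<open>ln m\<close> and
  \<open>ln n\<close> are comparable.\<close>

no_notation inner (infix \<open>\<bullet>\<close> 70)
no_notation vec_nth (infixl \<open>$\<close> 90)
hide_const (open) Finite_Cartesian_Product.row Finite_Cartesian_Product.mat

section \<open>Euclidean linear algebra on matrices of variable size\<close>

abbreviation nsq :: "real vec \<Rightarrow> real" where
  "nsq v \<equiv> v \<bullet> v"

lemma nsq_sum: "nsq v = (\<Sum>i<dim_vec v. (v $ i)\<^sup>2)"
  by (simp add: scalar_prod_def power2_eq_square atLeast0LessThan)

lemma nsq_nonneg [simp]: "0 \<le> nsq v"
  by (simp add: nsq_sum sum_nonneg)

lemma nsq_eq_0_iff: "v \<in> carrier_vec n \<Longrightarrow> nsq v = 0 \<longleftrightarrow> v = 0\<^sub>v n"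
  by (auto simp: nsq_sum sum_nonneg_eq_0_iff intro!: eq_vecI)

lemma vnorm_power2: "(vnorm v)\<^sup>2 = nsq v"
  by (simp add: vnorm_def)

lemma vnorm_nonneg [simp]: "0 \<le> vnorm v"
  by (simp add: vnorm_def)

lemma scalar_prod_Cauchy_Schwarz:
  fixes x y :: "real vec"
  assumes "x \<in> carrier_vec n" "y \<in> carrier_vec n"
  shows "(x \<bullet> y)\<^sup>2 \<le> nsq x * nsq y"
proof -
  have "(\<Sum>i<n. x $ i * y $ i)\<^sup>2 \<le> (\<Sum>i<n. (x $ i)\<^sup>2) * (\<Sum>i<n. (y $ i)\<^sup>2)"
    by (rule Cauchy_Schwarz_ineq_sum)
  then show ?thesis
    using assms by (simp add: nsq_sum scalar_prod_def atLeast0LessThan)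
qed

lemma nsq_add:
  fixes x y :: "real vec"
  assumes "x \<in> carrier_vec n" "y \<in> carrier_vec n"
  shows "nsq (x + y) = nsq x + 2 * (x \<bullet> y) + nsq y"
  using assms by (simp add: add_scalar_prod_distrib[of _ n] scalar_prod_add_distrib[of _ n]
      comm_scalar_prod[of y n x])

lemma nsq_add_le:
  fixes x y :: "real vec"
  assumes "x \<in> carrier_vec n" "y \<in> carrier_vec n"
  shows "nsq (x + y) \<le> 2 * nsq x + 2 * nsq y"
proof -
  have *: "(a + b)\<^sup>2 \<le> 2 * a\<^sup>2 + 2 * b\<^sup>2" for a b :: real
    using sum_squares_bound[of a b] by (simp add: power2_sum)
  have "(\<Sum>i<n. (x $ i + y $ i)\<^sup>2) \<le> (\<Sum>i<n. 2 * (x $ i)\<^sup>2 + 2 * (y $ i)\<^sup>2)"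
    by (intro sum_mono *)
  then show ?thesis
    using assms by (simp add: nsq_sum sum.distrib sum_distrib_left)
qed

lemma scalar_prod_mult_mat_vec:
  fixes A :: "real mat"
  assumes "A \<in> carrier_mat m n" "x \<in> carrier_vec n" "y \<in> carrier_vec m"
  shows "(A *\<^sub>v x) \<bullet> y = x \<bullet> (transpose_mat A *\<^sub>v y)"
proof -
  have "(A *\<^sub>v x) \<bullet> y = (\<Sum>i<m. (\<Sum>j<n. A $$ (i,j) * x $ j) * y $ i)"
    using assms by (simp add: scalar_prod_def atLeast0LessThan)
  also have "\<dots> = (\<Sum>j<n. x $ j * (\<Sum>i<m. A $$ (i,j) * y $ i))"
    by (simp add: sum_distrib_left sum_distrib_right)
       (subst sum.swap, simp add: mult_ac)
  also have "\<dots> = x \<bullet> (transpose_mat A *\<^sub>v y)"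
    using assms by (simp add: scalar_prod_def atLeast0LessThan)
  finally show ?thesis .
qed

text \<open>Padded with zero rows to a square matrix, A becomes singular, because the p-th unit
  vector lies in the kernel of the transpose. This dimension count is what drives the min-max
  arguments for singular values.\<close>

lemma wide_mat_kernel:
  fixes A :: "real mat"
  assumes A: "A \<in> carrier_mat p q" and "p < q"
  shows "\<exists>x. x \<in> carrier_vec q \<and> x \<noteq> 0\<^sub>v q \<and> A *\<^sub>v x = 0\<^sub>v p"
proof -
  define B where "B = mat q q (\<lambda>(i,j). if i < p then A $$ (i,j) else 0)"
  have B: "B \<in> carrier_mat q q" by (simp add: B_def)
  have "transpose_mat B *\<^sub>v unit_vec q p = 0\<^sub>v q"
    using B \<open>p < q\<close> by (intro eq_vecI) (auto simp: B_def)
  moreover have "unit_vec q p \<noteq> (0\<^sub>v q :: real vec)"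
    using \<open>p < q\<close> by simp
  ultimately have "det (transpose_mat B) = 0"
    using B det_0_iff_vec_prod_zero[of "transpose_mat B" q]
    by (metis transpose_carrier_mat unit_vec_carrier)
  then have "det B = 0"
    using det_transpose[OF B] by simp
  then obtain x where x: "x \<in> carrier_vec q" "x \<noteq> 0\<^sub>v q" "B *\<^sub>v x = 0\<^sub>v q"
    using det_0_iff_vec_prod_zero[OF B] by blast
  have "(A *\<^sub>v x) $ i = 0" if "i < p" for i
  proof -
    have "row A i = row B i"
      using that A \<open>p < q\<close> by (intro eq_vecI) (auto simp: B_def)
    then have "(A *\<^sub>v x) $ i = (B *\<^sub>v x) $ i"
      using that A B \<open>p < q\<close> by simp
    then show ?thesis
      using x that \<open>p < q\<close> by simp
  qed
  then have "A *\<^sub>v x = 0\<^sub>v p"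
    using A by (intro eq_vecI) auto
  with x show ?thesis by blast
qed

lemma orthonormal_nsq:
  assumes Q: "Q \<in> carrier_mat m n" "orthonormal_cols Q" and x: "x \<in> carrier_vec n"
  shows "nsq (Q *\<^sub>v x) = nsq x"
proof -
  have "nsq (Q *\<^sub>v x) = x \<bullet> (transpose_mat Q *\<^sub>v (Q *\<^sub>v x))"
    using Q x by (intro scalar_prod_mult_mat_vec) auto
  also have "transpose_mat Q *\<^sub>v (Q *\<^sub>v x) = (transpose_mat Q * Q) *\<^sub>v x"
    using Q x by (intro assoc_mult_mat_vec[symmetric]) auto
  also have "\<dots> = x"
    using Q x by (simp add: orthonormal_cols_def)
  finally show ?thesis .
qed

text \<open>B is injective and square, hence y = B x for some x. Then (y . y)^2 = (x . B'y)^2 is at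
  most |x|^2 |B'y|^2, while c |x|^2 is at most |y|^2. It turns closeness of two frames around: a
  bound for \<open>transpose_mat W * V\<close> becomes one for
  \<open>transpose_mat V * W\<close>.\<close>

lemma square_inj_transpose_bound:
  fixes B :: "real mat"
  assumes B: "B \<in> carrier_mat r r" and "0 < c"
    and bd: "\<And>x. x \<in> carrier_vec r \<Longrightarrow> c * nsq x \<le> nsq (B *\<^sub>v x)"
    and y: "y \<in> carrier_vec r"
  shows "c * nsq y \<le> nsq (transpose_mat B *\<^sub>v y)"
proof -
  have "det B \<noteq> 0"
  proof
    assume "det B = 0"
    then obtain x where x: "x \<in> carrier_vec r" "x \<noteq> 0\<^sub>v r" "B *\<^sub>v x = 0\<^sub>v r"
      using det_0_iff_vec_prod_zero[OF B] by blast
    then have "c * nsq x \<le> 0" using bd[of x] by simp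
    with \<open>0 < c\<close> have "nsq x = 0"
      using nsq_nonneg[of x] by (simp add: mult_le_0_iff)
    with x show False by (simp add: nsq_eq_0_iff)
  qed
  then obtain C where C: "C \<in> carrier_mat r r" "B * C = 1\<^sub>m r"
    using det_non_zero_imp_unit[OF B, unfolded Units_def ring_mat_def] by auto
  define x where "x = C *\<^sub>v y"
  have x: "x \<in> carrier_vec r" using C y by (simp add: x_def)
  have Bx: "B *\<^sub>v x = y"
    using B C y by (simp add: x_def flip: assoc_mult_mat_vec)
  have "(nsq y)\<^sup>2 = (x \<bullet> (transpose_mat B *\<^sub>v y))\<^sup>2"
    using scalar_prod_mult_mat_vec[OF B x y] Bx by simp
  also have "\<dots> \<le> nsq x * nsq (transpose_mat B *\<^sub>v y)"
    using x B y by (intro scalar_prod_Cauchy_Schwarz[of _ r]) auto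
  finally have 1: "(nsq y)\<^sup>2 \<le> nsq x * nsq (transpose_mat B *\<^sub>v y)" .
  have 2: "c * nsq x \<le> nsq y" using bd[OF x] Bx by simp
  show ?thesis
  proof (cases "nsq y = 0")
    case False
    then have pos: "0 < nsq y" using nsq_nonneg[of y] by linarith
    have "c * (nsq y)\<^sup>2 \<le> (c * nsq x) * nsq (transpose_mat B *\<^sub>v y)"
      using 1 \<open>0 < c\<close> by (simp add: mult.assoc)
    also have "\<dots> \<le> nsq y * nsq (transpose_mat B *\<^sub>v y)"
      using 2 by (intro mult_right_mono) auto
    finally have "nsq y * (c * nsq y) \<le> nsq y * nsq (transpose_mat B *\<^sub>v y)"
      by (simp add: power2_eq_square mult_ac)
    then show ?thesis using pos by simp
  qed auto
qed

subsection \<open>The spectral theorem for real symmetric matrices\<close>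

text \<open>Take an eigenvector x + iy of the complexified matrix. Symmetry equates (Ax) . y with x
  . (Ay), which says that the imaginary part of the eigenvalue times |x|^2 + |y|^2 vanishes. Then x
  or y, whichever is nonzero, is a real eigenvector.\<close>

lemma symmetric_eigenvector:
  fixes A :: "real mat"
  assumes A: "A \<in> carrier_mat n n" and sym: "transpose_mat A = A" and "0 < n"
  shows "\<exists>e v. v \<in> carrier_vec n \<and> nsq v = 1 \<and> A *\<^sub>v v = e \<cdot>\<^sub>v v"
proof -
  define C where "C = map_mat complex_of_real A"
  have C: "C \<in> carrier_mat n n" using A by (simp add: C_def)
  obtain as where as: "char_poly C = (\<Prod>a\<leftarrow>as. [:- a, 1:])" "length as = n"
    using char_poly_factorized[OF C] by blast
  with \<open>0 < n\<close> obtain lam bs where "as = lam # bs" by (cases as) auto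
  with as have "poly (char_poly C) lam = 0" by simp
  then have "eigenvalue C lam" using eigenvalue_root_char_poly[OF C] by simp
  then obtain w where w: "w \<in> carrier_vec n" "w \<noteq> 0\<^sub>v n" "C *\<^sub>v w = lam \<cdot>\<^sub>v w"
    using C by (auto simp: eigenvalue_def eigenvector_def)
  define x where "x = map_vec Re w"
  define y where "y = map_vec Im w"
  have xy: "x \<in> carrier_vec n" "y \<in> carrier_vec n" using w by (auto simp: x_def y_def)
  have eq: "(\<Sum>j<n. of_real (A $$ (i,j)) * w $ j) = lam * w $ i" if "i < n" for i
  proof -
    have "(C *\<^sub>v w) $ i = (\<Sum>j<n. of_real (A $$ (i,j)) * w $ j)"
      using that A w(1) by (simp add: C_def scalar_prod_def atLeast0LessThan)
    then show ?thesis using w that by simp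
  qed
  have Ax: "A *\<^sub>v x = Re lam \<cdot>\<^sub>v x - Im lam \<cdot>\<^sub>v y"
  proof (rule eq_vecI)
    fix i assume "i < dim_vec (Re lam \<cdot>\<^sub>v x - Im lam \<cdot>\<^sub>v y)"
    then have i: "i < n" using xy by simp
    have "(A *\<^sub>v x) $ i = Re (\<Sum>j<n. of_real (A $$ (i,j)) * w $ j)"
      using A w i by (simp add: scalar_prod_def atLeast0LessThan x_def)
    then show "(A *\<^sub>v x) $ i = (Re lam \<cdot>\<^sub>v x - Im lam \<cdot>\<^sub>v y) $ i"
      using eq[OF i] i w by (simp add: x_def y_def)
  qed (use A xy in auto)
  have Ay: "A *\<^sub>v y = Im lam \<cdot>\<^sub>v x + Re lam \<cdot>\<^sub>v y"
  proof (rule eq_vecI)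
    fix i assume "i < dim_vec (Im lam \<cdot>\<^sub>v x + Re lam \<cdot>\<^sub>v y)"
    then have i: "i < n" using xy by simp
    have "(A *\<^sub>v y) $ i = Im (\<Sum>j<n. of_real (A $$ (i,j)) * w $ j)"
      using A w i by (simp add: scalar_prod_def atLeast0LessThan y_def)
    then show "(A *\<^sub>v y) $ i = (Im lam \<cdot>\<^sub>v x + Re lam \<cdot>\<^sub>v y) $ i"
      using eq[OF i] i w by (simp add: x_def y_def)
  qed (use A xy in auto)
  have pos: "0 < nsq x + nsq y"
  proof (rule ccontr)
    assume "\<not> ?thesis"
    then have "nsq x = 0" "nsq y = 0"
      using nsq_nonneg[of x] nsq_nonneg[of y] by linarith+
    then have "x = 0\<^sub>v n" "y = 0\<^sub>v n" using xy by (auto simp: nsq_eq_0_iff)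
    then have "w = 0\<^sub>v n"
      using w by (intro eq_vecI) (auto simp: x_def y_def vec_eq_iff complex_eq_iff)
    with w show False by simp
  qed
  have "(A *\<^sub>v x) \<bullet> y = x \<bullet> (A *\<^sub>v y)"
    using scalar_prod_mult_mat_vec[OF A xy] sym by simp
  then have "Re lam * (x \<bullet> y) - Im lam * nsq y = Im lam * nsq x + Re lam * (x \<bullet> y)"
    using xy unfolding Ax Ay
    by (simp add: minus_scalar_prod_distrib[of _ n] scalar_prod_add_distrib[of _ n])
  then have "Im lam * (nsq x + nsq y) = 0" by (simp add: algebra_simps)
  with pos have im: "Im lam = 0" by simp
  have norm: "\<exists>e v. v \<in> carrier_vec n \<and> nsq v = 1 \<and> A *\<^sub>v v = e \<cdot>\<^sub>v v"
    if u: "u \<in> carrier_vec n" "A *\<^sub>v u = e \<cdot>\<^sub>v u" and p: "0 < nsq u" for u e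
  proof (intro exI conjI)
    let ?v = "(1 / vnorm u) \<cdot>\<^sub>v u"
    have n: "0 < vnorm u" using p by (simp add: vnorm_def)
    show "?v \<in> carrier_vec n" using u by simp
    show "nsq ?v = 1"
      using n u p vnorm_power2[of u] by (simp add: power2_eq_square)
    show "A *\<^sub>v ?v = e \<cdot>\<^sub>v ?v"
      using u A by (auto simp: mult_mat_vec smult_smult_assoc mult.commute)
  qed
  have "A *\<^sub>v x = Re lam \<cdot>\<^sub>v x" "A *\<^sub>v y = Re lam \<cdot>\<^sub>v y"
    using Ax Ay im xy by auto
  moreover have "0 < nsq x \<or> 0 < nsq y"
    using pos nsq_nonneg[of x] nsq_nonneg[of y] by linarith
  ultimately show ?thesis
    using norm xy by blast
qed

text \<open>Gram-Schmidt on a basis that begins with v keeps v in first place. It does not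
  normalize, so the columns are divided by their lengths.\<close>

lemma orthogonal_completion:
  assumes v: "v \<in> carrier_vec n" and v1: "nsq v = 1"
  shows "\<exists>H. H \<in> carrier_mat n n \<and> orthonormal_cols H \<and> col H 0 = v"
proof -
  interpret cof_vec_space n "TYPE(real)" .
  have v0: "v \<noteq> 0\<^sub>v n" using v1 by auto
  define b where "b = basis_completion v"
  define ws where "ws = gram_schmidt n b"
  from basis_completion[OF v v0, folded b_def]
  have dist_b: "distinct b"
    and indep: "\<not> lin_dep (set b)" and b: "set b \<subseteq> carrier_vec n" and hdb: "hd b = v"
    and len_b: "length b = n" by auto
  have n: "n \<noteq> 0" using v0 v by (metis carrier_vecD eq_vecI less_nat_zero_code zero_carrier_vec)
  from hdb len_b n obtain vs where bv: "b = v # vs" by (cases b) auto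
  from gram_schmidt_result[OF b dist_b indep refl, folded ws_def]
  have ws: "set ws \<subseteq> carrier_vec n" "corthogonal ws" "length ws = n"
    by (auto simp: len_b)
  from gram_schmidt_hd[OF v, of vs, folded bv] have hdws: "hd ws = v" unfolding ws_def .
  have wc: "ws ! i \<in> carrier_vec n" if "i < n" for i using ws that by auto
  have orth: "(ws ! i \<bullet> ws ! j = 0) = (i \<noteq> j)" if "i < n" "j < n" for i j
    using corthogonalD[OF ws(2), of i j] ws(3) that by simp
  define H where "H = mat n n (\<lambda>(i,j). (ws ! j) $ i / vnorm (ws ! j))"
  have H: "H \<in> carrier_mat n n" by (simp add: H_def)
  have colH: "col H j = (1 / vnorm (ws ! j)) \<cdot>\<^sub>v (ws ! j)" if "j < n" for j
    using that wc[OF that] by (intro eq_vecI) (auto simp: H_def)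
  have "transpose_mat H * H = 1\<^sub>m n"
  proof (rule eq_matI)
    fix i j assume "i < dim_row (1\<^sub>m n)" "j < dim_col (1\<^sub>m n)"
    then have ij: "i < n" "j < n" by auto
    have "(transpose_mat H * H) $$ (i,j) = col H i \<bullet> col H j"
      using H ij by simp
    also have "\<dots> = (ws ! i \<bullet> ws ! j) / (vnorm (ws ! i) * vnorm (ws ! j))"
      unfolding colH[OF ij(1)] colH[OF ij(2)] using wc[OF ij(1)] wc[OF ij(2)] by simp
    also have "\<dots> = (if i = j then 1 else 0)"
    proof (cases "i = j")
      case True
      then have "nsq (ws ! i) \<noteq> 0" using orth[OF ij] by simp
      then show ?thesis using True vnorm_power2[of "ws ! i"]
        by (auto simp: power2_eq_square)
    qed (use orth[OF ij] in auto)
    finally show "(transpose_mat H * H) $$ (i,j) = 1\<^sub>m n $$ (i,j)"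
      using ij by simp
  qed (use H in auto)
  then have "orthonormal_cols H" using H by (simp add: orthonormal_cols_def)
  moreover have "col H 0 = v"
  proof -
    have "ws ! 0 = v" using hdws ws n by (metis hd_conv_nth list.size(3))
    then show ?thesis using colH[of 0] n v1 v by (simp add: vnorm_def)
  qed
  ultimately show ?thesis using H by blast
qed

text \<open>Deflation: an orthogonal H with an eigenvector as first column turns A into a matrix B
  whose first column, and by symmetry whose first row, vanishes off the diagonal. The induction
  hypothesis treats the remaining block.\<close>

lemma real_symmetric_diagonalizable:
  fixes A :: "real mat"
  assumes "A \<in> carrier_mat n n" and "transpose_mat A = A"
  shows "\<exists>Q d. Q \<in> carrier_mat n n \<and> orthonormal_cols Q \<and>
           transpose_mat Q * A * Q = mat_diag n d"
  using assms
proof (induction n arbitrary: A)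
  case 0
  then show ?case
    by (intro exI[of _ "1\<^sub>m 0"] exI[of _ "\<lambda>_. 0"]) (auto simp: orthonormal_cols_def mat_diag_def)
next
  case (Suc n)
  note A = Suc.prems(1) and sym = Suc.prems(2)
  obtain e v where v: "v \<in> carrier_vec (Suc n)" "nsq v = 1" "A *\<^sub>v v = e \<cdot>\<^sub>v v"
    using symmetric_eigenvector[OF A sym] by auto
  obtain H where H: "H \<in> carrier_mat (Suc n) (Suc n)" "orthonormal_cols H" "col H 0 = v"
    using orthogonal_completion[OF v(1,2)] by blast
  have HH: "transpose_mat H * H = 1\<^sub>m (Suc n)"
    using H by (simp add: orthonormal_cols_def)
  define B where "B = transpose_mat H * A * H"
  have B: "B \<in> carrier_mat (Suc n) (Suc n)" using A H by (simp add: B_def)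
  have symB: "transpose_mat B = B"
    using A H sym unfolding B_def
    by (simp add: transpose_mult[of _ "Suc n" "Suc n" _ "Suc n"] assoc_mult_mat[of _ "Suc n" "Suc n" _ "Suc n" _ "Suc n"])
  have B0: "B $$ (i, 0) = (if i = 0 then e else 0)" if "i < Suc n" for i
  proof -
    have "B = transpose_mat H * (A * H)"
      using A H unfolding B_def by (intro assoc_mult_mat) auto
    then have "B $$ (i,0) = col H i \<bullet> (A *\<^sub>v col H 0)"
      using that A H by (simp add: col_mult2[of _ "Suc n" "Suc n" _ "Suc n"] mult_mat_vec_def)
    also have "\<dots> = e * (col H i \<bullet> col H 0)"
      using v H that by simp
    also have "col H i \<bullet> col H 0 = (transpose_mat H * H) $$ (i,0)"
      using H that by simp
    also have "\<dots> = (if i = 0 then 1 else 0)" unfolding HH using that by simp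
    finally show ?thesis by simp
  qed
  have B0': "B $$ (0, i) = (if i = 0 then e else 0)" if "i < Suc n" for i
    using B0[OF that] symB B that by (metis carrier_matD index_transpose_mat(1) zero_less_Suc)
  define A3 where "A3 = mat n n (\<lambda>(i,j). B $$ (Suc i, Suc j))"
  have A3: "A3 \<in> carrier_mat n n" by (simp add: A3_def)
  have symA3: "transpose_mat A3 = A3"
  proof (rule eq_matI)
    fix i j assume "i < dim_row A3" "j < dim_col A3"
    then have ij: "i < n" "j < n" using A3 by auto
    have "B $$ (Suc j, Suc i) = transpose_mat B $$ (Suc i, Suc j)"
      using B ij by simp
    then show "transpose_mat A3 $$ (i,j) = A3 $$ (i,j)"
      using ij symB by (simp add: A3_def)
  qed (use A3 in auto)
  obtain Q3 d3 where Q3: "Q3 \<in> carrier_mat n n" "orthonormal_cols Q3"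
    "transpose_mat Q3 * A3 * Q3 = mat_diag n d3"
    using Suc.IH[OF A3 symA3] by blast
  let ?E = "mat 1 1 (\<lambda>_. e)"
  let ?z = "0\<^sub>m 1 n :: real mat" and ?z' = "0\<^sub>m n 1 :: real mat"
  have Bblock: "B = four_block_mat ?E ?z ?z' A3"
    using B B0 B0' by (intro eq_matI) (auto simp: A3_def)
  define P where "P = four_block_mat (1\<^sub>m 1) ?z ?z' Q3"
  have P: "P \<in> carrier_mat (Suc n) (Suc n)" using Q3 by (auto simp: P_def)
  have Pt: "transpose_mat P = four_block_mat (1\<^sub>m 1) ?z ?z' (transpose_mat Q3)"
    unfolding P_def using Q3 by (subst transpose_four_block_mat) auto
  have PP: "transpose_mat P * P = 1\<^sub>m (Suc n)"
  proof -
    have "transpose_mat P * P = four_block_mat (1\<^sub>m 1) ?z ?z' (transpose_mat Q3 * Q3)"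
      unfolding Pt unfolding P_def
      using Q3 by (subst mult_four_block_mat[of _ 1 1 _ n _ n _ _ 1 _ n]) auto
    also have "transpose_mat Q3 * Q3 = 1\<^sub>m n" using Q3 by (simp add: orthonormal_cols_def)
    also have "four_block_mat (1\<^sub>m 1) ?z ?z' (1\<^sub>m n) = (1\<^sub>m (Suc n) :: real mat)"
      by (intro eq_matI) auto
    finally show ?thesis .
  qed
  have PBP: "transpose_mat P * B * P = mat_diag (Suc n) (\<lambda>i. if i = 0 then e else d3 (i - 1))"
  proof -
    have "transpose_mat P * B = four_block_mat ?E ?z ?z' (transpose_mat Q3 * A3)"
      unfolding Pt Bblock
      using Q3 A3 by (subst mult_four_block_mat[of _ 1 1 _ n _ n _ _ 1 _ n]) auto
    then have "transpose_mat P * B * P = four_block_mat ?E ?z ?z' (transpose_mat Q3 * A3 * Q3)"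
      unfolding P_def
      using Q3 A3 by (simp, subst mult_four_block_mat[of _ 1 1 _ n _ n _ _ 1 _ n]) auto
    also have "\<dots> = mat_diag (Suc n) (\<lambda>i. if i = 0 then e else d3 (i - 1))"
      unfolding Q3(3) by (intro eq_matI) (auto simp: mat_diag_def)
    finally show ?thesis .
  qed
  show ?case
  proof (intro exI conjI)
    show Q: "H * P \<in> carrier_mat (Suc n) (Suc n)" using H P by simp
    have T: "transpose_mat (H * P) = transpose_mat P * transpose_mat H"
      using H P by (intro transpose_mult) auto
    have "transpose_mat (H * P) * (H * P) = transpose_mat P * (transpose_mat H * H) * P"
      unfolding T using H P by (simp add: assoc_mult_mat[of _ "Suc n" "Suc n" _ "Suc n" _ "Suc n"])
    also have "\<dots> = 1\<^sub>m (Suc n)" using HH PP P by simp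
    finally show "orthonormal_cols (H * P)" using Q P by (simp add: orthonormal_cols_def)
    have "transpose_mat (H * P) * A * (H * P) = transpose_mat P * B * P"
      unfolding T B_def
      using H P A by (simp add: assoc_mult_mat[of _ "Suc n" "Suc n" _ "Suc n" _ "Suc n"])
    then show "transpose_mat (H * P) * A * (H * P) =
        mat_diag (Suc n) (\<lambda>i. if i = 0 then e else d3 (i - 1))"
      using PBP by simp
  qed
qed

subsection \<open>Singular values\<close>

lemma orthonormal_square_transpose:
  assumes "Q \<in> carrier_mat n n" "orthonormal_cols Q"
  shows "Q * transpose_mat Q = 1\<^sub>m n"
  using assms mat_mult_left_right_inverse[of "transpose_mat Q" n Q]
  by (simp add: orthonormal_cols_def)

lemma proots_prod_list_linear:
  fixes xs :: "real list"
  shows "proots (\<Prod>a\<leftarrow>xs. [:- a, 1:]) = mset xs"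
proof (induction xs)
  case (Cons a xs)
  have "(\<Prod>a\<leftarrow>xs. [:- a, 1:]) \<noteq> (0 :: real poly)"
    by (auto simp: prod_list_zero_iff)
  then have "proots ([:- a, 1:] * (\<Prod>a\<leftarrow>xs. [:- a, 1:])) =
      proots [:- a, 1:] + proots (\<Prod>a\<leftarrow>xs. [:- a, 1:])"
    by (intro proots_mult) auto
  then show ?case
    using Cons proots_linear_factor[of "- a"] by simp
qed simp

lemma mset_eq_ex_bij:
  assumes "mset xs = mset ys"
  shows "\<exists>f. bij_betw f {..<length xs} {..<length ys} \<and> (\<forall>i<length xs. xs ! i = ys ! f i)"
proof -
  obtain p where p: "p permutes {..<length ys}" "permute_list p ys = xs"
    using mset_eq_permutation[OF assms] by metis
  have "length xs = length ys" using assms by (rule mset_eq_length)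
  with p show ?thesis
    by (intro exI[of _ p]) (auto simp: permutes_imp_bij permute_list_def)
qed

text \<open>The definition reads the singular values off a characteristic polynomial, whereas all
  later arguments use the quadratic form |Ax|^2 in an orthonormal eigenbasis. Diagonalizing A'A
  gives the basis, similarity identifies its eigenvalues with the roots, and the permutation that
  sorts them is applied to the eigenvectors.\<close>

lemma singular_values_spectral:
  fixes A :: "real mat"
  assumes A: "A \<in> carrier_mat m n"
  obtains Q where "Q \<in> carrier_mat n n" "orthonormal_cols Q"
    "length (singular_values A) = n"
    "\<And>i. i < n \<Longrightarrow> 0 \<le> singular_values A ! i"
    "\<And>i j. i \<le> j \<Longrightarrow> j < n \<Longrightarrow> singular_values A ! j \<le> singular_values A ! i"
    "\<And>x. x \<in> carrier_vec n \<Longrightarrow>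
       nsq (A *\<^sub>v x) = (\<Sum>i<n. (singular_values A ! i)\<^sup>2 * (col Q i \<bullet> x)\<^sup>2)"
proof -
  define S where "S = transpose_mat A * A"
  have S: "S \<in> carrier_mat n n" using A by (simp add: S_def)
  have symS: "transpose_mat S = S"
    using A unfolding S_def by (simp add: transpose_mult[of _ n m _ n])
  obtain P d where P: "P \<in> carrier_mat n n" "orthonormal_cols P"
    "transpose_mat P * S * P = mat_diag n d"
    using real_symmetric_diagonalizable[OF S symS] by blast
  have PP: "transpose_mat P * P = 1\<^sub>m n" "P * transpose_mat P = 1\<^sub>m n"
    using P orthonormal_square_transpose[OF P(1,2)] by (auto simp: orthonormal_cols_def)
  have quad: "nsq (A *\<^sub>v x) = (\<Sum>i<n. d i * (col P i \<bullet> x)\<^sup>2)" if x: "x \<in> carrier_vec n" for x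
  proof -
    define y where "y = transpose_mat P *\<^sub>v x"
    have y: "y \<in> carrier_vec n" using P x by (simp add: y_def)
    have xy: "x = P *\<^sub>v y"
      using P x PP by (simp add: y_def flip: assoc_mult_mat_vec[of _ n n _ n])
    have "nsq (A *\<^sub>v x) = x \<bullet> (S *\<^sub>v x)"
      using A x scalar_prod_mult_mat_vec[OF A x, of "A *\<^sub>v x"]
      by (simp add: S_def assoc_mult_mat_vec[of _ n m _ n])
    also have "\<dots> = y \<bullet> (transpose_mat P *\<^sub>v (S *\<^sub>v (P *\<^sub>v y)))"
      using P y S xy scalar_prod_mult_mat_vec[OF P(1) y, of "S *\<^sub>v (P *\<^sub>v y)"] by simp
    also have "transpose_mat P *\<^sub>v (S *\<^sub>v (P *\<^sub>v y)) = mat_diag n d *\<^sub>v y"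
      using P S y unfolding P(3)[symmetric] by (simp add: assoc_mult_mat_vec[of _ n n _ n])
    also have "y \<bullet> (mat_diag n d *\<^sub>v y) = (\<Sum>i<n. d i * (y $ i)\<^sup>2)"
    proof -
      have "(mat_diag n d *\<^sub>v y) $ i = d i * y $ i" if "i < n" for i
      proof -
        have "(mat_diag n d *\<^sub>v y) $ i = (\<Sum>j<n. (if i = j then d j else 0) * y $ j)"
          using that y by (simp add: mat_diag_def scalar_prod_def atLeast0LessThan)
        also have "\<dots> = (\<Sum>j<n. if j = i then d i * y $ i else 0)"
          by (intro sum.cong) auto
        finally show ?thesis using that by simp
      qed
      then show ?thesis
        using y by (simp add: scalar_prod_def mat_diag_def atLeast0LessThan power2_eq_square mult_ac)
    qed
    also have "\<dots> = (\<Sum>i<n. d i * (col P i \<bullet> x)\<^sup>2)"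
      using P x by (intro sum.cong) (auto simp: y_def)
    finally show ?thesis .
  qed
  have d_nonneg: "0 \<le> d i" if "i < n" for i
  proof -
    have "(\<Sum>j<n. d j * (col P j \<bullet> col P i)\<^sup>2) = (\<Sum>j<n. if j = i then d i else 0)"
    proof (intro sum.cong refl)
      fix j assume "j \<in> {..<n}"
      then have "col P j \<bullet> col P i = (transpose_mat P * P) $$ (j,i)"
        using P that by simp
      then show "d j * (col P j \<bullet> col P i)\<^sup>2 = (if j = i then d i else 0)"
        using PP \<open>j \<in> {..<n}\<close> that by simp
    qed
    moreover have "col P i \<in> carrier_vec n" using P that by auto
    ultimately have "nsq (A *\<^sub>v col P i) = d i" using quad that by simp
    then show ?thesis using nsq_nonneg by metis
  qed
  have "similar_mat S (mat_diag n d)"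
  proof -
    have "S = P * mat_diag n d * transpose_mat P"
    proof -
      have "P * mat_diag n d * transpose_mat P = (P * transpose_mat P) * S * (P * transpose_mat P)"
        unfolding P(3)[symmetric] using P(1) S by (simp add: assoc_mult_mat[of _ n n _ n _ n])
      then show ?thesis using PP S by simp
    qed
    then have "similar_mat_wit S (mat_diag n d) P (transpose_mat P)"
      using S P PP by (intro similar_mat_witI[of _ _ n]) (auto simp: mat_diag_def)
    then show ?thesis unfolding similar_mat_def by blast
  qed
  then have "char_poly S = char_poly (mat_diag n d)" by (rule char_poly_similar)
  also have "\<dots> = (\<Prod>a\<leftarrow>diag_mat (mat_diag n d). [:- a, 1:])"
    by (rule char_poly_upper_triangular[of _ n]) (auto simp: mat_diag_def)
  also have "diag_mat (mat_diag n d) = map d [0..<n]"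
    by (auto simp: diag_mat_def mat_diag_def)
  finally have cp: "proots (char_poly S) = mset (map d [0..<n])"
    by (simp add: proots_prod_list_linear del: map_map)
  define s where "s = singular_values A"
  define xs where "xs = map (\<lambda>i. sqrt (d i)) [0..<n]"
  have s_eq: "s = rev (sort xs)"
  proof -
    have "image_mset sqrt (proots (char_poly S)) = mset xs"
      unfolding cp xs_def by (simp add: image_mset.compositionality comp_def flip: mset_map)
    then show ?thesis
      unfolding s_def singular_values_def S_def[symmetric] by simp
  qed
  have len: "length s = n" by (simp add: s_eq xs_def)
  have "mset s = mset xs" by (simp add: s_eq)
  from mset_eq_ex_bij[OF this] obtain f where
    f: "bij_betw f {..<n} {..<n}" "\<And>i. i < n \<Longrightarrow> s ! i = xs ! f i"
    using len by (auto simp: xs_def)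
  have fn: "f i < n" if "i < n" for i using f(1) that by (auto simp: bij_betw_def)
  have s2: "s ! i = sqrt (d (f i))" if "i < n" for i
    using f(2)[OF that] fn[OF that] by (simp add: xs_def)
  define Q where "Q = mat n n (\<lambda>(i,j). P $$ (i, f j))"
  have Q: "Q \<in> carrier_mat n n" by (simp add: Q_def)
  have colQ: "col Q j = col P (f j)" if "j < n" for j
    using P that fn[OF that] by (intro eq_vecI) (auto simp: Q_def)
  show ?thesis
  proof
    show "Q \<in> carrier_mat n n" by fact
    have "transpose_mat Q * Q = 1\<^sub>m n"
    proof (rule eq_matI)
      fix i j assume "i < dim_row (1\<^sub>m n)" "j < dim_col (1\<^sub>m n)"
      then have ij: "i < n" "j < n" by auto
      then have "(transpose_mat Q * Q) $$ (i,j) = col P (f i) \<bullet> col P (f j)"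
        using Q by (simp add: colQ)
      also have "\<dots> = (transpose_mat P * P) $$ (f i, f j)"
        using P fn ij by simp
      also have "\<dots> = 1\<^sub>m n $$ (i,j)"
      proof -
        have "f i = f j \<longleftrightarrow> i = j"
          using bij_betw_imp_inj_on[OF f(1)] ij by (simp add: inj_on_eq_iff)
        then show ?thesis unfolding PP(1) using ij fn by simp
      qed
      finally show "(transpose_mat Q * Q) $$ (i,j) = 1\<^sub>m n $$ (i,j)" .
    qed (use Q in auto)
    then show "orthonormal_cols Q" using Q by (simp add: orthonormal_cols_def)
    show "length (singular_values A) = n" using len by (simp add: s_def)
    show "0 \<le> singular_values A ! i" if "i < n" for i
      using s2[OF that] d_nonneg[OF fn[OF that]] by (simp add: s_def)
    show "singular_values A ! j \<le> singular_values A ! i" if "i \<le> j" "j < n" for i j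
    proof -
      have "sorted (rev s)" by (simp add: s_eq)
      then show ?thesis
        using that len unfolding s_def[symmetric] by (simp add: sorted_rev_iff_nth_mono)
    qed
    show "nsq (A *\<^sub>v x) = (\<Sum>i<n. (singular_values A ! i)\<^sup>2 * (col Q i \<bullet> x)\<^sup>2)"
      if x: "x \<in> carrier_vec n" for x
    proof -
      have "(\<Sum>i<n. (s ! i)\<^sup>2 * (col Q i \<bullet> x)\<^sup>2) = (\<Sum>i<n. d (f i) * (col P (f i) \<bullet> x)\<^sup>2)"
        using s2 d_nonneg fn colQ by (intro sum.cong) auto
      also have "\<dots> = (\<Sum>i<n. d i * (col P i \<bullet> x)\<^sup>2)"
        by (rule sum.reindex_bij_betw[OF f(1)])
      finally show ?thesis using quad[OF x] by (simp add: s_def)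
    qed
  qed
qed

section \<open>Coordinates in an orthonormal basis and min-max bounds for singular values\<close>

lemma orthonormal_col_scalar_prod:
  assumes "Q \<in> carrier_mat m n" "orthonormal_cols Q" "i < n" "j < n"
  shows "col Q i \<bullet> col Q j = (if i = j then 1 else 0)"
proof -
  have "col Q i \<bullet> col Q j = (transpose_mat Q * Q) $$ (i,j)"
    using assms by simp
  also have "transpose_mat Q * Q = 1\<^sub>m n"
    using assms by (simp add: orthonormal_cols_def)
  finally show ?thesis using assms by simp
qed

lemma nsq_orthonormal_coords:
  assumes "Q \<in> carrier_mat n n" "orthonormal_cols Q" "x \<in> carrier_vec n"
  shows "nsq x = (\<Sum>i<n. (col Q i \<bullet> x)\<^sup>2)"
proof -
  have "nsq x = nsq (transpose_mat Q *\<^sub>v x)"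
    using assms orthonormal_square_transpose[of Q n]
    by (intro orthonormal_nsq[symmetric, of _ n n]) (auto simp: orthonormal_cols_def)
  then show ?thesis using assms by (simp add: nsq_sum)
qed

lemma sing_val_le:
  fixes A :: "real mat"
  assumes A: "A \<in> carrier_mat m n" and i: "1 \<le> i" "i \<le> n" and "0 \<le> c"
    and bd: "\<And>x. x \<in> carrier_vec n \<Longrightarrow> nsq (A *\<^sub>v x) \<le> c\<^sup>2 * nsq x"
  shows "sing_val A i \<le> c"
proof -
  obtain Q where Q: "Q \<in> carrier_mat n n" "orthonormal_cols Q"
    "length (singular_values A) = n"
    "\<And>i. i < n \<Longrightarrow> 0 \<le> singular_values A ! i"
    "\<And>i j. i \<le> j \<Longrightarrow> j < n \<Longrightarrow> singular_values A ! j \<le> singular_values A ! i"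
    "\<And>x. x \<in> carrier_vec n \<Longrightarrow>
       nsq (A *\<^sub>v x) = (\<Sum>i<n. (singular_values A ! i)\<^sup>2 * (col Q i \<bullet> x)\<^sup>2)"
    by (rule singular_values_spectral[OF A]) (rule that)
  let ?q = "col Q (i - 1)"
  have q: "?q \<in> carrier_vec n" using Q(1) i by (intro col_carrier_vec) auto
  have "nsq (A *\<^sub>v ?q) = (\<Sum>j<n. if j = i - 1 then (singular_values A ! j)\<^sup>2 else 0)"
    unfolding Q(6)[OF q] using i orthonormal_col_scalar_prod[OF Q(1,2)]
    by (intro sum.cong) auto
  also have "\<dots> = (sing_val A i)\<^sup>2" using i by (simp add: sing_val_def)
  finally have "(sing_val A i)\<^sup>2 \<le> c\<^sup>2 * nsq ?q" using bd[OF q] by simp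
  also have "nsq ?q = 1" using orthonormal_col_scalar_prod[OF Q(1,2)] i by simp
  finally have "(sing_val A i)\<^sup>2 \<le> c\<^sup>2" by simp
  then show ?thesis using \<open>0 \<le> c\<close> by (rule power2_le_imp_le)
qed

text \<open>Both the list \<open>singular_values\<close> and an arbitrary SVD, such as the one
  chosen by the algorithm, yield such a frame, so the min-max bounds are proved once for
  both.\<close>

definition sv_frame :: "real mat \<Rightarrow> nat \<Rightarrow> real mat \<Rightarrow> (nat \<Rightarrow> real) \<Rightarrow> bool" where
  "sv_frame A n Q s \<longleftrightarrow> Q \<in> carrier_mat n n \<and> orthonormal_cols Q \<and> (\<forall>i<n. 0 \<le> s i) \<and>
     (\<forall>i j. i \<le> j \<and> j < n \<longrightarrow> s j \<le> s i) \<and>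
     (\<forall>x\<in>carrier_vec n. nsq (A *\<^sub>v x) = (\<Sum>i<n. (s i)\<^sup>2 * (col Q i \<bullet> x)\<^sup>2))"

lemma sv_frameD:
  assumes "sv_frame A n Q s"
  shows "Q \<in> carrier_mat n n" "orthonormal_cols Q"
    "\<And>i. i < n \<Longrightarrow> 0 \<le> s i"
    "\<And>i j. i \<le> j \<Longrightarrow> j < n \<Longrightarrow> s j \<le> s i"
    "\<And>x. x \<in> carrier_vec n \<Longrightarrow> nsq (A *\<^sub>v x) = (\<Sum>i<n. (s i)\<^sup>2 * (col Q i \<bullet> x)\<^sup>2)"
  using assms unfolding sv_frame_def by simp_all

lemma sv_frame_singular_values:
  assumes "A \<in> carrier_mat m n"
  shows "\<exists>Q. sv_frame A n Q (\<lambda>i. singular_values A ! i)"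
  by (rule singular_values_spectral[OF assms]) (unfold sv_frame_def, intro exI conjI ballI allI impI, auto)

text \<open>Courant-Fischer from below: the i-dimensional range of V contains a nonzero vector
  orthogonal to the first i - 1 singular vectors, and on such vectors the form is at most
  \<open>(s (i - 1))^2\<close>, indices being counted from 0.\<close>

lemma sv_frame_ge:
  fixes A :: "real mat"
  assumes fr: "sv_frame A n Q s" and i: "1 \<le> i" "i \<le> n" and "0 \<le> c"
    and V: "V \<in> carrier_mat n i" "orthonormal_cols V"
    and bd: "\<And>x. x \<in> carrier_vec i \<Longrightarrow> c\<^sup>2 * nsq x \<le> nsq (A *\<^sub>v (V *\<^sub>v x))"
  shows "c \<le> s (i - 1)"
proof -
  note Q = sv_frameD[OF fr]
  define K where "K = mat (i - 1) i (\<lambda>(a,b). col Q a \<bullet> col V b)"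
  have Kc: "K \<in> carrier_mat (i - 1) i" by (simp add: K_def)
  obtain x where x: "x \<in> carrier_vec i" "x \<noteq> 0\<^sub>v i" "K *\<^sub>v x = 0\<^sub>v (i - 1)"
    using wide_mat_kernel[OF Kc] i by auto
  define y where "y = V *\<^sub>v x"
  have y: "y \<in> carrier_vec n" using V x by (simp add: y_def)
  have 0: "col Q a \<bullet> y = 0" if "a < i - 1" for a
  proof -
    have "transpose_mat V *\<^sub>v col Q a = row K a"
      using that V Q(1) i comm_scalar_prod[OF col_carrier_vec[OF _ V(1)] col_carrier_vec[OF _ Q(1)]]
      by (intro eq_vecI) (auto simp: K_def)
    then have "y \<bullet> col Q a = x \<bullet> row K a"
      using scalar_prod_mult_mat_vec[OF V(1) x(1) col_carrier_vec[OF _ Q(1)], of a] that i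
      by (simp add: y_def)
    also have "\<dots> = (K *\<^sub>v x) $ a"
      using that Kc comm_scalar_prod[OF x(1) row_carrier_vec[OF that Kc]] by simp
    also have "\<dots> = 0" using x that by simp
    finally show ?thesis
      using comm_scalar_prod[OF y col_carrier_vec[OF _ Q(1)], of a] that i by simp
  qed
  have "c\<^sup>2 * nsq x \<le> nsq (A *\<^sub>v y)" using bd[OF x(1)] by (simp add: y_def)
  also have "\<dots> = (\<Sum>j<n. (s j)\<^sup>2 * (col Q j \<bullet> y)\<^sup>2)" by (rule Q(5)[OF y])
  also have "\<dots> \<le> (\<Sum>j<n. (s (i - 1))\<^sup>2 * (col Q j \<bullet> y)\<^sup>2)"
  proof (intro sum_mono)
    fix j assume j: "j \<in> {..<n}"
    show "(s j)\<^sup>2 * (col Q j \<bullet> y)\<^sup>2 \<le> (s (i - 1))\<^sup>2 * (col Q j \<bullet> y)\<^sup>2"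
    proof (cases "j < i - 1")
      case False
      then show ?thesis using Q(3)[of j] Q(4)[of "i - 1" j] j
        by (intro mult_right_mono power_mono) auto
    qed (simp add: 0)
  qed
  also have "\<dots> = (s (i - 1))\<^sup>2 * nsq x"
    using nsq_orthonormal_coords[OF Q(1,2) y] orthonormal_nsq[OF V x(1)]
    by (simp add: y_def sum_distrib_left)
  finally have "c\<^sup>2 * nsq x \<le> (s (i - 1))\<^sup>2 * nsq x" .
  moreover have "0 < nsq x" using nsq_eq_0_iff[OF x(1)] x(2) nsq_nonneg[of x] by linarith
  ultimately have "c\<^sup>2 \<le> (s (i - 1))\<^sup>2" by simp
  moreover have "0 \<le> s (i - 1)" using i by (intro Q(3)) simp
  ultimately show ?thesis by (rule power2_le_imp_le)
qed

lemma sing_val_ge: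
  assumes "A \<in> carrier_mat m n" "1 \<le> i" "i \<le> n" "0 \<le> c"
    "V \<in> carrier_mat n i" "orthonormal_cols V"
    "\<And>x. x \<in> carrier_vec i \<Longrightarrow> c\<^sup>2 * nsq x \<le> nsq (A *\<^sub>v (V *\<^sub>v x))"
  shows "c \<le> sing_val A i"
proof -
  obtain Q where "sv_frame A n Q (\<lambda>i. singular_values A ! i)"
    using sv_frame_singular_values[OF assms(1)] by blast
  from sv_frame_ge[OF this assms(2-)] show ?thesis by (simp add: sing_val_def)
qed

lemma orthonormal_leading_cols:
  assumes Q: "Q \<in> carrier_mat n p" "orthonormal_cols Q" and "i \<le> p"
  shows "orthonormal_cols (mat n i (\<lambda>(a,b). Q $$ (a,b)))"
    and "\<And>b. b < i \<Longrightarrow> col (mat n i (\<lambda>(a,b). Q $$ (a,b))) b = col Q b"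
proof -
  define V where "V = mat n i (\<lambda>(a,b). Q $$ (a,b))"
  have V: "V \<in> carrier_mat n i" by (simp add: V_def)
  have colV: "col V b = col Q b" if "b < i" for b
    using that assms by (intro eq_vecI) (auto simp: V_def)
  then show "\<And>b. b < i \<Longrightarrow> col (mat n i (\<lambda>(a,b). Q $$ (a,b))) b = col Q b" by (simp add: V_def)
  have "transpose_mat V * V = 1\<^sub>m i"
  proof (rule eq_matI)
    fix a b assume "a < dim_row (1\<^sub>m i)" "b < dim_col (1\<^sub>m i)"
    then have ab: "a < i" "b < i" by auto
    have "(transpose_mat V * V) $$ (a,b) = col Q a \<bullet> col Q b"
      using ab V by (simp add: colV)
    then show "(transpose_mat V * V) $$ (a,b) = 1\<^sub>m i $$ (a,b)"
      using ab assms orthonormal_col_scalar_prod[OF Q, of a b] by simp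
  qed (use V in auto)
  then have "orthonormal_cols V" using V by (simp add: orthonormal_cols_def)
  then show "orthonormal_cols (mat n i (\<lambda>(a,b). Q $$ (a,b)))" by (simp only: V_def)
qed

text \<open>The dual argument: the kernel of B has codimension at most p, so it meets the span of
  the first i + 1 > p singular vectors, where the form is at least \<open>(s i)^2\<close>.\<close>

lemma sv_frame_kernel_le:
  assumes fr: "sv_frame A n Q s" and B: "B \<in> carrier_mat p n" and "0 \<le> c"
    and ker: "\<And>x. x \<in> carrier_vec n \<Longrightarrow> B *\<^sub>v x = 0\<^sub>v p \<Longrightarrow> nsq (A *\<^sub>v x) \<le> c\<^sup>2 * nsq x"
    and i: "p \<le> i" "i < n"
  shows "s i \<le> c"
proof -
  note Q = sv_frameD[OF fr]
  define V where "V = mat n (Suc i) (\<lambda>(a,b). Q $$ (a,b))"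
  have V: "V \<in> carrier_mat n (Suc i)" by (simp add: V_def)
  have oV: "orthonormal_cols V" and colV: "\<And>b. b < Suc i \<Longrightarrow> col V b = col Q b"
    using orthonormal_leading_cols[OF Q(1,2), of "Suc i"] i by (auto simp: V_def)
  obtain x where x: "x \<in> carrier_vec (Suc i)" "x \<noteq> 0\<^sub>v (Suc i)" "(B * V) *\<^sub>v x = 0\<^sub>v p"
    using wide_mat_kernel[of "B * V" p "Suc i"] i B V by auto
  define y where "y = V *\<^sub>v x"
  have y: "y \<in> carrier_vec n" using V x by (simp add: y_def)
  have nxy: "nsq y = nsq x" unfolding y_def by (rule orthonormal_nsq[OF V oV x(1)])
  have "B *\<^sub>v y = 0\<^sub>v p"
    using x B V by (simp add: y_def assoc_mult_mat_vec[of _ p n _ "Suc i"])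
  then have Ay: "nsq (A *\<^sub>v y) \<le> c\<^sup>2 * nsq x" using ker[OF y] nxy by simp
  have zero: "col Q j \<bullet> y = 0" if "Suc i \<le> j" "j < n" for j
  proof -
    have "transpose_mat V *\<^sub>v col Q j = 0\<^sub>v (Suc i)"
      using that V Q i orthonormal_col_scalar_prod[OF Q(1,2)]
      by (intro eq_vecI) (auto simp: colV)
    then have "y \<bullet> col Q j = 0"
      using scalar_prod_mult_mat_vec[OF V x(1) col_carrier_vec[OF _ Q(1)], of j] that x
      by (simp add: y_def)
    then show ?thesis using comm_scalar_prod[OF y col_carrier_vec[OF _ Q(1)], of j] that by simp
  qed
  have "(s i)\<^sup>2 * nsq x = (\<Sum>j<n. (s i)\<^sup>2 * (col Q j \<bullet> y)\<^sup>2)"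
    using nsq_orthonormal_coords[OF Q(1,2) y] nxy by (simp add: sum_distrib_left)
  also have "\<dots> \<le> (\<Sum>j<n. (s j)\<^sup>2 * (col Q j \<bullet> y)\<^sup>2)"
  proof (intro sum_mono)
    fix j assume j: "j \<in> {..<n}"
    show "(s i)\<^sup>2 * (col Q j \<bullet> y)\<^sup>2 \<le> (s j)\<^sup>2 * (col Q j \<bullet> y)\<^sup>2"
    proof (cases "j \<le> i")
      case True
      then show ?thesis using Q(3)[of i] Q(4)[of j i] i
        by (intro mult_right_mono power_mono) auto
    qed (use zero j in simp)
  qed
  also have "\<dots> \<le> c\<^sup>2 * nsq x" using Q(5)[OF y] Ay by simp
  finally have "(s i)\<^sup>2 * nsq x \<le> c\<^sup>2 * nsq x" .
  moreover have "0 < nsq x" using nsq_eq_0_iff[OF x(1)] x(2) nsq_nonneg[of x] by linarith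
  ultimately have "(s i)\<^sup>2 \<le> c\<^sup>2" by simp
  then show ?thesis using \<open>0 \<le> c\<close> by (rule power2_le_imp_le)
qed

subsection \<open>Frobenius norm\<close>

definition fro2 :: "real mat \<Rightarrow> real" where
  "fro2 A = (\<Sum>i<dim_row A. \<Sum>j<dim_col A. (A $$ (i,j))\<^sup>2)"

lemma fro2_nonneg [simp]: "0 \<le> fro2 A"
  by (simp add: fro2_def sum_nonneg)

lemma fro2_transpose [simp]: "fro2 (transpose_mat A) = fro2 A"
  unfolding fro2_def by (subst sum.swap) simp

lemma fro2_rows: "fro2 A = (\<Sum>i<dim_row A. nsq (row A i))"
  by (simp add: fro2_def nsq_sum)

lemma fro2_cols: "fro2 A = (\<Sum>j<dim_col A. nsq (col A j))"
  using fro2_rows[of "transpose_mat A"] by simp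

lemma fro2_add_le:
  assumes "A \<in> carrier_mat m n" "B \<in> carrier_mat m n"
  shows "fro2 (A + B) \<le> 2 * fro2 A + 2 * fro2 B"
proof -
  have "(\<Sum>i<m. nsq (row (A + B) i)) \<le> (\<Sum>i<m. 2 * nsq (row A i) + 2 * nsq (row B i))"
  proof (intro sum_mono)
    fix i assume "i \<in> {..<m}"
    then have "row (A + B) i = row A i + row B i"
      using assms by (intro row_add) auto
    then show "nsq (row (A + B) i) \<le> 2 * nsq (row A i) + 2 * nsq (row B i)"
      using assms \<open>i \<in> {..<m}\<close> nsq_add_le[of "row A i" n "row B i"] row_carrier_vec[of i m] by simp
  qed
  then show ?thesis using assms by (simp add: fro2_rows sum.distrib sum_distrib_left)
qed

lemma col_mult_mat_vec:
  fixes A B :: "real mat"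
  assumes "A \<in> carrier_mat m n" "B \<in> carrier_mat n p" "j < p"
  shows "col (A * B) j = A *\<^sub>v col B j"
  using assms by (intro eq_vecI) auto

lemma fro2_mult_left_le:
  assumes "A \<in> carrier_mat m n" "B \<in> carrier_mat n p"
    and "\<And>x. x \<in> carrier_vec n \<Longrightarrow> nsq (A *\<^sub>v x) \<le> c * nsq x"
  shows "fro2 (A * B) \<le> c * fro2 B"
proof -
  have "(\<Sum>j<p. nsq (col (A * B) j)) \<le> (\<Sum>j<p. c * nsq (col B j))"
    using col_mult_mat_vec[OF assms(1,2)] assms(3)[OF col_carrier_vec[OF _ assms(2)]]
    by (intro sum_mono) simp
  then show ?thesis using assms by (simp add: fro2_cols sum_distrib_left)
qed

lemma fro2_mult_left_ge:
  assumes "A \<in> carrier_mat m n" "B \<in> carrier_mat n p"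
    and "\<And>x. x \<in> carrier_vec n \<Longrightarrow> c * nsq x \<le> nsq (A *\<^sub>v x)"
  shows "c * fro2 B \<le> fro2 (A * B)"
proof -
  have "(\<Sum>j<p. c * nsq (col B j)) \<le> (\<Sum>j<p. nsq (col (A * B) j))"
    using col_mult_mat_vec[OF assms(1,2)] assms(3)[OF col_carrier_vec[OF _ assms(2)]]
    by (intro sum_mono) simp
  then show ?thesis using assms by (simp add: fro2_cols sum_distrib_left)
qed

lemma nsq_mult_mat_vec_le_fro2:
  assumes A: "A \<in> carrier_mat m n" and x: "x \<in> carrier_vec n"
  shows "nsq (A *\<^sub>v x) \<le> fro2 A * nsq x"
proof -
  have "nsq (A *\<^sub>v x) = (\<Sum>i<m. (row A i \<bullet> x)\<^sup>2)"
    using A by (simp add: nsq_sum)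
  also have "\<dots> \<le> (\<Sum>i<m. nsq (row A i) * nsq x)"
    using A x by (intro sum_mono scalar_prod_Cauchy_Schwarz[of _ n]) auto
  finally show ?thesis using A by (simp add: fro2_rows sum_distrib_right)
qed

lemma orthonormal_proj_decomp:
  assumes Q: "Q \<in> carrier_mat m r" "orthonormal_cols Q" and x: "x \<in> carrier_vec m"
  shows "nsq x = nsq (transpose_mat Q *\<^sub>v x) + nsq (x - Q *\<^sub>v (transpose_mat Q *\<^sub>v x))"
proof -
  define a where "a = transpose_mat Q *\<^sub>v x"
  have a: "a \<in> carrier_vec r" using Q x by (simp add: a_def)
  have 1: "(Q *\<^sub>v a) \<bullet> x = nsq a"
    using scalar_prod_mult_mat_vec[OF Q(1) a x] by (simp add: a_def)
  have 2: "nsq (Q *\<^sub>v a) = nsq a" by (rule orthonormal_nsq[OF Q a])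
  have c: "Q *\<^sub>v a \<in> carrier_vec m" using Q a by simp
  have "nsq (x - Q *\<^sub>v a) = nsq x - x \<bullet> (Q *\<^sub>v a) - ((Q *\<^sub>v a) \<bullet> x - nsq (Q *\<^sub>v a))"
    using x c by (simp add: minus_scalar_prod_distrib[of _ m] scalar_prod_minus_distrib[of _ m])
  also have "x \<bullet> (Q *\<^sub>v a) = (Q *\<^sub>v a) \<bullet> x" using x c by (rule comm_scalar_prod)
  finally show ?thesis using 1 2 by (simp add: a_def)
qed

lemma orthonormal_transpose_contraction:
  assumes "Q \<in> carrier_mat m r" "orthonormal_cols Q" "x \<in> carrier_vec m"
  shows "nsq (transpose_mat Q *\<^sub>v x) \<le> nsq x"
  using orthonormal_proj_decomp[OF assms] nsq_nonneg by (metis le_add_same_cancel1)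

lemma fro2_orthonormal:
  assumes "Q \<in> carrier_mat m r" "orthonormal_cols Q"
  shows "fro2 Q = r"
proof -
  have "nsq (col Q j) = 1" if "j < r" for j
    using orthonormal_col_scalar_prod[OF assms that that] by simp
  then show ?thesis using assms by (simp add: fro2_cols)
qed

subsection \<open>Schatten norms of matrices of low rank\<close>

text \<open>The Frobenius norm is unchanged when A is multiplied by the orthogonal Q of right
  singular vectors, and the columns of A * Q have the singular values as lengths.\<close>

lemma sum_sing_val_fro2:
  assumes A: "A \<in> carrier_mat m n"
  shows "(\<Sum>i<n. (singular_values A ! i)\<^sup>2) = fro2 A"
proof -
  obtain Q where Q: "Q \<in> carrier_mat n n" "orthonormal_cols Q"
    "length (singular_values A) = n"
    "\<And>i. i < n \<Longrightarrow> 0 \<le> singular_values A ! i"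
    "\<And>i j. i \<le> j \<Longrightarrow> j < n \<Longrightarrow> singular_values A ! j \<le> singular_values A ! i"
    "\<And>x. x \<in> carrier_vec n \<Longrightarrow>
       nsq (A *\<^sub>v x) = (\<Sum>i<n. (singular_values A ! i)\<^sup>2 * (col Q i \<bullet> x)\<^sup>2)"
    by (rule singular_values_spectral[OF A]) (rule that)
  have T: "orthonormal_cols (transpose_mat Q)"
    using orthonormal_square_transpose[OF Q(1,2)] Q by (simp add: orthonormal_cols_def)
  have "fro2 A = fro2 (transpose_mat Q * transpose_mat A)"
  proof -
    have "nsq (transpose_mat Q *\<^sub>v x) = nsq x" if "x \<in> carrier_vec n" for x
      using orthonormal_nsq[OF _ T that] Q by simp
    then show ?thesis
      using fro2_mult_left_le[of "transpose_mat Q" n n "transpose_mat A" m 1]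
        fro2_mult_left_ge[of "transpose_mat Q" n n "transpose_mat A" m 1] A Q by simp
  qed
  also have "\<dots> = fro2 (A * Q)"
    using A Q fro2_transpose[of "A * Q"] by (simp add: transpose_mult[of _ m n _ n])
  also have "\<dots> = (\<Sum>j<n. nsq (A *\<^sub>v col Q j))"
    using A Q(1) col_mult_mat_vec[OF A Q(1)] by (simp add: fro2_cols del: col_mult2)
  also have "\<dots> = (\<Sum>j<n. (singular_values A ! j)\<^sup>2)"
  proof (intro sum.cong refl)
    fix j assume j: "j \<in> {..<n}"
    then have "col Q j \<in> carrier_vec n" using Q by auto
    then have "nsq (A *\<^sub>v col Q j) = (\<Sum>i<n. (singular_values A ! i)\<^sup>2 * (col Q i \<bullet> col Q j)\<^sup>2)"
      by (rule Q(6))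
    also have "\<dots> = (\<Sum>i<n. if i = j then (singular_values A ! i)\<^sup>2 else 0)"
      using j orthonormal_col_scalar_prod[OF Q(1,2)] by (intro sum.cong) auto
    finally show "nsq (A *\<^sub>v col Q j) = (singular_values A ! j)\<^sup>2" using j by simp
  qed
  finally show ?thesis ..
qed

text \<open>Rank at most p is expressed by a matrix with p rows whose kernel is contained in that of
  A; such a matrix is easy to write down for a sum of two factored matrices.\<close>

lemma sing_val_eq_0_of_kernel:
  assumes A: "A \<in> carrier_mat m n" and B: "B \<in> carrier_mat p n"
    and ker: "\<And>x. x \<in> carrier_vec n \<Longrightarrow> B *\<^sub>v x = 0\<^sub>v p \<Longrightarrow> A *\<^sub>v x = 0\<^sub>v m"
    and i: "p \<le> i" "i < n"
  shows "singular_values A ! i = 0"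
proof -
  obtain Q where fr: "sv_frame A n Q (\<lambda>i. singular_values A ! i)"
    using sv_frame_singular_values[OF A] by blast
  have "singular_values A ! i \<le> 0"
    by (rule sv_frame_kernel_le[OF fr B _ _ i]) (simp_all add: ker)
  moreover have "0 \<le> singular_values A ! i" using sv_frameD(3)[OF fr i(2)] .
  ultimately show ?thesis by linarith
qed

text \<open>Concavity of the power q / 2, used through its tangent at the mean a of the squares:
  Young's inequality with weights q / 2 and 1 - q / 2 for \<open>(s i)^2 / a\<close> and 1. When
  summed, the tangents add up to exactly p.\<close>

lemma power_mean_powr:
  fixes s :: "nat \<Rightarrow> real"
  assumes s: "\<And>i. i < p \<Longrightarrow> 0 \<le> s i" and "0 < p" and q: "1 \<le> q" "q \<le> 2"
  shows "(\<Sum>i<p. s i powr q) powr (2 / q) \<le> real p powr (2 / q - 1) * (\<Sum>i<p. (s i)\<^sup>2)"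
proof (cases "(\<Sum>i<p. (s i)\<^sup>2) = 0")
  case True
  then have "s i = 0" if "i < p" for i
    using that by (simp add: sum_nonneg_eq_0_iff)
  then show ?thesis by simp
next
  case False
  define a where "a = (\<Sum>i<p. (s i)\<^sup>2) / p"
  have "0 \<le> (\<Sum>i<p. (s i)\<^sup>2)" by (intro sum_nonneg) auto
  with False have pos: "0 < (\<Sum>i<p. (s i)\<^sup>2)" by linarith
  have a: "0 < a" using pos \<open>0 < p\<close> by (simp add: a_def)
  have term_le: "s i powr q \<le> a powr (q / 2) * (q / 2 * ((s i)\<^sup>2 / a) + (1 - q / 2))" if i: "i < p" for i
  proof (cases "s i = 0")
    case True
    then show ?thesis using q a by simp
  next
    case False
    then have si: "0 < s i" using s[OF i] by simp
    have "((s i)\<^sup>2 / a) powr (q / 2) * 1 powr (1 - q / 2) \<le> q / 2 * ((s i)\<^sup>2 / a) + (1 - q / 2) * 1"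
      using q si a by (intro Youngs_inequality_0) auto
    moreover have "((s i)\<^sup>2 / a) powr (q / 2) = s i powr q / a powr (q / 2)"
    proof -
      have "(s i)\<^sup>2 powr (q / 2) = s i powr q"
        using si by (simp add: powr_powr flip: powr_numeral)
      then show ?thesis using si a by (simp add: powr_divide)
    qed
    ultimately have "s i powr q / a powr (q / 2) \<le> q / 2 * ((s i)\<^sup>2 / a) + (1 - q / 2)" by simp
    then show ?thesis using a by (simp add: pos_divide_le_eq mult.commute)
  qed
  have "(\<Sum>i<p. s i powr q) \<le> (\<Sum>i<p. a powr (q / 2) * (q / 2 * ((s i)\<^sup>2 / a) + (1 - q / 2)))"
    using term_le by (intro sum_mono) auto
  also have "\<dots> = a powr (q / 2) * (q / 2 * ((\<Sum>i<p. (s i)\<^sup>2) / a) + p * (1 - q / 2))"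
    by (simp add: sum.distrib flip: sum_distrib_left sum_divide_distrib)
  also have "(\<Sum>i<p. (s i)\<^sup>2) / a = p" using pos by (simp add: a_def)
  also have "q / 2 * real p + p * (1 - q / 2) = p" by (simp add: algebra_simps)
  finally have "(\<Sum>i<p. s i powr q) powr (2 / q) \<le> (a powr (q / 2) * p) powr (2 / q)"
    using q by (intro powr_mono2) (auto intro!: sum_nonneg)
  also have "\<dots> = a * real p powr (2 / q)"
    using q a by (simp add: powr_mult powr_powr)
  also have "\<dots> = real p powr (2 / q - 1) * (\<Sum>i<p. (s i)\<^sup>2)"
    using \<open>0 < p\<close> by (simp add: a_def powr_diff)
  finally show ?thesis .
qed

lemma schatten_norm_low_rank:
  assumes A: "A \<in> carrier_mat m n" and B: "B \<in> carrier_mat p n" and p: "0 < p"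
    and ker: "\<And>x. x \<in> carrier_vec n \<Longrightarrow> B *\<^sub>v x = 0\<^sub>v p \<Longrightarrow> A *\<^sub>v x = 0\<^sub>v m"
    and q: "1 \<le> q" "q \<le> 2"
  shows "(schatten_norm q A)\<^sup>2 \<le> real p powr (2 / q - 1) * fro2 A"
proof -
  obtain Q where Q: "Q \<in> carrier_mat n n" "orthonormal_cols Q"
    "length (singular_values A) = n"
    "\<And>i. i < n \<Longrightarrow> 0 \<le> singular_values A ! i"
    "\<And>i j. i \<le> j \<Longrightarrow> j < n \<Longrightarrow> singular_values A ! j \<le> singular_values A ! i"
    "\<And>x. x \<in> carrier_vec n \<Longrightarrow>
       nsq (A *\<^sub>v x) = (\<Sum>i<n. (singular_values A ! i)\<^sup>2 * (col Q i \<bullet> x)\<^sup>2)"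
    by (rule singular_values_spectral[OF A]) (rule that)
  note len = Q(3) and nn = Q(4)
  \<comment> \<open>The sequence is continued by zeros because p may exceed n.\<close>
  define s where "s i = (if i < n then singular_values A ! i else 0)" for i
  have s0: "0 \<le> s i" for i using nn by (simp add: s_def)
  have sz: "s i = 0" if "p \<le> i" for i
    using sing_val_eq_0_of_kernel[OF A B ker that] by (simp add: s_def)
  have cut: "(\<Sum>i<n. f (s i)) = (\<Sum>i<p. f (s i))" if "f 0 = 0" for f :: "real \<Rightarrow> real"
  proof -
    have "(\<Sum>i<n. f (s i)) = (\<Sum>i<max n p. f (s i))"
      using that by (intro sum.mono_neutral_left) (auto simp: s_def)
    also have "\<dots> = (\<Sum>i<p. f (s i))"
      using that sz by (intro sum.mono_neutral_right) auto
    finally show ?thesis .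
  qed
  have "(\<Sum>x\<leftarrow>singular_values A. x powr q) = (\<Sum>i<n. s i powr q)"
    unfolding sum_list_sum_nth by (simp add: len s_def atLeast0LessThan)
  also have "\<dots> = (\<Sum>i<p. s i powr q)" by (rule cut) simp
  finally have "(schatten_norm q A)\<^sup>2 = ((\<Sum>i<p. s i powr q) powr (1 / q))\<^sup>2"
    by (simp add: schatten_norm_def)
  also have "\<dots> = (\<Sum>i<p. s i powr q) powr (2 / q)"
    by (simp add: power2_eq_square flip: powr_add)
  also have "\<dots> \<le> real p powr (2 / q - 1) * (\<Sum>i<p. (s i)\<^sup>2)"
    using s0 p q by (intro power_mean_powr) auto
  also have "(\<Sum>i<p. (s i)\<^sup>2) = (\<Sum>i<n. (singular_values A ! i)\<^sup>2)"
    using cut[of "\<lambda>x. x\<^sup>2"] by (simp add: s_def)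
  also have "\<dots> = fro2 A" by (rule sum_sing_val_fro2[OF A])
  finally show ?thesis .
qed

section \<open>Nets in convex bodies\<close>

text \<open>
  A doubling argument on a fine lattice replaces the comparison of volumes.
\<close>

locale lattice_body =
  fixes B :: "('i \<Rightarrow> real) set" and D :: "'i set" and a0 :: real
  assumes fin: "finite D"
    and supp: "x \<in> B \<Longrightarrow> i \<notin> D \<Longrightarrow> x i = 0"
    and conv: "x \<in> B \<Longrightarrow> y \<in> B \<Longrightarrow> 0 \<le> t \<Longrightarrow> t \<le> 1 \<Longrightarrow> (\<lambda>i. (1 - t) * x i + t * y i) \<in> B"
    and sym: "x \<in> B \<Longrightarrow> (\<lambda>i. - x i) \<in> B"
    and a0: "0 < a0"
    and cube: "(\<And>i. i \<in> D \<Longrightarrow> \<bar>x i\<bar> \<le> a0) \<Longrightarrow> (\<And>i. i \<notin> D \<Longrightarrow> x i = 0) \<Longrightarrow> x \<in> B"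
    and bdd: "x \<in> B \<Longrightarrow> \<bar>x i\<bar> \<le> 1"
begin

definition inb :: "real \<Rightarrow> ('i \<Rightarrow> real) \<Rightarrow> bool" where
  "inb R x \<longleftrightarrow> (\<exists>y\<in>B. x = (\<lambda>i. R * y i))"

lemma zero_mem: "(\<lambda>i. 0) \<in> B"
  using a0 by (intro cube) auto

lemma inb_zero: "inb R (\<lambda>i. 0)"
  unfolding inb_def using zero_mem by (intro bexI[of _ "\<lambda>i. 0"]) auto

lemma inb_add:
  assumes "inb R x" "inb S y" "0 \<le> R" "0 \<le> S"
  shows "inb (R + S) (\<lambda>i. x i + y i)"
proof (cases "R + S = 0")
  case True
  then have "R = 0" "S = 0" using assms by auto
  then show ?thesis using assms inb_zero by (auto simp: inb_def)
next
  case False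
  then have pos: "0 < R + S" using assms by linarith
  obtain x' y' where xy: "x' \<in> B" "y' \<in> B" "x = (\<lambda>i. R * x' i)" "y = (\<lambda>i. S * y' i)"
    using assms by (auto simp: inb_def)
  have "(\<lambda>i. (1 - S / (R + S)) * x' i + S / (R + S) * y' i) \<in> B"
    using pos assms xy by (intro conv) auto
  moreover have "x i + y i = (R + S) * ((1 - S / (R + S)) * x' i + S / (R + S) * y' i)" for i
  proof -
    have "(R + S) * (S / (R + S)) = S" "(R + S) * (1 - S / (R + S)) = R"
      using pos by (simp_all add: right_diff_distrib)
    then show ?thesis unfolding xy distrib_left mult.assoc[symmetric] by simp
  qed
  ultimately show ?thesis unfolding inb_def
    by (intro bexI[of _ "\<lambda>i. (1 - S / (R + S)) * x' i + S / (R + S) * y' i"]) auto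
qed

lemma inb_mono: "inb R x \<Longrightarrow> 0 \<le> R \<Longrightarrow> R \<le> S \<Longrightarrow> inb S x"
  using inb_add[of R x "S - R" "\<lambda>i. 0"] inb_zero by simp

lemma inb_neg: "inb R x \<Longrightarrow> inb R (\<lambda>i. - x i)"
  unfolding inb_def using sym by (metis mult_minus_right)

lemma inb_diff: "inb R x \<Longrightarrow> inb S y \<Longrightarrow> 0 \<le> R \<Longrightarrow> 0 \<le> S \<Longrightarrow> inb (R + S) (\<lambda>i. x i - y i)"
  using inb_add[of R x S "\<lambda>i. - y i"] inb_neg[of S y] by simp

lemma inb_half: "inb R x \<Longrightarrow> inb (R / 2) (\<lambda>i. x i / 2)"
  unfolding inb_def by auto

lemma inb_cube:
  assumes "0 < R" "\<And>i. i \<in> D \<Longrightarrow> \<bar>x i\<bar> \<le> R * a0" "\<And>i. i \<notin> D \<Longrightarrow> x i = 0"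
  shows "inb R x"
proof -
  have "(\<lambda>i. x i / R) \<in> B"
    using assms by (intro cube) (auto simp: divide_le_eq mult.commute)
  then show ?thesis unfolding inb_def using assms(1) by (intro bexI[of _ "\<lambda>i. x i / R"]) auto
qed

lemma inb_bdd: "inb R x \<Longrightarrow> 0 \<le> R \<Longrightarrow> \<bar>x i\<bar> \<le> R"
  unfolding inb_def using bdd by (auto simp: abs_mult mult_left_le)

section \<open>Counting lattice points in dilates of the body\<close>

definition lat :: "real \<Rightarrow> real \<Rightarrow> ('i \<Rightarrow> int) set" where
  "lat h R = {a. (\<forall>i. i \<notin> D \<longrightarrow> a i = 0) \<and> inb R (\<lambda>i. h * of_int (a i))}"

lemma finite_lat:
  assumes "0 < h" "0 \<le> R"
  shows "finite (lat h R)"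
proof -
  let ?K = "\<lceil>R / h\<rceil>"
  have "lat h R \<subseteq> {f. \<forall>x. (x \<in> D \<longrightarrow> f x \<in> {-?K..?K}) \<and> (x \<notin> D \<longrightarrow> f x = 0)}"
  proof
    fix a assume a: "a \<in> lat h R"
    have "\<bar>a i\<bar> \<le> ?K" for i
    proof -
      have "\<bar>h * of_int (a i)\<bar> \<le> R"
        using a assms inb_bdd unfolding lat_def by fastforce
      then have "real_of_int \<bar>a i\<bar> \<le> R / h"
        using assms by (simp add: abs_mult field_simps)
      then show ?thesis by linarith
    qed
    then show "a \<in> {f. \<forall>x. (x \<in> D \<longrightarrow> f x \<in> {-?K..?K}) \<and> (x \<notin> D \<longrightarrow> f x = 0)}"
      using a by (auto simp: lat_def abs_le_iff minus_le_iff)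
  qed
  then show ?thesis
    by (rule finite_subset) (intro finite_set_of_finite_funs; simp add: fin)
qed

lemma lat_mono: "0 \<le> R \<Longrightarrow> R \<le> S \<Longrightarrow> lat h R \<subseteq> lat h S"
  unfolding lat_def using inb_mono by blast

text \<open>A lattice point a is determined by its integer half and the set of its odd coordinates,
  which accounts for the factor \<open>2 ^ card D\<close>. Halving with rounding moves a / 2 by at
  most h / 2 per coordinate, hence by an element of \<epsilon> B.\<close>

lemma lat_doubling:
  assumes h: "0 < h" "h = \<epsilon> * a0" and R: "0 \<le> R"
  shows "card (lat h R) \<le> 2 ^ card D * card (lat h (R / 2 + \<epsilon>))"
proof -
  have e: "0 < \<epsilon>" using h a0 by (simp add: zero_less_mult_iff)
  let ?f = "\<lambda>a :: 'i \<Rightarrow> int. (\<lambda>i. a i div 2, {i \<in> D. odd (a i)})"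
  have inj: "inj_on ?f (lat h R)"
  proof (rule inj_onI)
    fix a b assume ab: "a \<in> lat h R" "b \<in> lat h R" "?f a = ?f b"
    have "a i = b i" for i
    proof (cases "i \<in> D")
      case True
      have "a i div 2 = b i div 2" using ab(3) by (auto dest: fun_cong)
      moreover have "odd (a i) = odd (b i)" using ab(3) True by auto
      ultimately show ?thesis by presburger
    qed (use ab in \<open>auto simp: lat_def\<close>)
    then show "a = b" by auto
  qed
  have sub: "?f ` lat h R \<subseteq> lat h (R / 2 + \<epsilon>) \<times> Pow D"
  proof
    fix p assume "p \<in> ?f ` lat h R"
    then obtain a where a: "a \<in> lat h R" "p = ?f a" by blast
    have 1: "inb (R / 2) (\<lambda>i. h * of_int (a i) / 2)"
      using a by (intro inb_half) (auto simp: lat_def)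
    have 2: "inb \<epsilon> (\<lambda>i. - h * of_int (a i mod 2) / 2)"
    proof (rule inb_cube)
      fix i assume "i \<in> D"
      have "0 \<le> a i mod 2" "a i mod 2 \<le> 1" by auto
      then have "\<bar>real_of_int (a i mod 2)\<bar> \<le> 1" by linarith
      then have "h * \<bar>real_of_int (a i mod 2)\<bar> \<le> h * 1"
        using h(1) by (intro mult_left_mono) auto
      moreover have "\<bar>- h * of_int (a i mod 2) / 2\<bar> = h * \<bar>real_of_int (a i mod 2)\<bar> / 2"
        using h(1) by (simp add: abs_mult)
      ultimately show "\<bar>- h * of_int (a i mod 2) / 2\<bar> \<le> \<epsilon> * a0"
        using h by linarith
    next
      show "- h * of_int (a i mod 2) / 2 = 0" if "i \<notin> D" for i
        using that a by (simp add: lat_def)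
    qed (rule e)
    have "h * of_int (a i) / 2 + - h * of_int (a i mod 2) / 2 = h * of_int (a i div 2)" for i
    proof -
      have "real_of_int (a i) = 2 * of_int (a i div 2) + of_int (a i mod 2)"
        using arg_cong[OF mult_div_mod_eq[of 2 "a i", symmetric], of real_of_int]
        by (simp only: of_int_add of_int_mult of_int_numeral)
      then show ?thesis by (simp add: algebra_simps)
    qed
    then have "inb (R / 2 + \<epsilon>) (\<lambda>i. h * of_int (a i div 2))"
      using inb_add[OF 1 2] R e by simp
    then show "p \<in> lat h (R / 2 + \<epsilon>) \<times> Pow D"
      using a by (auto simp: lat_def)
  qed
  have "card (lat h R) \<le> card (lat h (R / 2 + \<epsilon>) \<times> Pow D)"
    using fin finite_lat[OF h(1), of "R / 2 + \<epsilon>"] R e by (intro card_inj_on_le[OF inj sub] finite_cartesian_product) auto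
  then show ?thesis using fin by (simp add: card_cartesian_product card_Pow mult.commute)
qed

text \<open>The radius 2 * \<epsilon> is fixed by R -> R / 2 + \<epsilon>, so radii of the form 2 /
  2^j + 2 * \<epsilon> pass into each other exactly.\<close>

lemma lat_doubling_iterate:
  assumes h: "0 < h" "h = \<epsilon> * a0"
  shows "card (lat h 2) \<le> 2 ^ (j * card D) * card (lat h (2 / 2 ^ j + 2 * \<epsilon>))"
proof (induction j)
  case 0
  have "0 < \<epsilon>" using h a0 by (simp add: zero_less_mult_iff)
  then show ?case using finite_lat[OF h(1)] lat_mono[of 2 "2 + 2 * \<epsilon>" h]
    by (auto intro!: card_mono)
next
  case (Suc j)
  have e: "0 < \<epsilon>" using h a0 by (simp add: zero_less_mult_iff)
  have "card (lat h (2 / 2 ^ j + 2 * \<epsilon>)) \<le>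
      2 ^ card D * card (lat h ((2 / 2 ^ j + 2 * \<epsilon>) / 2 + \<epsilon>))"
    using e by (intro lat_doubling[OF h]) auto
  also have "(2 / 2 ^ j + 2 * \<epsilon>) / 2 + \<epsilon> = 2 / 2 ^ Suc j + 2 * \<epsilon>"
    by (simp add: field_simps)
  finally have "2 ^ (j * card D) * card (lat h (2 / 2 ^ j + 2 * \<epsilon>)) \<le>
     2 ^ (j * card D) * (2 ^ card D * card (lat h (2 / 2 ^ Suc j + 2 * \<epsilon>)))"
    by (intro mult_left_mono) auto
  also have "2 ^ (j * card D) * (2 ^ card D * card (lat h (2 / 2 ^ Suc j + 2 * \<epsilon>))) =
      2 ^ (Suc j * card D) * card (lat h (2 / 2 ^ Suc j + 2 * \<epsilon>))"
    by (simp only: mult_Suc power_add mult.assoc mult.left_commute)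
  finally show ?case using Suc by linarith
qed

text \<open>The lattice analogue of packing disjoint balls. Points of T, rounded to the lattice,
  translate the lattice points of (\<rho> / 4) B. Two coinciding translates would bring points of T
  within 2 * \<epsilon> + \<rho> / 2 < \<rho> of each other, and all translates lie in 2 B. After J
  doublings the radius is at most \<rho> / 16 + \<rho> / 8 < \<rho> / 4, so the count of lattice
  points cancels, and with it the mesh and \<open>a0\<close>.\<close>

lemma separated_card:
  assumes \<rho>: "0 < \<rho>" "\<rho> \<le> 1" and J: "32 / \<rho> \<le> 2 ^ J"
    and T: "finite T" "T \<subseteq> B" "\<And>x y. x \<in> T \<Longrightarrow> y \<in> T \<Longrightarrow> x \<noteq> y \<Longrightarrow> \<not> inb \<rho> (\<lambda>i. x i - y i)"
  shows "card T \<le> 2 ^ (J * card D)"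
proof -
  define \<epsilon> where "\<epsilon> = \<rho> / 16"
  define h where "h = \<epsilon> * a0"
  have e: "0 < \<epsilon>" and h: "0 < h" using \<rho> a0 by (auto simp: \<epsilon>_def h_def)
  define rnd where "rnd x i = (if i \<in> D then \<lfloor>x i / h\<rfloor> else 0)" for x :: "'i \<Rightarrow> real" and i
  have rnd: "inb \<epsilon> (\<lambda>i. x i - h * of_int (rnd x i))" if "x \<in> B" for x
  proof (rule inb_cube[OF e])
    fix i assume "i \<in> D"
    have "0 \<le> x i / h - of_int \<lfloor>x i / h\<rfloor>" "x i / h - of_int \<lfloor>x i / h\<rfloor> \<le> 1" by linarith+
    then have "0 \<le> (x i / h - of_int \<lfloor>x i / h\<rfloor>) * h" "(x i / h - of_int \<lfloor>x i / h\<rfloor>) * h \<le> 1 * h"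
      using h by (auto intro!: mult_right_mono)
    moreover have "x i - h * of_int (rnd x i) = (x i / h - of_int \<lfloor>x i / h\<rfloor>) * h"
      using h \<open>i \<in> D\<close> by (simp add: rnd_def field_simps)
    ultimately show "\<bar>x i - h * of_int (rnd x i)\<bar> \<le> \<epsilon> * a0" by (simp add: h_def)
  qed (use that supp in \<open>auto simp: rnd_def\<close>)
  let ?f = "\<lambda>(t, b). (\<lambda>i. rnd t i + b i :: int)"
  have inj: "inj_on ?f (T \<times> lat h (\<rho> / 4))"
  proof (rule inj_onI)
    fix p p' assume p: "p \<in> T \<times> lat h (\<rho> / 4)" "p' \<in> T \<times> lat h (\<rho> / 4)" "?f p = ?f p'"
    obtain t b t' b' where tb: "p = (t,b)" "p' = (t',b')" by (cases p, cases p')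
    have eq: "rnd t i + b i = rnd t' i + b' i" for i
      using p(3) tb by (auto dest: fun_cong)
    have tB: "t \<in> B" "t' \<in> B" using p tb T by auto
    have "inb (\<epsilon> + \<epsilon>) (\<lambda>i. (t i - h * of_int (rnd t i)) - (t' i - h * of_int (rnd t' i)))"
      using rnd[OF tB(1)] rnd[OF tB(2)] e by (intro inb_diff) auto
    moreover have "inb (\<rho> / 4 + \<rho> / 4) (\<lambda>i. h * of_int (b' i) - h * of_int (b i))"
      using p tb \<rho> by (intro inb_diff) (auto simp: lat_def)
    ultimately have "inb ((\<epsilon> + \<epsilon>) + (\<rho> / 4 + \<rho> / 4))
       (\<lambda>i. ((t i - h * of_int (rnd t i)) - (t' i - h * of_int (rnd t' i))) +
            (h * of_int (b' i) - h * of_int (b i)))"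
      using e \<rho> by (intro inb_add) auto
    moreover have "((t i - h * of_int (rnd t i)) - (t' i - h * of_int (rnd t' i))) +
            (h * of_int (b' i) - h * of_int (b i)) = t i - t' i" for i
    proof -
      have "real_of_int (rnd t i) + of_int (b i) = of_int (rnd t' i) + of_int (b' i)"
        using eq[of i] by (metis of_int_add)
      then have "h * (real_of_int (rnd t i) + of_int (b i)) = h * (of_int (rnd t' i) + of_int (b' i))"
        by simp
      then show ?thesis by (simp add: algebra_simps)
    qed
    ultimately have "inb ((\<epsilon> + \<epsilon>) + (\<rho> / 4 + \<rho> / 4)) (\<lambda>i. t i - t' i)" by simp
    then have "inb \<rho> (\<lambda>i. t i - t' i)"
      by (rule inb_mono) (use \<rho> in \<open>auto simp: \<epsilon>_def\<close>)
    then have "t = t'" using T(3) p tb by auto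
    then have "b = b'" using eq by auto
    with \<open>t = t'\<close> tb show "p = p'" by simp
  qed
  have sub: "?f ` (T \<times> lat h (\<rho> / 4)) \<subseteq> lat h 2"
  proof
    fix a assume "a \<in> ?f ` (T \<times> lat h (\<rho> / 4))"
    then obtain t b where tb: "t \<in> T" "b \<in> lat h (\<rho> / 4)" "a = (\<lambda>i. rnd t i + b i)" by auto
    have tB: "t \<in> B" using tb T by auto
    then have "inb 1 t" by (auto simp: inb_def)
    then have "inb (1 + \<epsilon>) (\<lambda>i. t i - (t i - h * of_int (rnd t i)))"
      using rnd[OF tB] e by (intro inb_diff) auto
    then have "inb ((1 + \<epsilon>) + \<rho> / 4) (\<lambda>i. (t i - (t i - h * of_int (rnd t i))) + h * of_int (b i))"
      using tb e \<rho> by (intro inb_add) (auto simp: lat_def)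
    then have "inb ((1 + \<epsilon>) + \<rho> / 4) (\<lambda>i. h * of_int (a i))"
      by (simp add: tb(3) algebra_simps)
    then have "inb 2 (\<lambda>i. h * of_int (a i))"
      by (rule inb_mono) (use \<rho> in \<open>auto simp: \<epsilon>_def\<close>)
    then show "a \<in> lat h 2" using tb by (auto simp: lat_def rnd_def)
  qed
  have fin4: "finite (lat h (\<rho> / 4))" using h \<rho> by (intro finite_lat) auto
  have "(\<lambda>i. 0) \<in> lat h (\<rho> / 4)" using inb_zero by (simp add: lat_def)
  then have pos: "0 < card (lat h (\<rho> / 4))" using fin4 by (auto simp: card_gt_0_iff)
  have "card T * card (lat h (\<rho> / 4)) \<le> card (lat h 2)"
    using card_inj_on_le[OF inj sub] finite_lat[OF h, of 2] by (simp add: card_cartesian_product)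
  also have "\<dots> \<le> 2 ^ (J * card D) * card (lat h (2 / 2 ^ J + 2 * \<epsilon>))"
    by (rule lat_doubling_iterate[OF h h_def])
  also have "\<dots> \<le> 2 ^ (J * card D) * card (lat h (\<rho> / 4))"
  proof -
    have "2 / 2 ^ J \<le> \<rho> / 16" using J \<rho> by (simp add: field_simps)
    then have "lat h (2 / 2 ^ J + 2 * \<epsilon>) \<subseteq> lat h (\<rho> / 4)"
      using e \<rho> by (intro lat_mono) (auto simp: \<epsilon>_def)
    then show ?thesis using fin4 by (intro mult_left_mono card_mono) auto
  qed
  finally show ?thesis using pos by simp
qed

text \<open>A separated set of largest cardinality is a net, since a point not covered by it could
  be added. Covering is expressed by the body itself: the rescaled remainder belongs to B again,
  which allows a self-improving estimate on the whole body.\<close>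

lemma ex_net:
  assumes \<rho>: "0 < \<rho>" "\<rho> \<le> 1" and J: "32 / \<rho> \<le> 2 ^ J"
  shows "\<exists>N. finite N \<and> N \<subseteq> B \<and> card N \<le> 2 ^ (J * card D) \<and>
    (\<forall>x\<in>B. \<exists>y\<in>N. (\<lambda>i. (x i - y i) / \<rho>) \<in> B)"
proof -
  define sep where "sep T \<longleftrightarrow> finite T \<and> T \<subseteq> B \<and>
    (\<forall>x\<in>T. \<forall>y\<in>T. x \<noteq> y \<longrightarrow> \<not> inb \<rho> (\<lambda>i. x i - y i))" for T
  have bd: "card T \<le> 2 ^ (J * card D)" if "sep T" for T
    using that unfolding sep_def by (intro separated_card[OF \<rho> J]) auto
  have "\<exists>N. sep N \<and> (\<forall>T. sep T \<longrightarrow> card T \<le> card N)"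
  proof (rule ex_has_greatest_nat)
    show "sep {}" by (simp add: sep_def)
    show "\<forall>T. sep T \<longrightarrow> card T < Suc (2 ^ (J * card D))"
      using bd by (intro allI impI le_imp_less_Suc)
  qed
  then obtain N where N: "sep N" "\<And>T. sep T \<Longrightarrow> card T \<le> card N" by blast
  have "\<exists>y\<in>N. (\<lambda>i. (x i - y i) / \<rho>) \<in> B" if x: "x \<in> B" for x
  proof -
    have "\<exists>y\<in>N. inb \<rho> (\<lambda>i. x i - y i)"
    proof (rule ccontr)
      assume *: "\<not> ?thesis"
      then have "x \<notin> N" using inb_zero by fastforce
      have "\<not> inb \<rho> (\<lambda>i. y i - x i)" if "y \<in> N" for y
        using * that inb_neg[of \<rho> "\<lambda>i. y i - x i"] by auto
      then have "sep (insert x N)" using N(1) x * by (auto simp: sep_def)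
      then have "card (insert x N) \<le> card N" by (rule N(2))
      then show False using \<open>x \<notin> N\<close> N(1) by (simp add: sep_def)
    qed
    then obtain y z where "y \<in> N" "z \<in> B" "(\<lambda>i. x i - y i) = (\<lambda>i. \<rho> * z i)"
      by (auto simp: inb_def)
    then have "(\<lambda>i. (x i - y i) / \<rho>) = z" using \<rho> by (auto simp: fun_eq_iff)
    then show ?thesis using \<open>y \<in> N\<close> \<open>z \<in> B\<close> by auto
  qed
  note cover = this
  show ?thesis
  proof (intro exI[of _ N] conjI ballI)
    show "finite N" "N \<subseteq> B" using N(1) by (auto simp: sep_def)
    show "card N \<le> 2 ^ (J * card D)" by (rule bd) (rule N(1))
    show "\<exists>y\<in>N. (\<lambda>i. (x i - y i) / \<rho>) \<in> B" if "x \<in> B" for x by (rule cover) fact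
  qed
qed

end

section \<open>Thresholded squares\<close>

text \<open>Above the level the full value is kept, not the difference to T, since a row that
  survives the thresholding brings its whole energy along.\<close>

definition excess :: "real \<Rightarrow> real \<Rightarrow> real" where
  "excess T y = (if T < y then y else 0)"

lemma excess_nonneg: "0 \<le> y \<Longrightarrow> 0 \<le> excess T y"
  by (simp add: excess_def)

lemma excess_le: "0 \<le> y \<Longrightarrow> excess T y \<le> y"
  by (simp add: excess_def)

lemma excess_antimono: "0 \<le> y \<Longrightarrow> S \<le> T \<Longrightarrow> excess T y \<le> excess S y"
  by (simp add: excess_def)

text \<open>If y > g, then a exceeds 0.999 g or b exceeds g / 1000. If only a does, b is below a /
  999 and y is at most 1.01 a. If only b does, a is below 999 b and y is at most 1000 b. If both do,
  y^2 is at most 2 a^2 + 2 b^2. The main part a thus keeps almost the whole level.\<close>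

lemma excess_split:
  fixes a b y g :: real
  assumes "0 \<le> a" "0 \<le> b" "0 \<le> y" "0 \<le> g" and y: "y \<le> a + b"
  shows "excess (g\<^sup>2) (y\<^sup>2) \<le> 3 * excess ((999 / 1000 * g)\<^sup>2) (a\<^sup>2) + 2000000 * excess ((g / 1000)\<^sup>2) (b\<^sup>2)"
proof (cases "g < y")
  case False
  then have "y\<^sup>2 \<le> g\<^sup>2" using assms by (intro power_mono) auto
  then show ?thesis by (simp add: excess_def)
next
  case True
  have ea: "excess ((999 / 1000 * g)\<^sup>2) (a\<^sup>2) = a\<^sup>2" if "999 / 1000 * g < a"
    using power_strict_mono[OF that, of 2] assms by (simp add: excess_def)
  have eb: "excess ((g / 1000)\<^sup>2) (b\<^sup>2) = b\<^sup>2" if "g / 1000 < b"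
    using power_strict_mono[OF that, of 2] assms by (simp add: excess_def)
  have ey: "excess (g\<^sup>2) (y\<^sup>2) \<le> y\<^sup>2" by (rule excess_le) simp
  have na: "0 \<le> excess ((999 / 1000 * g)\<^sup>2) (a\<^sup>2)" and nb: "0 \<le> excess ((g / 1000)\<^sup>2) (b\<^sup>2)"
    by (auto intro: excess_nonneg)
  show ?thesis
  proof (cases "999 / 1000 * g < a")
    case a: True
    show ?thesis
    proof (cases "g / 1000 < b")
      case b: True
      have "y\<^sup>2 \<le> (a + b)\<^sup>2" using y assms by (intro power_mono) auto
      also have "\<dots> \<le> 2 * a\<^sup>2 + 2 * b\<^sup>2"
        using sum_squares_bound[of a b] by (simp add: power2_sum)
      also have "\<dots> \<le> 3 * a\<^sup>2 + 2000000 * b\<^sup>2" by simp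
      finally show ?thesis using ey ea[OF a] eb[OF b] by simp
    next
      case False
      then have "y \<le> 101 / 100 * a" using y a assms(1) by linarith
      then have "y\<^sup>2 \<le> (101 / 100 * a)\<^sup>2" using assms by (intro power_mono) auto
      also have "\<dots> \<le> 3 * a\<^sup>2" by (simp add: power2_eq_square)
      finally show ?thesis using ey ea[OF a] nb by simp
    qed
  next
    case a: False
    then have b: "g / 1000 < b" using y True by linarith
    then have "y \<le> 1000 * b" using y a by linarith
    then have "y\<^sup>2 \<le> (1000 * b)\<^sup>2" using assms by (intro power_mono) auto
    also have "\<dots> \<le> 2000000 * b\<^sup>2" by (simp add: power2_eq_square)
    finally show ?thesis using ey eb[OF b] na by simp
  qed
qed

text \<open>It repairs the low level g / 1000 which \<open>excess_split\<close> leaves to the small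
  part: a factor \<rho> of at most 1/1000 in front of c lifts the level back to g and comes out
  squared.\<close>

lemma excess_scale:
  fixes c g \<rho> :: real
  assumes "0 \<le> c" "0 \<le> g" "0 \<le> \<rho>" "\<rho> \<le> 1 / 1000"
  shows "excess ((g / 1000)\<^sup>2) ((\<rho> * c)\<^sup>2) \<le> \<rho>\<^sup>2 * excess (g\<^sup>2) (c\<^sup>2)"
proof (cases "g / 1000 < \<rho> * c")
  case True
  have "\<rho> * c \<le> 1 / 1000 * c" using assms by (intro mult_right_mono) auto
  then have "g < c" using True by linarith
  then have "excess (g\<^sup>2) (c\<^sup>2) = c\<^sup>2"
    using power_strict_mono[of g c 2] assms by (simp add: excess_def)
  then show ?thesis using excess_le[of "(\<rho> * c)\<^sup>2" "(g / 1000)\<^sup>2"] by (simp add: power_mult_distrib)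
next
  case False
  then have "(\<rho> * c)\<^sup>2 \<le> (g / 1000)\<^sup>2" using assms by (intro power_mono) auto
  then have "excess ((g / 1000)\<^sup>2) ((\<rho> * c)\<^sup>2) = 0" by (simp add: excess_def)
  then show ?thesis using excess_nonneg[of "c\<^sup>2" "g\<^sup>2"] by simp
qed

section \<open>Gaussian tail bounds\<close>

abbreviation gn :: "real \<Rightarrow> real measure" where
  "gn \<sigma> \<equiv> density lborel (\<lambda>x. ennreal (normal_density 0 \<sigma> x))"

lemma prob_space_gn: "0 < \<sigma> \<Longrightarrow> prob_space (gn \<sigma>)"
  by (rule prob_space_normal_density)

lemma nn_integral_normal_density:
  "0 < \<sigma> \<Longrightarrow> (\<integral>\<^sup>+x. ennreal (normal_density \<mu> \<sigma> x) \<partial>lborel) = 1"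
  by (subst nn_integral_eq_integral) auto

lemma gn_exp_linear:
  assumes \<sigma>: "0 < \<sigma>"
  shows "(\<integral>\<^sup>+x. ennreal (exp (c * x)) \<partial>gn \<sigma>) = ennreal (exp (\<sigma>\<^sup>2 / 2 * c\<^sup>2))"
proof -
  have *: "normal_density 0 \<sigma> x * exp (c * x) = exp (\<sigma>\<^sup>2 / 2 * c\<^sup>2) * normal_density (c * \<sigma>\<^sup>2) \<sigma> x" for x
  proof -
    have "- (x - 0)\<^sup>2 / (2 * \<sigma>\<^sup>2) + c * x = \<sigma>\<^sup>2 / 2 * c\<^sup>2 + - (x - c * \<sigma>\<^sup>2)\<^sup>2 / (2 * \<sigma>\<^sup>2)"
      using \<sigma> by (simp add: field_simps power2_eq_square)
    then show ?thesis
      unfolding normal_density_def by (simp add: mult.left_commute mult.commute flip: exp_add)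
  qed
  have "(\<integral>\<^sup>+x. ennreal (exp (c * x)) \<partial>gn \<sigma>) =
      (\<integral>\<^sup>+x. ennreal (exp (\<sigma>\<^sup>2 / 2 * c\<^sup>2)) * ennreal (normal_density (c * \<sigma>\<^sup>2) \<sigma> x) \<partial>lborel)"
    by (subst nn_integral_density) (auto simp: * simp flip: ennreal_mult intro!: nn_integral_cong)
  also have "\<dots> = ennreal (exp (\<sigma>\<^sup>2 / 2 * c\<^sup>2))"
    using \<sigma> by (subst nn_integral_cmult) (auto simp: nn_integral_normal_density)
  finally show ?thesis .
qed

text \<open>Multiplied by exp (lam x^2) the density becomes, up to the factor 1 / sqrt s, the
  centred normal density with variance \<sigma>^2 / s.\<close>

lemma gn_exp_square:
  assumes \<sigma>: "0 < \<sigma>" and lam: "2 * lam * \<sigma>\<^sup>2 < 1"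
  shows "(\<integral>\<^sup>+x. ennreal (exp (lam * x\<^sup>2)) \<partial>gn \<sigma>) = ennreal (exp (- ln (1 - 2 * lam * \<sigma>\<^sup>2) / 2))"
proof -
  define s where "s = 1 - 2 * lam * \<sigma>\<^sup>2"
  have s: "0 < s" using lam by (simp add: s_def)
  define \<tau> where "\<tau> = \<sigma> / sqrt s"
  have \<tau>: "0 < \<tau>" "\<tau>\<^sup>2 = \<sigma>\<^sup>2 / s" using \<sigma> s by (auto simp: \<tau>_def power_divide)
  have e: "exp (- ln s / 2) = 1 / sqrt s"
  proof -
    have "exp (- ln s / 2) = 1 / exp (ln s / 2)"
      by (metis exp_minus inverse_eq_divide minus_divide_left)
    also have "exp (ln s / 2) = sqrt s"
      using s by (simp flip: ln_sqrt)
    finally show ?thesis .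
  qed
  have *: "normal_density 0 \<sigma> x * exp (lam * x\<^sup>2) = 1 / sqrt s * normal_density 0 \<tau> x" for x
  proof -
    have "- (x - 0)\<^sup>2 / (2 * \<sigma>\<^sup>2) + lam * x\<^sup>2 = - (x - 0)\<^sup>2 / (2 * \<tau>\<^sup>2)"
      using \<sigma> s unfolding \<tau>(2) by (simp add: field_simps s_def)
    moreover have "1 / sqrt (2 * pi * \<sigma>\<^sup>2) = 1 / sqrt s * (1 / sqrt (2 * pi * \<tau>\<^sup>2))"
      using \<sigma> s unfolding \<tau>(2) by (simp add: real_sqrt_divide real_sqrt_mult)
    ultimately show ?thesis
      unfolding normal_density_def by (simp add: mult.assoc flip: exp_add)
  qed
  have "(\<integral>\<^sup>+x. ennreal (exp (lam * x\<^sup>2)) \<partial>gn \<sigma>) =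
      (\<integral>\<^sup>+x. ennreal (1 / sqrt s) * ennreal (normal_density 0 \<tau> x) \<partial>lborel)"
    using s by (subst nn_integral_density) (auto simp: * simp flip: ennreal_mult intro!: nn_integral_cong)
  also have "\<dots> = ennreal (1 / sqrt s)"
    using \<tau>(1) by (subst nn_integral_cmult) (auto simp: nn_integral_normal_density)
  finally show ?thesis using e by (simp add: s_def)
qed

lemma measurable_gn_component:
  "i \<in> I \<Longrightarrow> (\<lambda>z. z i) \<in> borel_measurable (PiM I (\<lambda>_. gn \<sigma>))"
  using measurable_component_singleton[of i I "\<lambda>_. gn \<sigma>"]
  by (simp cong: measurable_cong_sets)

lemma product_sigma_finite_gn: "0 < \<sigma> \<Longrightarrow> product_sigma_finite (\<lambda>_. gn \<sigma>)"
  by (intro product_sigma_finite.intro prob_space_imp_sigma_finite prob_space_gn)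

lemma prob_space_PiM_gn: "0 < \<sigma> \<Longrightarrow> prob_space (PiM I (\<lambda>_. gn \<sigma>))"
  by (intro prob_space_PiM prob_space_gn)

lemma mgf_linear:
  assumes "0 < \<sigma>" "finite I"
  shows "(\<integral>\<^sup>+z. ennreal (exp (\<Sum>i\<in>I. c i * z i)) \<partial>PiM I (\<lambda>_. gn \<sigma>)) =
    ennreal (exp (\<sigma>\<^sup>2 / 2 * (\<Sum>i\<in>I. (c i)\<^sup>2)))"
proof -
  interpret product_sigma_finite "\<lambda>_. gn \<sigma>" by (rule product_sigma_finite_gn) fact
  have "(\<integral>\<^sup>+z. ennreal (exp (\<Sum>i\<in>I. c i * z i)) \<partial>PiM I (\<lambda>_. gn \<sigma>)) =
      (\<integral>\<^sup>+z. (\<Prod>i\<in>I. ennreal (exp (c i * z i))) \<partial>PiM I (\<lambda>_. gn \<sigma>))"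
    using assms by (simp add: exp_sum prod_ennreal)
  also have "\<dots> = (\<Prod>i\<in>I. \<integral>\<^sup>+x. ennreal (exp (c i * x)) \<partial>gn \<sigma>)"
    using assms by (intro product_nn_integral_prod) auto
  also have "\<dots> = ennreal (exp (\<sigma>\<^sup>2 / 2 * (\<Sum>i\<in>I. (c i)\<^sup>2)))"
    using assms by (simp add: gn_exp_linear prod_ennreal exp_sum sum_distrib_left)
  finally show ?thesis .
qed

lemma mgf_square:
  assumes \<sigma>: "0 < \<sigma>" and I: "finite I" and A: "A \<subseteq> I" and lam: "2 * lam * \<sigma>\<^sup>2 < 1"
  shows "(\<integral>\<^sup>+z. ennreal (exp (lam * (\<Sum>i\<in>A. (z i)\<^sup>2))) \<partial>PiM I (\<lambda>_. gn \<sigma>)) =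
    ennreal (exp (- (real (card A) / 2) * ln (1 - 2 * lam * \<sigma>\<^sup>2)))"
proof -
  interpret product_sigma_finite "\<lambda>_. gn \<sigma>" by (rule product_sigma_finite_gn) fact
  interpret g: prob_space "gn \<sigma>" by (rule prob_space_gn) fact
  have fA: "finite A" using A I by (rule finite_subset)
  have "(\<integral>\<^sup>+z. ennreal (exp (lam * (\<Sum>i\<in>A. (z i)\<^sup>2))) \<partial>PiM I (\<lambda>_. gn \<sigma>)) =
      (\<integral>\<^sup>+z. (\<Prod>i\<in>I. if i \<in> A then ennreal (exp (lam * (z i)\<^sup>2)) else 1) \<partial>PiM I (\<lambda>_. gn \<sigma>))"
  proof (intro nn_integral_cong)
    fix z :: "'a \<Rightarrow> real"
    have "ennreal (exp (lam * (\<Sum>i\<in>A. (z i)\<^sup>2))) = (\<Prod>i\<in>A. ennreal (exp (lam * (z i)\<^sup>2)))"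
      using fA by (simp add: exp_sum prod_ennreal sum_distrib_left)
    also have "\<dots> = (\<Prod>i\<in>I. if i \<in> A then ennreal (exp (lam * (z i)\<^sup>2)) else 1)"
      using A I by (simp add: prod.If_cases Int_absorb1)
    finally show "ennreal (exp (lam * (\<Sum>i\<in>A. (z i)\<^sup>2))) =
      (\<Prod>i\<in>I. if i \<in> A then ennreal (exp (lam * (z i)\<^sup>2)) else 1)" .
  qed
  also have "\<dots> = (\<Prod>i\<in>I. \<integral>\<^sup>+x. (if i \<in> A then ennreal (exp (lam * x\<^sup>2)) else 1) \<partial>gn \<sigma>)"
    using I by (intro product_nn_integral_prod) auto
  also have "\<dots> = (\<Prod>i\<in>I. if i \<in> A then ennreal (exp (- ln (1 - 2 * lam * \<sigma>\<^sup>2) / 2)) else 1)"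
    using gn_exp_square[OF \<sigma> lam] g.emeasure_space_1 by (intro prod.cong) auto
  also have "\<dots> = ennreal (exp (- ln (1 - 2 * lam * \<sigma>\<^sup>2) / 2)) ^ card A"
    using A I by (simp add: prod.If_cases Int_absorb1)
  also have "\<dots> = ennreal (exp (real (card A) * (- ln (1 - 2 * lam * \<sigma>\<^sup>2) / 2)))"
    using exp_of_nat_mult[of "card A" "- ln (1 - 2 * lam * \<sigma>\<^sup>2) / 2"]
    by (simp only: ennreal_power exp_ge_zero)
  finally show ?thesis by (simp add: algebra_simps)
qed

lemma (in prob_space) chernoff:
  assumes X: "X \<in> borel_measurable M"
    and bd: "(\<integral>\<^sup>+z. ennreal (exp (X z)) \<partial>M) \<le> ennreal (exp b)"
  shows "measure M {z \<in> space M. t \<le> X z} \<le> exp (b - t)"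
proof -
  have "emeasure M {z \<in> space M. t \<le> X z} = (\<integral>\<^sup>+z. indicator {z \<in> space M. t \<le> X z} z \<partial>M)"
    using X by (intro nn_integral_indicator[symmetric]) measurable
  also have "\<dots> \<le> (\<integral>\<^sup>+z. ennreal (exp (- t)) * ennreal (exp (X z)) \<partial>M)"
  proof (intro nn_integral_mono)
    fix z
    show "indicator {z \<in> space M. t \<le> X z} z \<le> ennreal (exp (- t)) * ennreal (exp (X z))"
      by (auto simp: indicator_def simp flip: ennreal_mult exp_add ennreal_1 intro!: ennreal_leI)
  qed
  also have "\<dots> = ennreal (exp (- t)) * (\<integral>\<^sup>+z. ennreal (exp (X z)) \<partial>M)"
    using X by (intro nn_integral_cmult) measurable
  also have "\<dots> \<le> ennreal (exp (- t)) * ennreal (exp b)"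
    using bd by (rule mult_left_mono) simp
  also have "\<dots> = ennreal (exp (b - t))"
    by (simp add: exp_add[symmetric] flip: ennreal_mult)
  finally show ?thesis by (simp add: emeasure_eq_measure)
qed

text \<open>The two sides agree at 1, and the difference has the derivative (1 - 1/x)^2 / 2. The
  agreement at 1 is of second order, which is what the sharp leading terms of the chi-squared tail
  require.\<close>

lemma ln_le_half_diff:
  fixes w :: real
  assumes "1 \<le> w"
  shows "ln w \<le> (w - 1 / w) / 2"
proof -
  have "(\<lambda>w. (w - 1 / w) / 2 - ln w) 1 \<le> (\<lambda>w. (w - 1 / w) / 2 - ln w) w"
  proof (rule DERIV_nonneg_imp_nondecreasing[OF assms])
    fix x :: real assume x: "1 \<le> x" "x \<le> w"
    have "((\<lambda>w. (w - 1 / w) / 2 - ln w) has_real_derivative (1 - 1 / x)\<^sup>2 / 2) (at x)"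
      using x by (auto intro!: derivative_eq_intros simp: field_simps power2_eq_square)
    then show "\<exists>y. ((\<lambda>w. (w - 1 / w) / 2 - ln w) has_real_derivative y) (at x) \<and> 0 \<le> y"
      by (meson zero_le_power2 divide_nonneg_pos zero_less_numeral)
  qed
  then show ?thesis by simp
qed

text \<open>The exponent of Laurent and Massart for the upper tail of a chi-squared variable with
  \<open>b\<close> degrees of freedom.\<close>

lemma chi_squared_exponent:
  fixes b x :: real
  assumes "0 < b" "0 < x"
  defines "u \<equiv> sqrt x / (sqrt b + 2 * sqrt x)"
  shows "0 < u" "2 * u < 1" "- (b / 2) * ln (1 - 2 * u) \<le> u * (b + 2 * sqrt (b * x) + 2 * x) - x"
proof -
  define p s where "p = sqrt b" and "s = sqrt x"
  have ps: "0 < p" "0 < s" "b = p\<^sup>2" "x = s\<^sup>2" using assms by (auto simp: p_def s_def)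
  have u: "u = s / (p + 2 * s)" by (simp add: u_def p_def s_def)
  have w: "1 - 2 * u = p / (p + 2 * s)" using ps by (simp add: u field_simps)
  show "0 < u" using ps by (simp add: u)
  show "2 * u < 1" using ps by (simp add: u field_simps)
  have "- ln (1 - 2 * u) = ln ((p + 2 * s) / p)"
    unfolding w using ps by (simp add: ln_div)
  also have "\<dots> \<le> ((p + 2 * s) / p - 1 / ((p + 2 * s) / p)) / 2"
    using ps by (intro ln_le_half_diff) auto
  finally have "b / 2 * (- ln (1 - 2 * u)) \<le> b / 2 * (((p + 2 * s) / p - 1 / ((p + 2 * s) / p)) / 2)"
    using assms by (intro mult_left_mono) auto
  also have "\<dots> = u * (b + 2 * (p * s) + 2 * x) - x"
  proof -
    have "p + 2 * s \<noteq> 0" using ps by simp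
    then show ?thesis using ps unfolding u ps(3,4)
      by (simp add: divide_simps) (simp add: algebra_simps power2_eq_square)
  qed
  also have "p * s = sqrt (b * x)" by (simp add: p_def s_def real_sqrt_mult)
  finally show "- (b / 2) * ln (1 - 2 * u) \<le> u * (b + 2 * sqrt (b * x) + 2 * x) - x" by simp
qed

lemma chi_squared_upper_tail:
  fixes L :: real
  assumes \<sigma>: "0 < \<sigma>" and I: "finite I" "A \<subseteq> I" and L: "0 < L" "144 * L \<le> real (card A)"
  shows "measure (PiM I (\<lambda>_. gn \<sigma>)) {z \<in> space (PiM I (\<lambda>_. gn \<sigma>)).
      \<sigma>\<^sup>2 * (card A + 4 * sqrt (card A * L)) \<le> (\<Sum>i\<in>A. (z i)\<^sup>2)} \<le> exp (- 3 * L)"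
proof -
  interpret prob_space "PiM I (\<lambda>_. gn \<sigma>)" by (rule prob_space_PiM_gn) fact
  define b where "b = real (card A)"
  define x :: real where "x = 3 * L"
  have b: "0 < b" and x: "0 < x" using L by (auto simp: b_def x_def)
  define u where "u = sqrt x / (sqrt b + 2 * sqrt x)"
  note u = chi_squared_exponent[of b x, OF b x, folded u_def]
  define y where "y = sqrt (b * L)"
  have Ly: "12 * L \<le> y"
  proof -
    have "(12 * L)\<^sup>2 \<le> b * L" using L by (simp add: b_def power2_eq_square)
    then show ?thesis unfolding y_def using L by (intro real_le_rsqrt) auto
  qed
  have q3: "sqrt (b * x) = sqrt 3 * y" by (simp add: x_def y_def real_sqrt_mult)
  have "sqrt 3 \<le> (174 / 100)" by (rule real_le_lsqrt) (auto simp: power2_eq_square)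
  then have "sqrt 3 * y \<le> (174 / 100) * y" using Ly L by (intro mult_right_mono) auto
  then have Q: "b + 2 * sqrt (b * x) + 2 * x \<le> b + 4 * y"
    using Ly x_def L(1) unfolding q3 by linarith
  have "(\<integral>\<^sup>+z. ennreal (exp (u / \<sigma>\<^sup>2 * (\<Sum>i\<in>A. (z i)\<^sup>2))) \<partial>PiM I (\<lambda>_. gn \<sigma>)) =
      ennreal (exp (- (b / 2) * ln (1 - 2 * u)))"
    using u \<sigma> by (subst mgf_square[OF \<sigma> I]) (auto simp: b_def)
  also have "\<dots> \<le> ennreal (exp (u * (b + 2 * sqrt (b * x) + 2 * x) - x))"
    using u by (intro ennreal_leI) auto
  finally have bd: "(\<integral>\<^sup>+z. ennreal (exp (u / \<sigma>\<^sup>2 * (\<Sum>i\<in>A. (z i)\<^sup>2))) \<partial>PiM I (\<lambda>_. gn \<sigma>))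
      \<le> ennreal (exp (u * (b + 2 * sqrt (b * x) + 2 * x) - x))" .
  have meas: "(\<lambda>z. u / \<sigma>\<^sup>2 * (\<Sum>i\<in>A. (z i)\<^sup>2)) \<in> borel_measurable (PiM I (\<lambda>_. gn \<sigma>))"
    using I by (intro borel_measurable_times borel_measurable_const borel_measurable_sum
        borel_measurable_power measurable_gn_component) auto
  have "{z \<in> space (PiM I (\<lambda>_. gn \<sigma>)). \<sigma>\<^sup>2 * (b + 4 * y) \<le> (\<Sum>i\<in>A. (z i)\<^sup>2)} =
      {z \<in> space (PiM I (\<lambda>_. gn \<sigma>)). u * (b + 4 * y) \<le> u / \<sigma>\<^sup>2 * (\<Sum>i\<in>A. (z i)\<^sup>2)}"
  proof (intro Collect_cong conj_cong refl)
    fix z :: "'a \<Rightarrow> real"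
    have "u * (b + 4 * y) \<le> u / \<sigma>\<^sup>2 * (\<Sum>i\<in>A. (z i)\<^sup>2) \<longleftrightarrow> u * (b + 4 * y) \<le> u * ((\<Sum>i\<in>A. (z i)\<^sup>2) / \<sigma>\<^sup>2)"
      by simp
    also have "\<dots> \<longleftrightarrow> b + 4 * y \<le> (\<Sum>i\<in>A. (z i)\<^sup>2) / \<sigma>\<^sup>2" using u(1) by (rule mult_le_cancel_left_pos)
    also have "\<dots> \<longleftrightarrow> \<sigma>\<^sup>2 * (b + 4 * y) \<le> (\<Sum>i\<in>A. (z i)\<^sup>2)" using \<sigma> by (simp add: pos_le_divide_eq mult.commute)
    finally show "\<sigma>\<^sup>2 * (b + 4 * y) \<le> (\<Sum>i\<in>A. (z i)\<^sup>2) \<longleftrightarrow>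
      u * (b + 4 * y) \<le> u / \<sigma>\<^sup>2 * (\<Sum>i\<in>A. (z i)\<^sup>2)" by simp
  qed
  then have "measure (PiM I (\<lambda>_. gn \<sigma>)) {z \<in> space (PiM I (\<lambda>_. gn \<sigma>)). \<sigma>\<^sup>2 * (b + 4 * y) \<le> (\<Sum>i\<in>A. (z i)\<^sup>2)}
      \<le> exp (u * (b + 2 * sqrt (b * x) + 2 * x) - x - u * (b + 4 * y))"
    using chernoff[OF meas bd] by simp
  also have "\<dots> \<le> exp (- 3 * L)"
    using mult_left_mono[OF Q, of u] u(1) by (simp add: x_def)
  finally show ?thesis by (simp add: b_def y_def)
qed

lemma chi_squared_lower_tail:
  fixes L :: real
  assumes \<sigma>: "0 < \<sigma>" and I: "finite I" "A \<subseteq> I" and L: "0 < L" "0 < card A"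
  shows "measure (PiM I (\<lambda>_. gn \<sigma>)) {z \<in> space (PiM I (\<lambda>_. gn \<sigma>)).
      (\<Sum>i\<in>A. (z i)\<^sup>2) \<le> \<sigma>\<^sup>2 * (card A - 4 * sqrt (card A * L))} \<le> exp (- 4 * L)"
proof -
  interpret prob_space "PiM I (\<lambda>_. gn \<sigma>)" by (rule prob_space_PiM_gn) fact
  define b where "b = real (card A)"
  have b: "0 < b" using L by (simp add: b_def)
  \<comment> \<open>With this u the quadratic term u^2 b equals 4 L and the linear gain 4 u sqrt (b
    L) equals 8 L, leaving the exponent - 4 L.\<close>
  define u where "u = 2 * sqrt (L / b)"
  have u: "0 < u" using L b by (simp add: u_def)
  have ub: "u\<^sup>2 * b = 4 * L" using L b by (simp add: u_def power_mult_distrib)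
  have uy: "u * sqrt (b * L) = 2 * L"
  proof -
    have "sqrt (L / b) * sqrt (b * L) = sqrt (L\<^sup>2)"
      unfolding real_sqrt_mult[symmetric] using b by (simp add: power2_eq_square)
    then show ?thesis using L by (simp add: u_def)
  qed
  have "2 * u - (2 * u)\<^sup>2 / 2 \<le> ln (1 + 2 * u)"
  proof -
    have "(\<lambda>w. ln (1 + w) - (w - w\<^sup>2 / 2)) 0 \<le> (\<lambda>w. ln (1 + w) - (w - w\<^sup>2 / 2)) (2 * u)"
    proof (rule DERIV_nonneg_imp_nondecreasing[where a = 0 and b = "2 * u"
          and f = "\<lambda>w. ln (1 + w) - (w - w\<^sup>2 / 2)"])
      fix x :: real assume x: "0 \<le> x" "x \<le> 2 * u"
      have "((\<lambda>w. ln (1 + w) - (w - w\<^sup>2 / 2)) has_real_derivative x\<^sup>2 / (1 + x)) (at x)"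
        using x by (auto intro!: derivative_eq_intros simp: field_simps power2_eq_square)
      then show "\<exists>y. ((\<lambda>w. ln (1 + w) - (w - w\<^sup>2 / 2)) has_real_derivative y) (at x) \<and> 0 \<le> y"
        using x by (intro exI[of _ "x\<^sup>2 / (1 + x)"]) auto
    qed (use u in auto)
    then show ?thesis by simp
  qed
  then have "b / 2 * (2 * u - (2 * u)\<^sup>2 / 2) \<le> b / 2 * ln (1 + 2 * u)"
    using b by (intro mult_left_mono) auto
  then have key: "- (b / 2) * ln (1 + 2 * u) \<le> - u * b + 4 * L"
    using ub by (simp add: algebra_simps power2_eq_square)
  have "(\<integral>\<^sup>+z. ennreal (exp (- u / \<sigma>\<^sup>2 * (\<Sum>i\<in>A. (z i)\<^sup>2))) \<partial>PiM I (\<lambda>_. gn \<sigma>)) =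
      ennreal (exp (- (b / 2) * ln (1 + 2 * u)))"
    using u \<sigma> by (subst mgf_square[OF \<sigma> I]) (auto simp: b_def)
  also have "\<dots> \<le> ennreal (exp (- u * b + 4 * L))"
    using key by (intro ennreal_leI) auto
  finally have bd: "(\<integral>\<^sup>+z. ennreal (exp (- u / \<sigma>\<^sup>2 * (\<Sum>i\<in>A. (z i)\<^sup>2))) \<partial>PiM I (\<lambda>_. gn \<sigma>))
      \<le> ennreal (exp (- u * b + 4 * L))" .
  have meas: "(\<lambda>z. - u / \<sigma>\<^sup>2 * (\<Sum>i\<in>A. (z i)\<^sup>2)) \<in> borel_measurable (PiM I (\<lambda>_. gn \<sigma>))"
    using I by (intro borel_measurable_times borel_measurable_const borel_measurable_sum
        borel_measurable_power measurable_gn_component) auto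
  define y where "y = sqrt (b * L)"
  have "{z \<in> space (PiM I (\<lambda>_. gn \<sigma>)). (\<Sum>i\<in>A. (z i)\<^sup>2) \<le> \<sigma>\<^sup>2 * (b - 4 * y)} =
      {z \<in> space (PiM I (\<lambda>_. gn \<sigma>)). - u * (b - 4 * y) \<le> - u / \<sigma>\<^sup>2 * (\<Sum>i\<in>A. (z i)\<^sup>2)}"
  proof (intro Collect_cong conj_cong refl)
    fix z :: "'a \<Rightarrow> real"
    have "- u * (b - 4 * y) \<le> - u / \<sigma>\<^sup>2 * (\<Sum>i\<in>A. (z i)\<^sup>2) \<longleftrightarrow> u * ((\<Sum>i\<in>A. (z i)\<^sup>2) / \<sigma>\<^sup>2) \<le> u * (b - 4 * y)"
      by simp
    also have "\<dots> \<longleftrightarrow> (\<Sum>i\<in>A. (z i)\<^sup>2) / \<sigma>\<^sup>2 \<le> b - 4 * y" using u by (rule mult_le_cancel_left_pos)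
    also have "\<dots> \<longleftrightarrow> (\<Sum>i\<in>A. (z i)\<^sup>2) \<le> \<sigma>\<^sup>2 * (b - 4 * y)" using \<sigma> by (simp add: pos_divide_le_eq mult.commute)
    finally show "(\<Sum>i\<in>A. (z i)\<^sup>2) \<le> \<sigma>\<^sup>2 * (b - 4 * y) \<longleftrightarrow>
      - u * (b - 4 * y) \<le> - u / \<sigma>\<^sup>2 * (\<Sum>i\<in>A. (z i)\<^sup>2)" by simp
  qed
  then have "measure (PiM I (\<lambda>_. gn \<sigma>)) {z \<in> space (PiM I (\<lambda>_. gn \<sigma>)). (\<Sum>i\<in>A. (z i)\<^sup>2) \<le> \<sigma>\<^sup>2 * (b - 4 * y)}
      \<le> exp (- u * b + 4 * L - (- u * (b - 4 * y)))"
    using chernoff[OF meas bd, of "- u * (b - 4 * y)"] by simp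
  also have "- u * b + 4 * L - (- u * (b - 4 * y)) = - 4 * L"
    using uy by (simp add: y_def algebra_simps)
  finally show ?thesis by (simp add: b_def y_def)
qed

lemma linear_lower_tail:
  fixes L :: real
  assumes \<sigma>: "0 < \<sigma>" and I: "finite I" "A \<subseteq> I" and L: "0 < L"
  shows "measure (PiM I (\<lambda>_. gn \<sigma>)) {z \<in> space (PiM I (\<lambda>_. gn \<sigma>)).
      (\<Sum>i\<in>A. c i * z i) < - \<sigma> * sqrt (8 * L) * sqrt (\<Sum>i\<in>A. (c i)\<^sup>2)} \<le> exp (- 4 * L)"
proof (cases "(\<Sum>i\<in>A. (c i)\<^sup>2) = 0")
  \<comment> \<open>For vanishing coefficients the event is empty, because the deviation is required
    to be strict.\<close>
  case True
  have "finite A" using I by (metis finite_subset)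
  then have "c i = 0" if "i \<in> A" for i
    using True that by (simp add: sum_nonneg_eq_0_iff)
  then have "(\<Sum>i\<in>A. c i * z i) = 0" for z :: "'a \<Rightarrow> real" by simp
  then show ?thesis using True by simp
next
  case False
  interpret prob_space "PiM I (\<lambda>_. gn \<sigma>)" by (rule prob_space_PiM_gn) fact
  define v where "v = sqrt (\<Sum>i\<in>A. (c i)\<^sup>2)"
  have v: "0 < v" "v\<^sup>2 = (\<Sum>i\<in>A. (c i)\<^sup>2)"
    using False by (auto simp: v_def sum_nonneg less_le)
  define u where "u = sqrt (8 * L) / (\<sigma> * v)"
  have u: "0 < u" using L \<sigma> v by (simp add: u_def)
  have "(\<integral>\<^sup>+z. ennreal (exp (\<Sum>i\<in>I. (if i \<in> A then - u * c i else 0) * z i)) \<partial>PiM I (\<lambda>_. gn \<sigma>)) =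
      ennreal (exp (\<sigma>\<^sup>2 / 2 * (\<Sum>i\<in>I. (if i \<in> A then - u * c i else 0)\<^sup>2)))"
    by (rule mgf_linear[OF \<sigma> I(1)])
  also have "(\<Sum>i\<in>I. (if i \<in> A then - u * c i else 0)\<^sup>2) = (\<Sum>i\<in>A. (- u * c i)\<^sup>2)"
    using I by (simp add: if_distrib[of "\<lambda>x. x\<^sup>2"] sum.If_cases Int_absorb1 cong: if_cong)
  also have "\<dots> = u\<^sup>2 * v\<^sup>2" by (simp add: v power_mult_distrib sum_distrib_left)
  also have "\<sigma>\<^sup>2 / 2 * (u\<^sup>2 * v\<^sup>2) = 4 * L"
    using \<sigma> v(1) L by (simp add: u_def power_divide power_mult_distrib)
  also have "(\<lambda>z. \<Sum>i\<in>I. (if i \<in> A then - u * c i else 0) * z i) = (\<lambda>z. - u * (\<Sum>i\<in>A. c i * z i))"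
  proof
    fix z :: "'a \<Rightarrow> real"
    have "(\<Sum>i\<in>I. (if i \<in> A then - u * c i else 0) * z i) = (\<Sum>i\<in>A. - u * c i * z i)"
      using I by (simp add: if_distrib[of "\<lambda>x. x * _"] sum.If_cases Int_absorb1 cong: if_cong)
    then show "(\<Sum>i\<in>I. (if i \<in> A then - u * c i else 0) * z i) = - u * (\<Sum>i\<in>A. c i * z i)"
      by (simp add: sum_distrib_left mult.assoc)
  qed
  finally have bd: "(\<integral>\<^sup>+z. ennreal (exp (- u * (\<Sum>i\<in>A. c i * z i))) \<partial>PiM I (\<lambda>_. gn \<sigma>)) \<le> ennreal (exp (4 * L))"
    by simp
  have meas: "(\<lambda>z. - u * (\<Sum>i\<in>A. c i * z i)) \<in> borel_measurable (PiM I (\<lambda>_. gn \<sigma>))"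
    using I by (intro borel_measurable_times borel_measurable_const borel_measurable_sum
        measurable_gn_component) auto
  have us: "u * (\<sigma> * sqrt (8 * L) * v) = 8 * L"
    using \<sigma> v L by (simp add: u_def)
  have "measure (PiM I (\<lambda>_. gn \<sigma>)) {z \<in> space (PiM I (\<lambda>_. gn \<sigma>)). (\<Sum>i\<in>A. c i * z i) < - \<sigma> * sqrt (8 * L) * v}
     \<le> measure (PiM I (\<lambda>_. gn \<sigma>)) {z \<in> space (PiM I (\<lambda>_. gn \<sigma>)). 8 * L \<le> - u * (\<Sum>i\<in>A. c i * z i)}"
  proof (rule finite_measure_mono)
    show "{z \<in> space (PiM I (\<lambda>_. gn \<sigma>)). (\<Sum>i\<in>A. c i * z i) < - \<sigma> * sqrt (8 * L) * v} \<subseteq>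
      {z \<in> space (PiM I (\<lambda>_. gn \<sigma>)). 8 * L \<le> - u * (\<Sum>i\<in>A. c i * z i)}"
    proof safe
      fix z assume "(\<Sum>i\<in>A. c i * z i) < - \<sigma> * sqrt (8 * L) * v"
      then have "u * (\<Sum>i\<in>A. c i * z i) \<le> u * (- \<sigma> * sqrt (8 * L) * v)"
        using u by (intro mult_left_mono) auto
      then show "8 * L \<le> - u * (\<Sum>i\<in>A. c i * z i)" using us by simp
    qed
    show "{z \<in> space (PiM I (\<lambda>_. gn \<sigma>)). 8 * L \<le> - u * (\<Sum>i\<in>A. c i * z i)} \<in> sets (PiM I (\<lambda>_. gn \<sigma>))"
      using meas by measurable
  qed
  also have "\<dots> \<le> exp (4 * L - 8 * L)" by (rule chernoff[OF meas bd])
  finally show ?thesis by (simp add: v_def)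
qed

section \<open>Thresholded energy of a Gaussian matrix, uniformly over sparse frames\<close>

text \<open>Matrices are functions on pairs of indices here, so that they are points of a
  \<^locale>\<open>lattice_body\<close>.\<close>

definition contr :: "nat \<Rightarrow> nat \<Rightarrow> (nat \<times> nat \<Rightarrow> real) \<Rightarrow> bool" where
  "contr n r V \<longleftrightarrow> (\<forall>g::nat \<Rightarrow> real. (\<Sum>j<n. (\<Sum>q<r. V (j,q) * g q)\<^sup>2) \<le> (\<Sum>q<r. (g q)\<^sup>2))"

definition rowsq :: "nat \<Rightarrow> nat \<Rightarrow> (nat \<times> nat \<Rightarrow> real) \<Rightarrow> (nat \<times> nat \<Rightarrow> real) \<Rightarrow> nat \<Rightarrow> real" where
  "rowsq n r z V i = (\<Sum>q<r. (\<Sum>j<n. z (i,j) * V (j,q))\<^sup>2)"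

lemma rowsq_nonneg [simp]: "0 \<le> rowsq n r z V i"
  by (simp add: rowsq_def sum_nonneg)

text \<open>The square in the exponent is linearized by an auxiliary standard Gaussian vector, after
  which the two integrations are interchanged.\<close>

lemma mgf_rows:
  assumes \<sigma>: "0 < \<sigma>" and A: "A \<subseteq> {..<m}" and V: "contr n r V" and u: "0 \<le> u" "2 * u < 1"
  shows "(\<integral>\<^sup>+z. ennreal (exp (u / \<sigma>\<^sup>2 * (\<Sum>i\<in>A. rowsq n r z V i))) \<partial>PiM ({..<m} \<times> {..<n}) (\<lambda>_. gn \<sigma>))
    \<le> ennreal (exp (- (real (card A * r) / 2) * ln (1 - 2 * u)))"
proof -
  define I where "I = {..<m} \<times> {..<n}"
  define G where "G = A \<times> {..<r}"
  define P where "P = PiM I (\<lambda>_. gn \<sigma>)"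
  define Q where "Q = PiM G (\<lambda>_. gn 1)"
  define c where "c = sqrt (2 * u) / \<sigma>"
  define y where "y z p = (\<Sum>j<n. z (fst p, j) * V (j, snd p))" for z :: "nat \<times> nat \<Rightarrow> real" and p
  have fA: "finite A" using A by (metis finite_lessThan finite_subset)
  have fin: "finite I" "finite G" using fA by (auto simp: I_def G_def)
  have c2: "c\<^sup>2 = 2 * u / \<sigma>\<^sup>2" using u by (simp add: c_def power_divide)
  interpret P: prob_space P unfolding P_def by (rule prob_space_PiM_gn) fact
  interpret Q: prob_space Q unfolding Q_def by (rule prob_space_PiM_gn) simp
  interpret PQ: pair_sigma_finite P Q ..
  have compP: "(\<lambda>x. fst x p) \<in> borel_measurable (P \<Otimes>\<^sub>M Q)" if "p \<in> I" for p
    using measurable_compose[OF measurable_fst measurable_gn_component[OF that]] unfolding P_def .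
  have compQ: "(\<lambda>x. snd x p) \<in> borel_measurable (P \<Otimes>\<^sub>M Q)" if "p \<in> G" for p
    using measurable_compose[OF measurable_snd measurable_gn_component[OF that]] unfolding Q_def .
  let ?f = "\<lambda>x. ennreal (exp (\<Sum>p\<in>G. c * y (fst x) p * snd x p))"
  have y_meas: "(\<lambda>x. y (fst x) p) \<in> borel_measurable (P \<Otimes>\<^sub>M Q)" if "p \<in> G" for p
    using that A unfolding y_def
    by (intro borel_measurable_sum borel_measurable_times borel_measurable_const compP)
       (auto simp: I_def G_def)
  have f_meas: "?f \<in> borel_measurable (P \<Otimes>\<^sub>M Q)"
    by (rule measurable_compose[OF _ measurable_ennreal], rule measurable_compose[OF _ borel_measurable_exp])
       (intro borel_measurable_sum borel_measurable_times borel_measurable_const y_meas compQ)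
  have lin: "ennreal (exp (u / \<sigma>\<^sup>2 * (\<Sum>i\<in>A. rowsq n r z V i))) =
      (\<integral>\<^sup>+g. ?f (z, g) \<partial>Q)" for z
  proof -
    have "(\<Sum>i\<in>A. rowsq n r z V i) = (\<Sum>p\<in>G. (y z p)\<^sup>2)"
      unfolding rowsq_def G_def y_def by (simp add: sum.cartesian_product split_def)
    then have "u / \<sigma>\<^sup>2 * (\<Sum>i\<in>A. rowsq n r z V i) = 1\<^sup>2 / 2 * (\<Sum>p\<in>G. (c * y z p)\<^sup>2)"
      by (simp add: power_mult_distrib c2 sum_distrib_left)
    then show ?thesis
      using mgf_linear[of 1 G "\<lambda>p. c * y z p"] fin by (simp add: Q_def)
  qed
  have inner: "(\<integral>\<^sup>+z. ?f (z, g) \<partial>P) \<le> ennreal (exp (u * (\<Sum>p\<in>G. (g p)\<^sup>2)))" for g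
  proof -
    define k where "k p = (if fst p \<in> A then c * (\<Sum>q<r. V (snd p, q) * g (fst p, q)) else 0)" for p
    have "(\<Sum>p\<in>G. c * y z p * g p) = (\<Sum>p\<in>I. k p * z p)" for z
    proof -
      have "(\<Sum>p\<in>I. k p * z p) = (\<Sum>a<m. \<Sum>b<n. k (a,b) * z (a,b))"
        unfolding I_def by (simp add: sum.cartesian_product split_def)
      also have "\<dots> = (\<Sum>a<m. if a \<in> A then \<Sum>b<n. c * (\<Sum>q<r. V (b, q) * g (a, q)) * z (a,b) else 0)"
        by (intro sum.cong) (auto simp: k_def)
      also have "\<dots> = (\<Sum>a\<in>A. \<Sum>b<n. c * (\<Sum>q<r. V (b, q) * g (a, q)) * z (a,b))"
        using A by (simp add: sum.If_cases Int_absorb1)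
      also have "\<dots> = (\<Sum>a\<in>A. \<Sum>q<r. c * (\<Sum>b<n. z (a, b) * V (b, q)) * g (a, q))"
      proof (rule sum.cong[OF refl])
        fix a
        have "(\<Sum>b<n. c * (\<Sum>q<r. V (b, q) * g (a, q)) * z (a,b)) =
            (\<Sum>b<n. \<Sum>q<r. c * z (a,b) * V (b,q) * g (a,q))"
          by (simp add: sum_distrib_left sum_distrib_right mult_ac)
        also have "\<dots> = (\<Sum>q<r. \<Sum>b<n. c * z (a,b) * V (b,q) * g (a,q))" by (rule sum.swap)
        also have "\<dots> = (\<Sum>q<r. c * (\<Sum>b<n. z (a, b) * V (b, q)) * g (a, q))"
          by (simp add: sum_distrib_left sum_distrib_right mult_ac)
        finally show "(\<Sum>b<n. c * (\<Sum>q<r. V (b, q) * g (a, q)) * z (a,b)) =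
            (\<Sum>q<r. c * (\<Sum>b<n. z (a, b) * V (b, q)) * g (a, q))" by (simp add: mult_ac)
      qed
      also have "\<dots> = (\<Sum>p\<in>G. c * y z p * g p)"
        unfolding G_def y_def by (simp add: sum.cartesian_product split_def)
      finally show ?thesis ..
    qed
    then have "(\<integral>\<^sup>+z. ?f (z, g) \<partial>P) = ennreal (exp (\<sigma>\<^sup>2 / 2 * (\<Sum>p\<in>I. (k p)\<^sup>2)))"
      using mgf_linear[OF \<sigma> fin(1), of k] by (simp add: P_def)
    also have "\<dots> \<le> ennreal (exp (u * (\<Sum>p\<in>G. (g p)\<^sup>2)))"
    proof (intro ennreal_leI, subst exp_le_cancel_iff)
      have "(\<Sum>p\<in>I. (k p)\<^sup>2) = (\<Sum>a<m. \<Sum>b<n. (k (a,b))\<^sup>2)"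
        unfolding I_def by (simp add: sum.cartesian_product split_def)
      also have "\<dots> = (\<Sum>a<m. if a \<in> A then \<Sum>b<n. c\<^sup>2 * (\<Sum>q<r. V (b, q) * g (a, q))\<^sup>2 else 0)"
        by (intro sum.cong) (auto simp: k_def power_mult_distrib)
      also have "\<dots> = (\<Sum>a\<in>A. c\<^sup>2 * (\<Sum>b<n. (\<Sum>q<r. V (b, q) * g (a, q))\<^sup>2))"
        using A by (simp add: sum.If_cases Int_absorb1 sum_distrib_left)
      also have "\<dots> \<le> (\<Sum>a\<in>A. c\<^sup>2 * (\<Sum>q<r. (g (a,q))\<^sup>2))"
      proof (intro sum_mono mult_left_mono)
        fix a show "(\<Sum>b<n. (\<Sum>q<r. V (b, q) * g (a, q))\<^sup>2) \<le> (\<Sum>q<r. (g (a,q))\<^sup>2)"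
          using V[unfolded contr_def, rule_format, of "\<lambda>q. g (a,q)"] by simp
      qed auto
      also have "\<dots> = c\<^sup>2 * (\<Sum>p\<in>G. (g p)\<^sup>2)"
        unfolding G_def by (simp add: sum.cartesian_product split_def flip: sum_distrib_left)
      finally have "\<sigma>\<^sup>2 / 2 * (\<Sum>p\<in>I. (k p)\<^sup>2) \<le> \<sigma>\<^sup>2 / 2 * (c\<^sup>2 * (\<Sum>p\<in>G. (g p)\<^sup>2))"
        by (intro mult_left_mono) auto
      also have "\<dots> = u * (\<Sum>p\<in>G. (g p)\<^sup>2)" using \<sigma> by (simp add: c2)
      finally show "\<sigma>\<^sup>2 / 2 * (\<Sum>p\<in>I. (k p)\<^sup>2) \<le> u * (\<Sum>p\<in>G. (g p)\<^sup>2)" .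
    qed
    finally show ?thesis .
  qed
  have "(\<integral>\<^sup>+z. ennreal (exp (u / \<sigma>\<^sup>2 * (\<Sum>i\<in>A. rowsq n r z V i))) \<partial>P) =
      (\<integral>\<^sup>+z. (\<integral>\<^sup>+g. ?f (z, g) \<partial>Q) \<partial>P)"
    by (simp only: lin)
  also have "\<dots> = (\<integral>\<^sup>+g. (\<integral>\<^sup>+z. ?f (z, g) \<partial>P) \<partial>Q)"
    by (rule PQ.Fubini[OF f_meas, symmetric])
  \<comment> \<open>V has now disappeared: as for an orthonormal frame, the bound is the moment of a
    chi-squared variable with \<open>card A * r\<close> degrees of freedom.\<close>
  also have "\<dots> \<le> (\<integral>\<^sup>+g. ennreal (exp (u * (\<Sum>p\<in>G. (g p)\<^sup>2))) \<partial>Q)"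
    using inner by (rule nn_integral_mono)
  also have "\<dots> = ennreal (exp (- (real (card G) / 2) * ln (1 - 2 * u)))"
    unfolding Q_def using u fin by (subst mgf_square) auto
  also have "card G = card A * r" by (simp add: G_def card_cartesian_product)
  finally show ?thesis by (simp add: P_def I_def)
qed

section \<open>Exponential moment of the thresholded energy for a fixed frame\<close>

lemma rowsq_measurable:
  assumes "i < m"
  shows "(\<lambda>z. rowsq n r z V i) \<in> borel_measurable (PiM ({..<m} \<times> {..<n}) (\<lambda>_. gn \<sigma>))"
  unfolding rowsq_def using assms
  by (intro borel_measurable_sum borel_measurable_power borel_measurable_times
      borel_measurable_const measurable_gn_component) auto

lemma excess_measurable:
  assumes "f \<in> borel_measurable M"
  shows "(\<lambda>z. excess T (f z)) \<in> borel_measurable M"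
  unfolding excess_def using assms by measurable

lemma sum_Pow_power:
  fixes w :: real
  assumes "finite A"
  shows "(\<Sum>S\<in>Pow A. w ^ card S) = (1 + w) ^ card A"
proof -
  have "(\<Prod>i\<in>A. w + 1) = (\<Sum>S\<in>Pow A. (\<Prod>i\<in>S. w) * (\<Prod>i\<in>A - S. 1))"
    using assms by (rule prod_add)
  then show ?thesis by (simp add: add.commute)
qed

lemma one_plus_power_le_exp:
  fixes w :: real
  assumes "0 \<le> w"
  shows "(1 + w) ^ n \<le> exp (n * w)"
proof -
  have "(1 + w) ^ n \<le> exp w ^ n" using assms by (intro power_mono exp_ge_add_one_self) auto
  then show ?thesis by (simp add: exp_of_nat_mult)
qed

text \<open>Each factor of the exponential is at most 1 plus a tilted exponential, and the expanded
  product becomes a sum over sets A of rows above the level. The level is high enough for each row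
  of A to contribute a factor exp (- L), so the sum is at most (1 + exp (- L))^m \<le> e. The
  remaining exponent 1/1000000 depends on neither r nor L.\<close>

lemma excess_mgf:
  fixes \<sigma> L \<beta> T :: real
  assumes \<sigma>: "0 < \<sigma>" and L: "0 < L" "real m \<le> exp L" and r: "1 \<le> r" and \<beta>: "4 \<le> \<beta>"
    and T: "1.005 * (r + 2 * sqrt (r * \<beta> * L) + 2 * \<beta> * L) \<le> T" and V: "contr n r V"
  shows "(\<integral>\<^sup>+z. ennreal (exp (1 / 1000000 * (\<Sum>i<m. excess T (rowsq n r z V i / \<sigma>\<^sup>2))))
      \<partial>PiM ({..<m} \<times> {..<n}) (\<lambda>_. gn \<sigma>)) \<le> ennreal (exp 1)"
proof -
  let ?P = "PiM ({..<m} \<times> {..<n}) (\<lambda>_. gn \<sigma>)"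
  define lam :: real where "lam = 1 / 1000000"
  define T0 where "T0 = 1.005 * (r + 2 * sqrt (r * \<beta> * L) + 2 * \<beta> * L)"
  \<comment> \<open>\<open>\<beta> * L\<close> drives the tail. The second term matters when r is
    much larger than L: it gives sqrt x \<ge> sqrt r / 500, which keeps u above \<open>lam\<close>.
    It costs 0.004008 r in the level, within the margin of 1.005.\<close>
  define x where "x = \<beta> * L + 4 / 1000000 * r"
  have bL: "0 < \<beta> * L" "4 * L \<le> \<beta> * L" using L \<beta> by auto
  have x: "0 < x" using bL by (simp add: x_def add_pos_nonneg)
  have r0: "0 < real r" using r by simp
  define u where "u = sqrt x / (sqrt r + 2 * sqrt x)"
  note u = chi_squared_exponent[of r x, OF r0 x, folded u_def]
  have lam_u: "lam \<le> u"
  proof -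
    have "sqrt (4 / 1000000 * r) \<le> sqrt x" using bL by (simp add: x_def)
    moreover have "sqrt (4 / 1000000 * r) = 2 / 1000 * sqrt r"
    proof -
      have eq: "(4 / 1000000 :: real) = (2 / 1000)\<^sup>2" by (simp add: power2_eq_square)
      show ?thesis unfolding eq real_sqrt_mult real_sqrt_abs by simp
    qed
    ultimately have "sqrt r \<le> 500 * sqrt x" by linarith
    then have "sqrt r + 2 * sqrt x \<le> 502 * sqrt x" by simp
    then have "sqrt x / (502 * sqrt x) \<le> u"
      unfolding u_def using x r0 by (intro divide_left_mono) (auto intro!: mult_pos_pos add_pos_pos)
    moreover have "sqrt x / (502 * sqrt x) = 1 / 502" using x by simp
    ultimately show ?thesis by (simp add: lam_def)
  qed
  have QT: "r + 2 * sqrt (r * x) + 2 * x \<le> T0"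
  proof -
    have "r * x = r * \<beta> * L + (2 / 1000 * r)\<^sup>2"
      by (simp add: x_def power2_eq_square algebra_simps)
    moreover have "sqrt (r * \<beta> * L + (2 / 1000 * r)\<^sup>2) \<le> sqrt (r * \<beta> * L) + sqrt ((2 / 1000 * r)\<^sup>2)"
      using bL by (intro sqrt_add_le_add_sqrt) (auto simp: mult.assoc)
    ultimately have "sqrt (r * x) \<le> sqrt (r * \<beta> * L) + 2 / 1000 * r" by simp
    moreover have "0 \<le> sqrt (r * \<beta> * L)" using bL by (simp add: mult.assoc)
    moreover have "x = \<beta> * L + 4 / 1000000 * r" by (simp add: x_def)
    moreover have "a \<le> a' \<Longrightarrow> x = x' \<Longrightarrow> r + 2 * a + 2 * x \<le> r + 2 * a' + 2 * x'" for a a' x x' :: real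
      by simp
    ultimately have "r + 2 * sqrt (r * x) + 2 * x \<le>
        r + 2 * (sqrt (r * \<beta> * L) + 2 / 1000 * r) + 2 * (\<beta> * L + 4 / 1000000 * r)"
      by blast
    also have "\<dots> \<le> 1.005 * (r + 2 * sqrt (r * \<beta> * L) + 2 * (\<beta> * L))"
      using bL \<open>0 \<le> sqrt (r * \<beta> * L)\<close> r0 by (simp add: field_simps)
    finally show ?thesis by (simp add: T0_def mult.assoc)
  qed
  \<comment> \<open>After \<open>lam * T0\<close> is given back, the tail exponent x must still
    contain L, which pays for the choice of a row. Here \<beta> \<ge> 4 enters through 4 L \<le>
    \<beta> L.\<close>
  have lamT: "lam * T0 \<le> x - L"
  proof -
    have "2 * sqrt (r * \<beta> * L) \<le> r + \<beta> * L"
    proof -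
      have "sqrt (r * (\<beta> * L)) \<le> (r + \<beta> * L) / 2"
        using bL by (intro arith_geo_mean_sqrt) auto
      then show ?thesis by (simp add: mult.assoc)
    qed
    moreover have "2 * s \<le> R + w \<Longrightarrow> 4 * l \<le> w \<Longrightarrow> 0 < w \<Longrightarrow> 0 < R \<Longrightarrow>
        1 / 1000000 * (1.005 * (R + 2 * s + 2 * w)) \<le> w + 4 / 1000000 * R - l" for s R w l :: real
      by simp
    moreover have "T0 = 1.005 * (r + 2 * sqrt (r * \<beta> * L) + 2 * (\<beta> * L))" by (simp add: T0_def)
    ultimately show ?thesis using bL r0 unfolding lam_def x_def by blast
  qed
  define e where "e z i = exp (u * (rowsq n r z V i / \<sigma>\<^sup>2) - (u - lam) * T0)" for z i
  have pt: "exp (lam * excess T y) \<le> exp (u * y - (u - lam) * T0) + 1" for y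
  proof (cases "T < y")
    case True
    then have "0 \<le> (u - lam) * (y - T0)" using lam_u T by (intro mult_nonneg_nonneg) (auto simp: T0_def)
    then have "exp (lam * y) \<le> exp (u * y - (u - lam) * T0)" by (simp add: algebra_simps)
    then show ?thesis using True by (simp add: excess_def add_increasing2)
  qed (simp add: excess_def)
  have exp_le: "ennreal (exp (lam * (\<Sum>i<m. excess T (rowsq n r z V i / \<sigma>\<^sup>2)))) \<le>
      (\<Sum>A\<in>Pow {..<m}. ennreal (exp (- (card A * ((u - lam) * T0)))) *
         ennreal (exp (u / \<sigma>\<^sup>2 * (\<Sum>i\<in>A. rowsq n r z V i))))" for z
  proof -
    have "exp (lam * (\<Sum>i<m. excess T (rowsq n r z V i / \<sigma>\<^sup>2))) =
        (\<Prod>i<m. exp (lam * excess T (rowsq n r z V i / \<sigma>\<^sup>2)))"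
      by (simp add: exp_sum sum_distrib_left)
    also have "\<dots> \<le> (\<Prod>i<m. e z i + 1)"
    proof (intro prod_mono conjI)
      fix i show "exp (lam * excess T (rowsq n r z V i / \<sigma>\<^sup>2)) \<le> e z i + 1"
        unfolding e_def by (rule pt)
    qed simp
    also have "\<dots> = (\<Sum>A\<in>Pow {..<m}. (\<Prod>i\<in>A. e z i) * (\<Prod>i\<in>{..<m} - A. 1))"
      by (intro prod_add) simp
    also have "\<dots> = (\<Sum>A\<in>Pow {..<m}. exp (- (card A * ((u - lam) * T0))) *
         exp (u / \<sigma>\<^sup>2 * (\<Sum>i\<in>A. rowsq n r z V i)))"
    proof (intro sum.cong refl)
      fix A assume "A \<in> Pow {..<m}"
      then have "finite A" by (auto intro: finite_subset)
      then show "(\<Prod>i\<in>A. e z i) * (\<Prod>i\<in>{..<m} - A. 1) = exp (- (card A * ((u - lam) * T0))) *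
         exp (u / \<sigma>\<^sup>2 * (\<Sum>i\<in>A. rowsq n r z V i))"
        by (simp add: e_def sum_subtractf sum_distrib_left sum_divide_distrib
            flip: exp_sum exp_add)
    qed
    finally have "ennreal (exp (lam * (\<Sum>i<m. excess T (rowsq n r z V i / \<sigma>\<^sup>2)))) \<le>
      ennreal (\<Sum>A\<in>Pow {..<m}. exp (- (card A * ((u - lam) * T0))) *
         exp (u / \<sigma>\<^sup>2 * (\<Sum>i\<in>A. rowsq n r z V i)))" by (rule ennreal_leI)
    then show ?thesis by (simp add: ennreal_mult flip: sum_ennreal)
  qed
  have meas: "(\<lambda>z. ennreal (exp (u / \<sigma>\<^sup>2 * (\<Sum>i\<in>A. rowsq n r z V i)))) \<in> borel_measurable ?P"
    if "A \<in> Pow {..<m}" for A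
    using that
    by (intro measurable_compose[OF _ measurable_ennreal] measurable_compose[OF _ borel_measurable_exp]
        borel_measurable_times borel_measurable_const borel_measurable_sum rowsq_measurable) auto
  have "(\<integral>\<^sup>+z. ennreal (exp (lam * (\<Sum>i<m. excess T (rowsq n r z V i / \<sigma>\<^sup>2)))) \<partial>?P) \<le>
      (\<integral>\<^sup>+z. (\<Sum>A\<in>Pow {..<m}. ennreal (exp (- (card A * ((u - lam) * T0)))) *
         ennreal (exp (u / \<sigma>\<^sup>2 * (\<Sum>i\<in>A. rowsq n r z V i)))) \<partial>?P)"
    using exp_le by (rule nn_integral_mono)
  also have "\<dots> = (\<Sum>A\<in>Pow {..<m}. ennreal (exp (- (card A * ((u - lam) * T0)))) *
      (\<integral>\<^sup>+z. ennreal (exp (u / \<sigma>\<^sup>2 * (\<Sum>i\<in>A. rowsq n r z V i))) \<partial>?P))"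
    using meas by (subst nn_integral_sum) (auto intro!: sum.cong nn_integral_cmult)
  also have "\<dots> \<le> (\<Sum>A\<in>Pow {..<m}. ennreal (exp (- L) ^ card A))"
  proof (intro sum_mono)
    fix A assume A: "A \<in> Pow {..<m}"
    have "ennreal (exp (- (card A * ((u - lam) * T0)))) *
        (\<integral>\<^sup>+z. ennreal (exp (u / \<sigma>\<^sup>2 * (\<Sum>i\<in>A. rowsq n r z V i))) \<partial>?P)
      \<le> ennreal (exp (- (card A * ((u - lam) * T0)))) *
        ennreal (exp (- (real (card A * r) / 2) * ln (1 - 2 * u)))"
      using A u by (intro mult_left_mono mgf_rows[OF \<sigma> _ V]) auto
    also have "\<dots> = ennreal (exp (card A * (- (r / 2) * ln (1 - 2 * u) - (u - lam) * T0)))"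
      by (simp add: algebra_simps flip: ennreal_mult exp_add)
    also have "\<dots> \<le> ennreal (exp (card A * (- L)))"
    proof -
      have "u * (r + 2 * sqrt (r * x) + 2 * x) \<le> u * T0" using QT u(1) by (intro mult_left_mono) auto
      then have "- (r / 2) * ln (1 - 2 * u) - (u - lam) * T0 \<le> - L"
        using u(3) lamT by (simp add: algebra_simps)
      then have "card A * (- (r / 2) * ln (1 - 2 * u) - (u - lam) * T0) \<le> card A * (- L)"
        by (rule mult_left_mono) simp
      then show ?thesis by (intro ennreal_leI) simp
    qed
    also have "\<dots> = ennreal (exp (- L) ^ card A)" by (simp only: exp_of_nat_mult)
    finally show "ennreal (exp (- (card A * ((u - lam) * T0)))) *
        (\<integral>\<^sup>+z. ennreal (exp (u / \<sigma>\<^sup>2 * (\<Sum>i\<in>A. rowsq n r z V i))) \<partial>?P) \<le> ennreal (exp (- L) ^ card A)" .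
  qed
  also have "\<dots> = ennreal ((1 + exp (- L)) ^ m)"
    using sum_Pow_power[of "{..<m}" "exp (- L)"] by (simp add: sum_ennreal)
  also have "\<dots> \<le> ennreal (exp 1)"
  proof (intro ennreal_leI)
    have "(1 + exp (- L)) ^ m \<le> exp (m * exp (- L))" by (rule one_plus_power_le_exp) simp
    also have "real m * exp (- L) \<le> exp L * exp (- L)" using L by (intro mult_right_mono) auto
    then have "exp (m * exp (- L)) \<le> exp 1" by (simp flip: exp_add)
    finally show "(1 + exp (- L)) ^ m \<le> exp 1" .
  qed
  finally show ?thesis by (simp add: lam_def)
qed

lemma excess_tail:
  fixes \<sigma> L \<beta> T :: real
  assumes \<sigma>: "0 < \<sigma>" and L: "0 < L" "real m \<le> exp L" and r: "1 \<le> r" and \<beta>: "4 \<le> \<beta>"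
    and T: "1.005 * (r + 2 * sqrt (r * \<beta> * L) + 2 * \<beta> * L) \<le> T" and V: "contr n r V"
  shows "measure (PiM ({..<m} \<times> {..<n}) (\<lambda>_. gn \<sigma>)) {z \<in> space (PiM ({..<m} \<times> {..<n}) (\<lambda>_. gn \<sigma>)).
      1000000 * t \<le> (\<Sum>i<m. excess T (rowsq n r z V i / \<sigma>\<^sup>2))} \<le> exp (1 - t)"
proof -
  let ?P = "PiM ({..<m} \<times> {..<n}) (\<lambda>_. gn \<sigma>)"
  interpret prob_space ?P by (rule prob_space_PiM_gn) fact
  have meas: "(\<lambda>z. 1 / 1000000 * (\<Sum>i<m. excess T (rowsq n r z V i / \<sigma>\<^sup>2))) \<in> borel_measurable ?P"
    by (intro borel_measurable_times borel_measurable_const borel_measurable_sum excess_measurable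
        borel_measurable_divide rowsq_measurable) auto
  have "{z \<in> space ?P. 1000000 * t \<le> (\<Sum>i<m. excess T (rowsq n r z V i / \<sigma>\<^sup>2))} =
      {z \<in> space ?P. t \<le> 1 / 1000000 * (\<Sum>i<m. excess T (rowsq n r z V i / \<sigma>\<^sup>2))}"
    by auto
  then show ?thesis using chernoff[OF meas excess_mgf[OF assms], of t] by simp
qed

section \<open>From a fixed frame to all sparse contractions\<close>

lemma rowsq_scale: "rowsq n r z (\<lambda>p. c * V p) i = c\<^sup>2 * rowsq n r z V i"
  by (simp add: rowsq_def mult.left_commute power_mult_distrib flip: sum_distrib_left)

lemma rowsq_add_sqrt:
  "sqrt (rowsq n r z (\<lambda>p. V p + W p) i) \<le> sqrt (rowsq n r z V i) + sqrt (rowsq n r z W i)"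
proof -
  let ?a = "\<lambda>V q. \<Sum>j<n. z (i,j) * V (j,q)"
  have "sqrt (rowsq n r z V i) = L2_set (?a V) {..<r}" for V by (simp add: L2_set_def rowsq_def)
  moreover have "?a (\<lambda>p. V p + W p) = (\<lambda>q. ?a V q + ?a W q)"
    by (simp add: distrib_left sum.distrib)
  ultimately show ?thesis using L2_set_triangle_ineq[of "?a V" "?a W" "{..<r}"] by simp
qed

text \<open>Contractions instead of orthonormal frames: the set has to be convex and symmetric for
  the net argument, and it should contain the pieces of a frame obtained by deleting rows.\<close>

definition sparse_contr :: "nat \<Rightarrow> nat \<Rightarrow> nat set \<Rightarrow> (nat \<times> nat \<Rightarrow> real) set" where
  "sparse_contr n r S = {V. contr n r V \<and> (\<forall>p. p \<notin> S \<times> {..<r} \<longrightarrow> V p = 0)}"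

lemma contr_convex:
  assumes "contr n r V" "contr n r W" "0 \<le> t" "t \<le> 1"
  shows "contr n r (\<lambda>p. (1 - t) * V p + t * W p)"
  unfolding contr_def
proof
  fix g :: "nat \<Rightarrow> real"
  have cvx: "((1 - t) * a + t * b)\<^sup>2 \<le> (1 - t) * a\<^sup>2 + t * b\<^sup>2" for a b :: real
  proof -
    have "0 \<le> t * (1 - t) * (a - b)\<^sup>2" using assms by simp
    then show ?thesis by (simp add: algebra_simps power2_eq_square)
  qed
  let ?f = "\<lambda>V j. \<Sum>q<r. V (j,q) * g q"
  have "(\<Sum>j<n. (\<Sum>q<r. ((1 - t) * V (j,q) + t * W (j,q)) * g q)\<^sup>2) =
      (\<Sum>j<n. ((1 - t) * ?f V j + t * ?f W j)\<^sup>2)"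
    by (simp add: distrib_right sum.distrib sum_distrib_left mult.assoc)
  also have "\<dots> \<le> (\<Sum>j<n. (1 - t) * (?f V j)\<^sup>2 + t * (?f W j)\<^sup>2)"
    by (intro sum_mono cvx)
  also have "\<dots> = (1 - t) * (\<Sum>j<n. (?f V j)\<^sup>2) + t * (\<Sum>j<n. (?f W j)\<^sup>2)"
    by (simp add: sum.distrib sum_distrib_left)
  also have "\<dots> \<le> (1 - t) * (\<Sum>q<r. (g q)\<^sup>2) + t * (\<Sum>q<r. (g q)\<^sup>2)"
    using assms unfolding contr_def by (intro add_mono mult_left_mono) auto
  also have "\<dots> = (\<Sum>q<r. (g q)\<^sup>2)" by (simp add: algebra_simps)
  finally show "(\<Sum>j<n. (\<Sum>q<r. ((1 - t) * V (j,q) + t * W (j,q)) * g q)\<^sup>2) \<le> (\<Sum>q<r. (g q)\<^sup>2)" .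
qed

lemma contr_entry_le:
  assumes "contr n r V" "j < n" "q < r"
  shows "\<bar>V (j,q)\<bar> \<le> 1"
proof -
  let ?g = "\<lambda>p. if p = q then 1 else 0 :: real"
  have "(V (j,q))\<^sup>2 = (\<Sum>p<r. V (j,p) * ?g p)\<^sup>2" using assms by (simp add: if_distrib cong: if_cong)
  also have "\<dots> \<le> (\<Sum>i<n. (\<Sum>p<r. V (i,p) * ?g p)\<^sup>2)"
    using assms by (intro member_le_sum) auto
  also have "\<dots> \<le> (\<Sum>p<r. (?g p)\<^sup>2)" by (rule assms(1)[unfolded contr_def, rule_format])
  also have "\<dots> = (\<Sum>p<r. ?g p)" by (intro sum.cong) auto
  also have "\<dots> = 1" using assms by simp
  finally show ?thesis by (simp add: abs_square_le_1)
qed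

lemma contr_cube:
  assumes "0 < n" "0 < r" and V: "\<And>j q. j < n \<Longrightarrow> q < r \<Longrightarrow> \<bar>V (j,q)\<bar> \<le> 1 / (real n * real r)"
  shows "contr n r V"
  unfolding contr_def
proof
  fix g :: "nat \<Rightarrow> real"
  let ?a = "1 / (real n * real r)"
  have nr: "1 \<le> real n" "1 \<le> real r" using assms by auto
  then have "1 * 1 \<le> real n * real r" by (intro mult_mono) auto
  then have a: "0 \<le> ?a" "?a \<le> 1" by auto
  have "(\<Sum>j<n. (\<Sum>q<r. V (j,q) * g q)\<^sup>2) \<le> (\<Sum>j<n. (\<Sum>q<r. (V (j,q))\<^sup>2) * (\<Sum>q<r. (g q)\<^sup>2))"
    by (intro sum_mono Cauchy_Schwarz_ineq_sum)
  also have "\<dots> \<le> (\<Sum>j<n. (real r * ?a\<^sup>2) * (\<Sum>q<r. (g q)\<^sup>2))"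
  proof (intro sum_mono mult_right_mono)
    fix j assume "j \<in> {..<n}"
    then have "(\<Sum>q<r. (V (j,q))\<^sup>2) \<le> (\<Sum>q<r. ?a\<^sup>2)"
      using V a by (intro sum_mono) (metis abs_le_square_iff abs_of_nonneg lessThan_iff)
    then show "(\<Sum>q<r. (V (j,q))\<^sup>2) \<le> real r * ?a\<^sup>2" by simp
  qed (simp add: sum_nonneg)
  also have "\<dots> = ?a * (\<Sum>q<r. (g q)\<^sup>2)"
    using nr by (simp add: power2_eq_square)
  also have "\<dots> \<le> 1 * (\<Sum>q<r. (g q)\<^sup>2)"
    using a by (intro mult_right_mono) (auto simp: sum_nonneg)
  finally show "(\<Sum>j<n. (\<Sum>q<r. V (j,q) * g q)\<^sup>2) \<le> (\<Sum>q<r. (g q)\<^sup>2)" by simp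
qed

lemma sparse_contr_net:
  assumes S: "S \<subseteq> {..<n}" "S \<noteq> {}" and r: "1 \<le> r"
  shows "\<exists>N. finite N \<and> N \<subseteq> sparse_contr n r S \<and> card N \<le> 2 ^ (16 * (card S * r)) \<and>
    (\<forall>V\<in>sparse_contr n r S. \<exists>W\<in>N. (\<lambda>p. (V p - W p) / (1 / 2000)) \<in> sparse_contr n r S)"
proof -
  have n: "0 < n" using S by (cases n) auto
  have fS: "finite S" using S finite_subset by auto
  \<comment> \<open>Any inscribed cube will do, since its size does not enter the cardinality of the
    net; only the dimension \<open>card S * r\<close> does.\<close>
  interpret lattice_body "sparse_contr n r S" "S \<times> {..<r}" "1 / (real n * real r)"
  proof
    show "finite (S \<times> {..<r})" using fS by simp
    show "0 < 1 / (real n * real r)" using n r by simp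
  next
    fix V :: "nat \<times> nat \<Rightarrow> real" and p assume "V \<in> sparse_contr n r S" "p \<notin> S \<times> {..<r}"
    then show "V p = 0" by (cases p) (auto simp: sparse_contr_def)
  next
    fix V W :: "nat \<times> nat \<Rightarrow> real" and t :: real
    assume "V \<in> sparse_contr n r S" "W \<in> sparse_contr n r S" "0 \<le> t" "t \<le> 1"
    then show "(\<lambda>p. (1 - t) * V p + t * W p) \<in> sparse_contr n r S"
      by (auto simp: sparse_contr_def intro: contr_convex)
  next
    fix V :: "nat \<times> nat \<Rightarrow> real" assume "V \<in> sparse_contr n r S"
    then show "(\<lambda>p. - V p) \<in> sparse_contr n r S"
      by (auto simp: sparse_contr_def contr_def sum_negf)
  next
    fix V :: "nat \<times> nat \<Rightarrow> real"
    assume *: "\<And>p. p \<in> S \<times> {..<r} \<Longrightarrow> \<bar>V p\<bar> \<le> 1 / (real n * real r)"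
      "\<And>p. p \<notin> S \<times> {..<r} \<Longrightarrow> V p = 0"
    have "\<bar>V (j,q)\<bar> \<le> 1 / (real n * real r)" for j q
      using * by (cases "(j,q) \<in> S \<times> {..<r}") auto
    then have "contr n r V" using n r by (intro contr_cube) auto
    then show "V \<in> sparse_contr n r S" using *(2) by (simp add: sparse_contr_def)
  next
    fix V :: "nat \<times> nat \<Rightarrow> real" and p assume V: "V \<in> sparse_contr n r S"
    show "\<bar>V p\<bar> \<le> 1"
    proof (cases "p \<in> S \<times> {..<r}")
      case True
      then obtain j q where "p = (j,q)" "j < n" "q < r" using S by auto
      then show ?thesis using V contr_entry_le by (auto simp: sparse_contr_def)
    next
      case False
      then have "V p = 0" using V by (cases p) (auto simp: sparse_contr_def)
      then show ?thesis by simp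
    qed
  qed
  \<comment> \<open>2^16 = 65536 exceeds 64000, which is where the 16 in the cardinality comes
    from.\<close>
  have "32 / (1 / 2000) \<le> (2 :: real) ^ 16" by simp
  from ex_net[OF _ _ this] show ?thesis
    using fS by (simp add: card_cartesian_product)
qed

text \<open>Passing from the net to all sparse contractions costs a constant factor because the
  remainder of the approximation is again a multiple of a sparse contraction.\<close>

lemma excess_from_net:
  assumes N: "finite N" "N \<subseteq> sparse_contr n r S"
      "\<forall>V\<in>sparse_contr n r S. \<exists>W\<in>N. (\<lambda>p. (V p - W p) / (1 / 2000)) \<in> sparse_contr n r S"
    and S: "S \<subseteq> {..<n}" and g: "0 \<le> g"
    and net: "\<And>W. W \<in> N \<Longrightarrow> (\<Sum>i<m. excess ((999 / 1000 * g)\<^sup>2) (rowsq n r z W i)) \<le> t"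
    and V: "V \<in> sparse_contr n r S"
  shows "(\<Sum>i<m. excess (g\<^sup>2) (rowsq n r z V i)) \<le> 6 * t"
proof -
  define F where "F V = (\<Sum>i<m. excess (g\<^sup>2) (rowsq n r z V i))" for V
  define K where "K = (SUP V\<in>sparse_contr n r S. F V)"
  \<comment> \<open>A crude bound from entries of modulus at most 1. It serves to make the supremum
    K finite, so that K \<le> 3 t + K / 2 can be solved for K.\<close>
  have "F V \<le> (\<Sum>i<m. \<Sum>q<r. (\<Sum>j<n. \<bar>z (i,j)\<bar>)\<^sup>2)" if V: "V \<in> sparse_contr n r S" for V
    unfolding F_def
  proof (rule sum_mono)
    fix i
    have "excess (g\<^sup>2) (rowsq n r z V i) \<le> rowsq n r z V i" by (rule excess_le) simp
    also have "\<dots> \<le> (\<Sum>q<r. (\<Sum>j<n. \<bar>z (i,j)\<bar>)\<^sup>2)"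
      unfolding rowsq_def
    proof (rule sum_mono)
      fix q assume q: "q \<in> {..<r}"
      have "\<bar>\<Sum>j<n. z (i,j) * V (j,q)\<bar> \<le> (\<Sum>j<n. \<bar>z (i,j) * V (j,q)\<bar>)" by (rule sum_abs)
      also have "\<dots> \<le> (\<Sum>j<n. \<bar>z (i,j)\<bar>)"
      proof (rule sum_mono)
        fix j assume "j \<in> {..<n}"
        then have "\<bar>V (j,q)\<bar> \<le> 1" using V q contr_entry_le by (auto simp: sparse_contr_def)
        then have "\<bar>z (i,j)\<bar> * \<bar>V (j,q)\<bar> \<le> \<bar>z (i,j)\<bar> * 1" by (intro mult_left_mono) auto
        then show "\<bar>z (i,j) * V (j,q)\<bar> \<le> \<bar>z (i,j)\<bar>" by (simp add: abs_mult)
      qed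
      finally have "\<bar>\<Sum>j<n. z (i,j) * V (j,q)\<bar>\<^sup>2 \<le> (\<Sum>j<n. \<bar>z (i,j)\<bar>)\<^sup>2"
        by (intro power_mono) auto
      then show "(\<Sum>j<n. z (i,j) * V (j,q))\<^sup>2 \<le> (\<Sum>j<n. \<bar>z (i,j)\<bar>)\<^sup>2" by simp
    qed
    finally show "excess (g\<^sup>2) (rowsq n r z V i) \<le> (\<Sum>q<r. (\<Sum>j<n. \<bar>z (i,j)\<bar>)\<^sup>2)" .
  qed
  then have bdd: "bdd_above (F ` sparse_contr n r S)" by (auto simp: bdd_above_def)
  have FK: "F V \<le> K" if "V \<in> sparse_contr n r S" for V
    unfolding K_def using bdd that by (rule cSUP_upper2) simp
  have step: "F V \<le> 3 * t + K / 2" if V: "V \<in> sparse_contr n r S" for V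
  proof -
    obtain W where W: "W \<in> N" "(\<lambda>p. (V p - W p) / (1 / 2000)) \<in> sparse_contr n r S"
      using N(3) V by blast
    define Y where "Y = (\<lambda>p. (V p - W p) / (1 / 2000))"
    have VW: "V = (\<lambda>p. W p + 1 / 2000 * Y p)" by (auto simp: Y_def field_simps)
    \<comment> \<open>The mesh 1/2000 is chosen so that 2000000 / 2000^2 = 1/2 is a contraction
      factor.\<close>
    have pt: "excess (g\<^sup>2) (rowsq n r z V i) \<le> 3 * excess ((999 / 1000 * g)\<^sup>2) (rowsq n r z W i) +
        1 / 2 * excess (g\<^sup>2) (rowsq n r z Y i)" for i
    proof -
      have "sqrt (rowsq n r z V i) \<le> sqrt (rowsq n r z W i) + sqrt (rowsq n r z (\<lambda>p. 1 / 2000 * Y p) i)"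
        unfolding VW by (rule rowsq_add_sqrt)
      also have "sqrt (rowsq n r z (\<lambda>p. 1 / 2000 * Y p) i) = 1 / 2000 * sqrt (rowsq n r z Y i)"
        by (subst rowsq_scale) (auto simp: real_sqrt_mult power_divide real_sqrt_divide)
      finally have "excess (g\<^sup>2) ((sqrt (rowsq n r z V i))\<^sup>2) \<le>
          3 * excess ((999 / 1000 * g)\<^sup>2) ((sqrt (rowsq n r z W i))\<^sup>2) +
          2000000 * excess ((g / 1000)\<^sup>2) ((1 / 2000 * sqrt (rowsq n r z Y i))\<^sup>2)"
        using g by (intro excess_split) auto
      moreover have "excess ((g / 1000)\<^sup>2) ((1 / 2000 * sqrt (rowsq n r z Y i))\<^sup>2) \<le>
          (1 / 2000)\<^sup>2 * excess (g\<^sup>2) ((sqrt (rowsq n r z Y i))\<^sup>2)"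
        using g by (intro excess_scale) auto
      ultimately show ?thesis by (simp add: power_divide)
    qed
    have "F V \<le> (\<Sum>i<m. 3 * excess ((999 / 1000 * g)\<^sup>2) (rowsq n r z W i) +
        1 / 2 * excess (g\<^sup>2) (rowsq n r z Y i))"
      unfolding F_def by (intro sum_mono pt)
    also have "\<dots> = 3 * (\<Sum>i<m. excess ((999 / 1000 * g)\<^sup>2) (rowsq n r z W i)) + 1 / 2 * F Y"
      by (simp add: F_def sum.distrib sum_distrib_left)
    also have "\<dots> \<le> 3 * t + 1 / 2 * K"
      using net[OF W(1)] FK[of Y] W(2) by (intro add_mono mult_left_mono) (auto simp: Y_def)
    finally show ?thesis by simp
  qed
  have "K \<le> 3 * t + K / 2"
    unfolding K_def using V by (intro cSUP_least step[unfolded K_def]) auto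
  then show ?thesis using FK[OF V] unfolding F_def by linarith
qed

text \<open>A union bound over supports S and net points. The exponent 18 (r + L) card S covers 16 r
  card S for the net and the 1 of the exponential moment, and still leaves 4 L card S. Summed over
  all nonempty S, the powers of exp (- 4 L) give (1 + exp (- 4 L))^n - 1, which is of order exp (- 3
  L).\<close>

lemma excess_event:
  fixes \<sigma> L \<beta> g :: real
  assumes \<sigma>: "0 < \<sigma>" and L: "0 < L" "real m \<le> exp L" "real n \<le> exp L" and r: "1 \<le> r" and \<beta>: "4 \<le> \<beta>"
    and g: "0 \<le> g" "1.005 * \<sigma>\<^sup>2 * (r + 2 * sqrt (r * \<beta> * L) + 2 * \<beta> * L) \<le> (999 / 1000 * g)\<^sup>2"
  shows "\<exists>E\<in>sets (PiM ({..<m} \<times> {..<n}) (\<lambda>_. gn \<sigma>)).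
    measure (PiM ({..<m} \<times> {..<n}) (\<lambda>_. gn \<sigma>)) (space (PiM ({..<m} \<times> {..<n}) (\<lambda>_. gn \<sigma>)) - E) \<le> 2 * exp (- 3 * L) \<and>
    (\<forall>z\<in>E. \<forall>S\<subseteq>{..<n}. \<forall>V\<in>sparse_contr n r S.
       (\<Sum>i<m. excess (g\<^sup>2) (rowsq n r z V i)) \<le> 108000000 * \<sigma>\<^sup>2 * (r + L) * card S)"
proof -
  let ?P = "PiM ({..<m} \<times> {..<n}) (\<lambda>_. gn \<sigma>)"
  interpret prob_space ?P by (rule prob_space_PiM_gn) fact
  define T where "T = (999 / 1000 * g)\<^sup>2 / \<sigma>\<^sup>2"
  have T: "1.005 * (r + 2 * sqrt (r * \<beta> * L) + 2 * \<beta> * L) \<le> T"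
    unfolding T_def using g(2) \<sigma> by (simp add: pos_le_divide_eq mult_ac)
  \<comment> \<open>The empty support, which would contribute 1 to the sum of probabilities, is left
    out; there V = 0 and the bound is trivial.\<close>
  define SS where "SS = Pow {..<n} - {{}}"
  define is_net where "is_net S N \<longleftrightarrow> finite N \<and> N \<subseteq> sparse_contr n r S \<and> card N \<le> 2 ^ (16 * (card S * r)) \<and>
    (\<forall>V\<in>sparse_contr n r S. \<exists>W\<in>N. (\<lambda>p. (V p - W p) / (1 / 2000)) \<in> sparse_contr n r S)" for S N
  define N where "N S = (SOME N. is_net S N)" for S
  have net: "is_net S (N S)" if "S \<in> SS" for S
    unfolding N_def
  proof (rule someI_ex)
    show "\<exists>N. is_net S N"
      unfolding is_net_def by (rule sparse_contr_net) (use that r in \<open>auto simp: SS_def\<close>)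
  qed
  have N: "\<And>S. S \<in> SS \<Longrightarrow> finite (N S)" "\<And>S. S \<in> SS \<Longrightarrow> N S \<subseteq> sparse_contr n r S"
      "\<And>S. S \<in> SS \<Longrightarrow> card (N S) \<le> 2 ^ (16 * (card S * r))"
      "\<And>S. S \<in> SS \<Longrightarrow> \<forall>V\<in>sparse_contr n r S. \<exists>W\<in>N S. (\<lambda>p. (V p - W p) / (1 / 2000)) \<in> sparse_contr n r S"
    using net unfolding is_net_def by blast+
  define t where "t S = 18 * (r + L) * card S" for S :: "nat set"
  define Bad where "Bad S W = {z \<in> space ?P. 1000000 * t S \<le> (\<Sum>i<m. excess T (rowsq n r z W i / \<sigma>\<^sup>2))}" for S W
  define B where "B = (\<Union>S\<in>SS. \<Union>W\<in>N S. Bad S W)"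
  have finSS: "finite SS" by (simp add: SS_def)
  have meas: "(\<lambda>z. \<Sum>i<m. excess T (rowsq n r z W i / \<sigma>\<^sup>2)) \<in> borel_measurable ?P" for W
    by (intro borel_measurable_sum excess_measurable borel_measurable_divide borel_measurable_const
        rowsq_measurable) auto
  have BadM: "Bad S W \<in> sets ?P" for S W
    unfolding Bad_def using meas by measurable
  have BM: "B \<in> sets ?P"
    unfolding B_def using finSS N(1) BadM by (intro sets.finite_UN) auto
  have one: "measure ?P (\<Union>W\<in>N S. Bad S W) \<le> exp (- 4 * L) ^ card S" if S: "S \<in> SS" for S
  proof -
    have cS: "1 \<le> card S" using S by (auto simp: SS_def card_gt_0_iff Suc_le_eq intro: finite_subset)
    have "measure ?P (\<Union>W\<in>N S. Bad S W) \<le> (\<Sum>W\<in>N S. measure ?P (Bad S W))"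
      using N(1)[OF S] BadM by (intro finite_measure_subadditive_finite) auto
    also have "\<dots> \<le> (\<Sum>W\<in>N S. exp (1 - t S))"
      unfolding Bad_def using N(2)[OF S]
      by (intro sum_mono excess_tail[OF \<sigma> L(1,2) r \<beta> T]) (auto simp: sparse_contr_def)
    also have "\<dots> = card (N S) * exp (1 - t S)" by simp
    also have "\<dots> \<le> exp (16 * (card S * r)) * exp (1 - t S)"
    proof (rule mult_right_mono)
      have "real (card (N S)) \<le> real (2 ^ (16 * (card S * r)))"
        using N(3)[OF S] by (simp only: of_nat_le_iff)
      also have "\<dots> = 2 ^ (16 * (card S * r))" by simp
      also have "\<dots> \<le> exp 1 ^ (16 * (card S * r))"
        using exp_ge_add_one_self[of 1] by (intro power_mono) auto
      also have "\<dots> = exp (16 * (card S * r))" by (simp flip: exp_of_nat_mult)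
      finally show "real (card (N S)) \<le> exp (16 * (card S * r))" .
    qed simp
    also have "exp (16 * (card S * r)) * exp (1 - t S) = exp (16 * (card S * r) + 1 - t S)"
      by (simp flip: exp_add)
    also have "\<dots> \<le> exp (card S * (- 4 * L))"
    proof -
      have "1 * 1 \<le> real (card S) * real r" using cS r by (intro mult_mono) auto
      moreover have "0 \<le> real (card S) * L" using L by simp
      ultimately have "16 * (real (card S) * real r) + 1 - t S \<le> real (card S) * (- 4 * L)"
        unfolding t_def by (simp add: algebra_simps)
      then show ?thesis by simp
    qed
    also have "\<dots> = exp (- 4 * L) ^ card S" by (rule exp_of_nat_mult)
    finally show ?thesis .
  qed
  have "measure ?P B \<le> (\<Sum>S\<in>SS. measure ?P (\<Union>W\<in>N S. Bad S W))"
    unfolding B_def using finSS N(1) BadM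
    by (intro finite_measure_subadditive_finite) (auto intro!: sets.finite_UN)
  also have "\<dots> \<le> (\<Sum>S\<in>SS. exp (- 4 * L) ^ card S)" by (intro sum_mono one)
  also have "\<dots> = (\<Sum>S\<in>Pow {..<n}. exp (- 4 * L) ^ card S) - 1"
    unfolding SS_def by (subst sum_diff) auto
  also have "\<dots> = (1 + exp (- 4 * L)) ^ n - 1"
    using sum_Pow_power[of "{..<n}" "exp (- 4 * L)"] by simp
  also have "\<dots> \<le> exp (n * exp (- 4 * L)) - 1"
    using one_plus_power_le_exp[of "exp (- 4 * L)" n] by simp
  also have "\<dots> \<le> 2 * exp (- 3 * L)"
  proof -
    let ?w = "real n * exp (- 4 * L)"
    have "?w \<le> exp L * exp (- 4 * L)" using L by (intro mult_right_mono) auto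
    also have "\<dots> = exp (- 3 * L)" by (simp flip: exp_add)
    finally have w: "?w \<le> exp (- 3 * L)" .
    have "exp (- 3 * L) \<le> 1" using L by simp
    then have w1: "?w \<le> 1" using w by linarith
    moreover have w0: "0 \<le> ?w" by simp
    ultimately have "exp ?w \<le> 1 + ?w + ?w\<^sup>2" by (intro exp_bound)
    moreover have "?w * ?w \<le> ?w * 1" using w1 w0 by (rule mult_left_mono)
    then have "?w\<^sup>2 \<le> ?w" by (simp only: power2_eq_square mult_1_right)
    ultimately show ?thesis using w by linarith
  qed
  finally have PB: "measure ?P B \<le> 2 * exp (- 3 * L)" .
  show ?thesis
  proof (intro bexI[of _ "space ?P - B"] conjI ballI allI impI)
    show "space ?P - B \<in> sets ?P" using BM by auto
    have "space ?P - (space ?P - B) = B" using sets.sets_into_space[OF BM] by auto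
    then show "measure ?P (space ?P - (space ?P - B)) \<le> 2 * exp (- 3 * L)" using PB by simp
    fix z S V assume z: "z \<in> space ?P - B" and S: "S \<subseteq> {..<n}" and V: "V \<in> sparse_contr n r S"
    show "(\<Sum>i<m. excess (g\<^sup>2) (rowsq n r z V i)) \<le> 108000000 * \<sigma>\<^sup>2 * (r + L) * card S"
    proof (cases "S = {}")
      case True
      then have "V = (\<lambda>_. 0)" using V by (auto simp: sparse_contr_def)
      then have "rowsq n r z V i = 0" for i by (simp add: rowsq_def)
      then show ?thesis using True by (simp add: excess_def)
    next
      case False
      then have SS: "S \<in> SS" using S by (auto simp: SS_def)
      have "(\<Sum>i<m. excess (g\<^sup>2) (rowsq n r z V i)) \<le> 6 * (\<sigma>\<^sup>2 * (1000000 * t S))"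
      proof (rule excess_from_net[OF N(1,2,4)[OF SS] S g(1) _ V])
        fix W assume W: "W \<in> N S"
        have "z \<notin> Bad S W" using z SS W by (auto simp: B_def)
        then have lt: "(\<Sum>i<m. excess T (rowsq n r z W i / \<sigma>\<^sup>2)) < 1000000 * t S"
          using z by (auto simp: Bad_def)
        have "excess ((999 / 1000 * g)\<^sup>2) (rowsq n r z W i) = \<sigma>\<^sup>2 * excess T (rowsq n r z W i / \<sigma>\<^sup>2)" for i
          using \<sigma> by (simp add: excess_def T_def divide_less_cancel)
        then have "(\<Sum>i<m. excess ((999 / 1000 * g)\<^sup>2) (rowsq n r z W i)) =
            \<sigma>\<^sup>2 * (\<Sum>i<m. excess T (rowsq n r z W i / \<sigma>\<^sup>2))" by (simp add: sum_distrib_left)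
        also have "\<dots> \<le> \<sigma>\<^sup>2 * (1000000 * t S)" using lt by (intro mult_left_mono) auto
        finally show "(\<Sum>i<m. excess ((999 / 1000 * g)\<^sup>2) (rowsq n r z W i)) \<le> \<sigma>\<^sup>2 * (1000000 * t S)" .
      qed
      then show ?thesis by (simp add: t_def algebra_simps)
    qed
  qed
qed

section \<open>The thresholding iteration on a fixed data matrix\<close>

declare mat_diag_dim [simp]

lemma nsq_smult: "nsq (c \<cdot>\<^sub>v v) = c\<^sup>2 * nsq v" for c :: real
  by (simp add: power2_eq_square mult.assoc)

lemma smult_mat_mult_vec:
  fixes A :: "real mat"
  assumes "A \<in> carrier_mat m n" "x \<in> carrier_vec n"
  shows "(c \<cdot>\<^sub>m A) *\<^sub>v x = c \<cdot>\<^sub>v (A *\<^sub>v x)"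
  using assms by (intro eq_vecI) auto

lemma proj_compl_carrier:
  assumes Q: "Q \<in> carrier_mat m r" and B: "B \<in> carrier_mat m p"
  shows "B - Q * (transpose_mat Q * B) \<in> carrier_mat m p"
proof -
  have "transpose_mat Q * B \<in> carrier_mat r p" using Q B by simp
  then show ?thesis by (rule minus_carrier_mat[OF mult_carrier_mat[OF Q]])
qed

section \<open>Row thresholding, projections and restrictions to sets of rows\<close>

lemma row_threshold_carrier:
  "A \<in> carrier_mat m r \<Longrightarrow> row_threshold \<eta> \<gamma> A \<in> carrier_mat m r"
  by (intro carrier_matI) (auto simp: row_threshold_def)

lemma row_row_threshold:
  assumes "A \<in> carrier_mat m r" "i < m"
  shows "row (row_threshold \<eta> \<gamma> A) i =
    (\<eta> (vnorm (row A i)) \<gamma> / vnorm (row A i)) \<cdot>\<^sub>v row A i"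
  using assms by (intro eq_vecI) (auto simp: row_threshold_def)

text \<open>Thresholding moves a row radially, by at most \<gamma>. A surviving row has length x >
  \<gamma>, so its new length is at most x + \<gamma> \<le> 2 x, whence the factor 4. For a zero row
  the quotient is 0 / 0 = 0, and the same formula applies.\<close>

lemma row_threshold_error:
  assumes \<eta>: "thresholding_fun \<eta>" and \<gamma>: "0 < \<gamma>" and A: "A \<in> carrier_mat m r" "i < m"
  shows "nsq (row (row_threshold \<eta> \<gamma> A) i - row A i) \<le> \<gamma>\<^sup>2"
    and "nsq (row (row_threshold \<eta> \<gamma> A) i) \<le> 4 * excess (\<gamma>\<^sup>2) (nsq (row A i))"
proof -
  define v where "v = row A i"
  define x where "x = vnorm v"
  define c where "c = \<eta> x \<gamma> / x"
  have v: "v \<in> carrier_vec r" using A by (simp add: v_def)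
  have x0: "0 \<le> x" and x2: "nsq v = x\<^sup>2" by (simp_all add: x_def vnorm_power2)
  have row: "row (row_threshold \<eta> \<gamma> A) i = c \<cdot>\<^sub>v v"
    using row_row_threshold[OF A] by (simp add: c_def x_def v_def)
  have err: "\<bar>\<eta> x \<gamma> - x\<bar> \<le> \<gamma>" and zero: "x \<le> \<gamma> \<Longrightarrow> \<eta> x \<gamma> = 0"
    using \<eta> \<gamma> x0 by (auto simp: thresholding_fun_def)
  have "c \<cdot>\<^sub>v v - v = (c - 1) \<cdot>\<^sub>v v"
    using v by (intro eq_vecI) (auto simp: algebra_simps)
  then have "nsq (c \<cdot>\<^sub>v v - v) = ((c - 1) * x)\<^sup>2" by (simp only: nsq_smult x2 power_mult_distrib)
  also have "\<dots> \<le> \<gamma>\<^sup>2"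
  proof (cases "x = 0")
    case False
    then have "(c - 1) * x = \<eta> x \<gamma> - x" by (simp add: c_def algebra_simps)
    then show ?thesis using err \<gamma> by (simp add: abs_le_square_iff[symmetric])
  qed simp
  finally show "nsq (row (row_threshold \<eta> \<gamma> A) i - row A i) \<le> \<gamma>\<^sup>2"
    unfolding row by (simp add: v_def)
  have "nsq (c \<cdot>\<^sub>v v) = (c * x)\<^sup>2" by (simp only: nsq_smult x2 power_mult_distrib)
  also have "\<dots> \<le> 4 * excess (\<gamma>\<^sup>2) (x\<^sup>2)"
  proof (cases "x \<le> \<gamma>")
    case True
    then show ?thesis using zero by (simp add: c_def excess_nonneg)
  next
    case False
    then have "c * x = \<eta> x \<gamma>" using \<gamma> by (simp add: c_def)
    moreover have "\<bar>\<eta> x \<gamma>\<bar> \<le> 2 * x" using err False by linarith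
    ultimately have "\<bar>c * x\<bar> \<le> \<bar>2 * x\<bar>" using x0 by simp
    then have "(c * x)\<^sup>2 \<le> (2 * x)\<^sup>2" by (simp only: abs_le_square_iff)
    moreover have "excess (\<gamma>\<^sup>2) (x\<^sup>2) = x\<^sup>2"
      using False \<gamma> power_strict_mono[of \<gamma> x 2] by (simp add: excess_def)
    ultimately show ?thesis by (simp add: power_mult_distrib)
  qed
  finally show "nsq (row (row_threshold \<eta> \<gamma> A) i) \<le> 4 * excess (\<gamma>\<^sup>2) (nsq (row A i))"
    unfolding row by (simp add: x2 flip: v_def)
qed

lemma fro2_uminus: "fro2 (- A) = fro2 A"
  by (simp add: fro2_def)

lemma row_minus:
  fixes A B :: "real mat"
  assumes "A \<in> carrier_mat m n" "B \<in> carrier_mat m n" "i < m"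
  shows "row (A - B) i = row A i - row B i"
  using assms by (intro eq_vecI) auto

lemma row_mult_zero:
  fixes A B :: "real mat"
  assumes "A \<in> carrier_mat m n" "B \<in> carrier_mat n p" "i < m" "row A i = 0\<^sub>v n"
  shows "row (A * B) i = 0\<^sub>v p"
  using assms by (intro eq_vecI) auto

lemma finite_row_supp [simp]: "finite (row_supp A)"
  by (rule finite_subset[of _ "{..<dim_row A}"]) (auto simp: row_supp_def)

lemma row_notin_supp:
  assumes "A \<in> carrier_mat m n" "i < m" "i \<notin> row_supp A"
  shows "row A i = 0\<^sub>v n"
  using assms by (auto simp: row_supp_def)

lemma fro2_proj_compl:
  assumes Q: "Q \<in> carrier_mat m r" "orthonormal_cols Q" and B: "B \<in> carrier_mat m p"
  shows "fro2 (B - Q * (transpose_mat Q * B)) = fro2 B - fro2 (transpose_mat Q * B)"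
proof -
  have "nsq (col (B - Q * (transpose_mat Q * B)) j) = nsq (col B j) - nsq (col (transpose_mat Q * B) j)"
    if "j < p" for j
  proof -
    let ?b = "col B j"
    have b: "?b \<in> carrier_vec m" using that B by simp
    have c: "col (transpose_mat Q * B) j = transpose_mat Q *\<^sub>v ?b"
      using Q(1) B that by (intro col_mult_mat_vec) auto
    have "col (B - Q * (transpose_mat Q * B)) j = ?b - Q *\<^sub>v (transpose_mat Q *\<^sub>v ?b)"
    proof -
      have "col (Q * (transpose_mat Q * B)) j = Q *\<^sub>v col (transpose_mat Q * B) j"
        using Q(1) B that by (intro col_mult_mat_vec) auto
      moreover have "col (B - Q * (transpose_mat Q * B)) j = ?b - col (Q * (transpose_mat Q * B)) j"
        using Q(1) B that by (intro eq_vecI) auto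
      ultimately show ?thesis using c by simp
    qed
    then show ?thesis using orthonormal_proj_decomp[OF Q b] c by simp
  qed
  then have "(\<Sum>j<p. nsq (col (B - Q * (transpose_mat Q * B)) j)) =
      (\<Sum>j<p. nsq (col B j)) - (\<Sum>j<p. nsq (col (transpose_mat Q * B) j))"
    by (simp add: sum_subtractf[symmetric])
  then show ?thesis using Q(1) B by (simp add: fro2_cols)
qed

lemma fro2_proj_compl_le:
  assumes "Q \<in> carrier_mat m r" "orthonormal_cols Q" "B \<in> carrier_mat m p"
  shows "fro2 (B - Q * (transpose_mat Q * B)) \<le> fro2 B"
  using fro2_proj_compl[OF assms] by simp

lemma fro2_orthonormal_mult:
  assumes Q: "Q \<in> carrier_mat m r" "orthonormal_cols Q" and B: "B \<in> carrier_mat r p"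
  shows "fro2 (Q * B) = fro2 B"
  using fro2_mult_left_le[OF Q(1) B, of 1] fro2_mult_left_ge[OF Q(1) B, of 1]
    orthonormal_nsq[OF Q] by simp

lemma fro2_transpose_orthonormal_mult:
  assumes Q: "Q \<in> carrier_mat m r" "orthonormal_cols Q" and B: "B \<in> carrier_mat m p"
  shows "fro2 (transpose_mat Q * B) \<le> fro2 B"
  using fro2_proj_compl[OF assms] fro2_nonneg by (metis diff_ge_0_iff_ge)

text \<open>The constant \<open>3 / 4\<close> says that the principal angles between the column spans are at most
  30 degrees.\<close>

definition close_frame :: "nat \<Rightarrow> nat \<Rightarrow> real \<Rightarrow> real \<Rightarrow> real mat \<Rightarrow> real mat \<Rightarrow> bool" where
  "close_frame n r \<epsilon> s V W \<longleftrightarrow>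
     W \<in> carrier_mat n r \<and> orthonormal_cols W \<and>
     (\<forall>x\<in>carrier_vec r. 3 / 4 * nsq x \<le> nsq (transpose_mat W *\<^sub>v (V *\<^sub>v x))) \<and>
     (\<Sum>i\<in>{..<n} - row_supp V. nsq (row W i)) \<le> \<epsilon> \<and>
     real (card (row_supp W - row_supp V)) \<le> s"

definition contraction :: "nat \<Rightarrow> real mat \<Rightarrow> bool" where
  "contraction r W \<longleftrightarrow> (\<forall>x\<in>carrier_vec r. nsq (W *\<^sub>v x) \<le> nsq x)"

text \<open>The form in which the uniform energy bound enters the deterministic analysis. The level
  is lowered to 999/1000 of \<gamma> because \<open>false_rows_card\<close> compares the rows of Z *
  W with those of the main part of W at that level.\<close>

definition excess_bound :: "nat \<Rightarrow> nat \<Rightarrow> nat \<Rightarrow> real mat \<Rightarrow> real \<Rightarrow> real \<Rightarrow> bool" where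
  "excess_bound m n r Z \<gamma> B \<longleftrightarrow>
     (\<forall>W\<in>carrier_mat n r. contraction r W \<longrightarrow>
        (\<Sum>i<m. excess ((999 / 1000 * \<gamma>)\<^sup>2) (nsq (row (Z * W) i))) \<le> B * card (row_supp W))"

lemma excess_bound_upper:
  assumes "excess_bound m n r Z \<gamma> B" "0 < \<gamma>" "W \<in> carrier_mat n r" "contraction r W"
  shows "(\<Sum>i<m. excess (\<gamma>\<^sup>2) (nsq (row (Z * W) i))) \<le> B * card (row_supp W)"
proof -
  have "(999 / 1000 * \<gamma>)\<^sup>2 \<le> \<gamma>\<^sup>2" using assms(2) by (intro power_mono) auto
  then have "(\<Sum>i<m. excess (\<gamma>\<^sup>2) (nsq (row (Z * W) i))) \<le>
      (\<Sum>i<m. excess ((999 / 1000 * \<gamma>)\<^sup>2) (nsq (row (Z * W) i)))"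
    by (intro sum_mono excess_antimono) auto
  then show ?thesis using assms unfolding excess_bound_def by fastforce
qed

lemma vnorm_triangle:
  fixes x y :: "real vec"
  assumes "x \<in> carrier_vec n" "y \<in> carrier_vec n"
  shows "vnorm (x + y) \<le> vnorm x + vnorm y"
proof -
  have "(x \<bullet> y)\<^sup>2 \<le> (vnorm x * vnorm y)\<^sup>2"
    using scalar_prod_Cauchy_Schwarz[OF assms] by (simp add: power_mult_distrib vnorm_power2)
  then have "x \<bullet> y \<le> vnorm x * vnorm y"
    by (rule power2_le_imp_le) simp
  moreover have "nsq (x + y) = nsq x + 2 * (x \<bullet> y) + nsq y" by (rule nsq_add) fact+
  ultimately have "(vnorm (x + y))\<^sup>2 \<le> (vnorm x + vnorm y)\<^sup>2"
    by (simp add: power2_sum vnorm_power2)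
  then show ?thesis by (rule power2_le_imp_le) simp
qed

lemma contraction_orthonormal:
  "Q \<in> carrier_mat m r \<Longrightarrow> orthonormal_cols Q \<Longrightarrow> contraction r Q"
  by (simp add: contraction_def orthonormal_nsq)

definition restrict_rows :: "nat set \<Rightarrow> real mat \<Rightarrow> real mat" where
  "restrict_rows S W = mat (dim_row W) (dim_col W) (\<lambda>(i,j). if i \<in> S then W $$ (i,j) else 0)"

lemma restrict_rows_carrier [simp]:
  "W \<in> carrier_mat n r \<Longrightarrow> restrict_rows S W \<in> carrier_mat n r"
  by (simp add: restrict_rows_def)

lemma row_restrict_rows:
  assumes "W \<in> carrier_mat n r" "i < n"
  shows "row (restrict_rows S W) i = (if i \<in> S then row W i else 0\<^sub>v r)"
  using assms by (intro eq_vecI) (auto simp: restrict_rows_def)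

lemma row_supp_restrict_rows:
  assumes "W \<in> carrier_mat n r"
  shows "row_supp (restrict_rows S W) = row_supp W \<inter> S"
  using assms row_restrict_rows[OF assms] carrier_matD[OF restrict_rows_carrier[OF assms, of S]]
  by (auto simp: row_supp_def)

lemma fro2_restrict_rows:
  assumes "W \<in> carrier_mat n r"
  shows "fro2 (restrict_rows S W) = (\<Sum>i\<in>{..<n} \<inter> S. nsq (row W i))"
proof -
  have "fro2 (restrict_rows S W) = (\<Sum>i<n. if i \<in> S then nsq (row W i) else 0)"
    using assms carrier_matD[OF restrict_rows_carrier[OF assms, of S]]
    by (auto simp: fro2_rows row_restrict_rows intro!: sum.cong)
  then show ?thesis by (simp add: sum.inter_restrict)
qed

lemma nsq_restrict_rows_le:
  assumes "W \<in> carrier_mat n r" "x \<in> carrier_vec r"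
  shows "nsq (restrict_rows S W *\<^sub>v x) \<le> nsq (W *\<^sub>v x)"
proof -
  have "(\<Sum>i<n. ((restrict_rows S W *\<^sub>v x) $ i)\<^sup>2) \<le> (\<Sum>i<n. ((W *\<^sub>v x) $ i)\<^sup>2)"
    using assms carrier_matD[OF restrict_rows_carrier[OF assms(1), of S]]
    by (intro sum_mono) (auto simp: row_restrict_rows)
  then show ?thesis using assms carrier_matD[OF restrict_rows_carrier[OF assms(1), of S]] by (simp add: nsq_sum)
qed

lemma mult_restrict_rows:
  assumes Q: "Q \<in> carrier_mat m r" and B: "B \<in> carrier_mat m p" and "row_supp Q \<subseteq> S"
  shows "transpose_mat Q * restrict_rows S B = transpose_mat Q * B"
proof (rule eq_matI)
  fix a b assume "a < dim_row (transpose_mat Q * B)" "b < dim_col (transpose_mat Q * B)"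
  then have ab: "a < r" "b < p" using Q B by auto
  have 0: "Q $$ (i,a) = 0" if "i < m" "i \<notin> S" for i
  proof -
    have "row Q i = 0\<^sub>v r" using that assms by (intro row_notin_supp[of _ m]) auto
    then have "row Q i $ a = 0" using ab by simp
    then show ?thesis using that ab Q by simp
  qed
  have "(transpose_mat Q * restrict_rows S B) $$ (a,b) =
      (\<Sum>i<m. Q $$ (i,a) * (if i \<in> S then B $$ (i,b) else 0))"
    using ab Q B by (simp add: scalar_prod_def atLeast0LessThan restrict_rows_def)
  also have "\<dots> = (\<Sum>i<m. Q $$ (i,a) * B $$ (i,b))"
    using 0 by (intro sum.cong) auto
  also have "\<dots> = (transpose_mat Q * B) $$ (a,b)"
    using ab Q B by (simp add: scalar_prod_def atLeast0LessThan)
  finally show "(transpose_mat Q * restrict_rows S B) $$ (a,b) = (transpose_mat Q * B) $$ (a,b)" .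
qed (use Q B in \<open>auto simp: restrict_rows_def\<close>)

section \<open>Half a step of the iteration for a matrix of rank r\<close>

locale low_rank =
  fixes m n r :: nat and U V M :: "real mat" and D :: "nat \<Rightarrow> real" and d :: real
  assumes U: "U \<in> carrier_mat m r" "orthonormal_cols U"
    and V: "V \<in> carrier_mat n r" "orthonormal_cols V"
    and d: "0 < d" and D: "\<And>i. i < r \<Longrightarrow> d \<le> D i"
    and M: "M = U * mat_diag r D * transpose_mat V"
begin

lemma M_carrier: "M \<in> carrier_mat m n"
  unfolding M
  using mult_carrier_mat[OF mult_carrier_mat[OF U(1) mat_diag_dim[of r D]], of "transpose_mat V" n] V
  by simp

lemma M_assoc: "M = U * (mat_diag r D * transpose_mat V)"
  unfolding M by (rule assoc_mult_mat[OF U(1) mat_diag_dim]) (use V in simp)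

lemma transpose_M: "transpose_mat M = V * mat_diag r D * transpose_mat U"
proof -
  have dd: "transpose_mat (mat_diag r D) = mat_diag r D"
    by (intro eq_matI) (auto simp: mat_diag_def)
  have "transpose_mat M = transpose_mat (transpose_mat V) * transpose_mat (U * mat_diag r D)"
    unfolding M by (rule transpose_mult[OF mult_carrier_mat[OF U(1) mat_diag_dim]]) (use V in simp)
  also have "transpose_mat (U * mat_diag r D) = mat_diag r D * transpose_mat U"
    using U dd by (subst transpose_mult[of _ m r _ r]) auto
  finally show ?thesis using U V by (simp add: assoc_mult_mat[of _ n r _ r _ m])
qed

text \<open>The half-step that updates the right frame is the half-step for the left frame on
  transposed data; likewise columns are screened as rows of the transpose.\<close>

lemma low_rank_transpose: "low_rank n m r V U (transpose_mat M) D d"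
  using U V d D transpose_M by unfold_locales auto

lemma M_mult_vec:
  assumes "x \<in> carrier_vec n"
  shows "M *\<^sub>v x = U *\<^sub>v (mat_diag r D *\<^sub>v (transpose_mat V *\<^sub>v x))"
  unfolding M using U V assms
  by (simp add: assoc_mult_mat_vec[of _ m r _ n] assoc_mult_mat_vec[of _ m r _ r])

lemma mat_diag_mult_vec: "y \<in> carrier_vec r \<Longrightarrow> i < r \<Longrightarrow> (mat_diag r D *\<^sub>v y) $ i = D i * y $ i"
proof -
  assume y: "y \<in> carrier_vec r" and i: "i < r"
  have "(mat_diag r D *\<^sub>v y) $ i = (\<Sum>j<r. (if i = j then D j else 0) * y $ j)"
    using i y by (simp add: mat_diag_def scalar_prod_def atLeast0LessThan)
  also have "\<dots> = (\<Sum>j<r. if j = i then D i * y $ i else 0)"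
    by (intro sum.cong) auto
  finally show ?thesis using i by simp
qed

lemma nsq_mat_diag_ge:
  assumes y: "y \<in> carrier_vec r"
  shows "d\<^sup>2 * nsq y \<le> nsq (mat_diag r D *\<^sub>v y)"
proof -
  have "(\<Sum>i<r. d\<^sup>2 * (y $ i)\<^sup>2) \<le> (\<Sum>i<r. ((mat_diag r D *\<^sub>v y) $ i)\<^sup>2)"
  proof (intro sum_mono)
    fix i assume "i \<in> {..<r}"
    then have "d\<^sup>2 \<le> (D i)\<^sup>2" using d D by (intro power_mono) auto
    then show "d\<^sup>2 * (y $ i)\<^sup>2 \<le> ((mat_diag r D *\<^sub>v y) $ i)\<^sup>2"
      using \<open>i \<in> {..<r}\<close> mat_diag_mult_vec[OF y]
      by (auto simp: power_mult_distrib intro!: mult_right_mono)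
  qed
  then show ?thesis using y by (simp add: nsq_sum mat_diag_def sum_distrib_left)
qed

lemma nsq_M_ge:
  assumes x: "x \<in> carrier_vec n"
  shows "d\<^sup>2 * nsq (transpose_mat V *\<^sub>v x) \<le> nsq (M *\<^sub>v x)"
proof -
  have c: "transpose_mat V *\<^sub>v x \<in> carrier_vec r" using V x by simp
  have "nsq (M *\<^sub>v x) = nsq (mat_diag r D *\<^sub>v (transpose_mat V *\<^sub>v x))"
    unfolding M_mult_vec[OF x]
    by (rule orthonormal_nsq[OF U mult_mat_vec_carrier[OF mat_diag_dim c]])
  then show ?thesis using nsq_mat_diag_ge[OF c] by simp
qed

lemma row_M_zero:
  assumes "i < m" "i \<notin> row_supp U"
  shows "row M i = 0\<^sub>v n"
  unfolding M_assoc
proof (rule row_mult_zero[OF U(1) _ assms(1) row_notin_supp[OF U(1) assms]])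
  have "transpose_mat V \<in> carrier_mat r n" using V by simp
  then show "mat_diag r D * transpose_mat V \<in> carrier_mat r n"
    by (rule mult_carrier_mat[OF mat_diag_dim])
qed

text \<open>The first part converts an error in M into one in U, all singular values being at least
  d. The second says that the residual still acts through \<open>transpose_mat V\<close>, so its
  size can be tested on any frame close to V.\<close>

lemma fro2_proj_compl_M:
  assumes Q: "Q \<in> carrier_mat m r" "orthonormal_cols Q"
  shows "d\<^sup>2 * fro2 (U - Q * (transpose_mat Q * U)) \<le> fro2 (M - Q * (transpose_mat Q * M))"
    and "\<exists>H\<in>carrier_mat m r. M - Q * (transpose_mat Q * M) = H * transpose_mat V"
proof -
  define N where "N = U - Q * (transpose_mat Q * U)"
  define H where "H = N * mat_diag r D"
  have N: "N \<in> carrier_mat m r" unfolding N_def by (rule proj_compl_carrier[OF Q(1) U(1)])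
  have H: "H \<in> carrier_mat m r" using N by (simp add: H_def)
  define E where "E = mat_diag r D * transpose_mat V"
  have "transpose_mat V \<in> carrier_mat r n" using V by simp
  then have E: "E \<in> carrier_mat r n" unfolding E_def by (rule mult_carrier_mat[OF mat_diag_dim])
  have "N * E = U * E - Q * (transpose_mat Q * U) * E"
    unfolding N_def using U Q E by (intro minus_mult_distrib_mat[of _ m r _ _ n]) auto
  also have "Q * (transpose_mat Q * U) * E = Q * (transpose_mat Q * (U * E))"
    using U Q E by (simp add: assoc_mult_mat[of _ m r _ r _ n] assoc_mult_mat[of _ r m _ r _ n])
  finally have "M - Q * (transpose_mat Q * M) = N * E" by (simp add: M_assoc E_def)
  also have "N * E = H * transpose_mat V"
    unfolding H_def E_def using N V by (intro assoc_mult_mat[symmetric]) auto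
  finally have eq: "M - Q * (transpose_mat Q * M) = H * transpose_mat V" .
  then show "\<exists>H\<in>carrier_mat m r. M - Q * (transpose_mat Q * M) = H * transpose_mat V"
    using H by blast
  have "fro2 (H * transpose_mat V) = fro2 (V * transpose_mat H)"
    using fro2_transpose[of "H * transpose_mat V"] H V by (simp add: transpose_mult[of _ m r _ n])
  also have "\<dots> = fro2 H"
    using fro2_orthonormal_mult[OF V, of "transpose_mat H" m] H by simp
  also have "d\<^sup>2 * fro2 N \<le> fro2 H"
  proof -
    have "(\<Sum>i<m. \<Sum>j<r. d\<^sup>2 * (N $$ (i,j))\<^sup>2) \<le> (\<Sum>i<m. \<Sum>j<r. (N $$ (i,j) * D j)\<^sup>2)"
    proof (intro sum_mono)
      fix i j assume "j \<in> {..<r}"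
      then have "d\<^sup>2 \<le> (D j)\<^sup>2" using d D by (intro power_mono) auto
      then show "d\<^sup>2 * (N $$ (i,j))\<^sup>2 \<le> (N $$ (i,j) * D j)\<^sup>2"
        by (auto simp: power_mult_distrib mult.commute intro!: mult_right_mono)
    qed
    then show ?thesis
      using N by (simp add: H_def mat_diag_mult_right[OF N] fro2_def sum_distrib_left)
  qed
  ultimately show "d\<^sup>2 * fro2 (U - Q * (transpose_mat Q * U)) \<le> fro2 (M - Q * (transpose_mat Q * M))"
    by (simp add: eq N_def)
qed

text \<open>Closeness bounds \<open>transpose_mat W * V\<close> from below, and as a square matrix
  also its transpose. Hence every vector in the range of W has a substantial component along V, on
  which M is at least d.\<close>

lemma injective_image:
  assumes W: "W \<in> carrier_mat n r"
    and cl: "\<And>x. x \<in> carrier_vec r \<Longrightarrow> 3 / 4 * nsq x \<le> nsq (transpose_mat W *\<^sub>v (V *\<^sub>v x))"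
    and x: "x \<in> carrier_vec r"
  shows "3 / 4 * d\<^sup>2 * nsq x \<le> nsq (M *\<^sub>v (W *\<^sub>v x))"
proof -
  define S where "S = transpose_mat W * V"
  have S: "S \<in> carrier_mat r r" using W V by (simp add: S_def)
  have St: "transpose_mat S = transpose_mat V * W"
    unfolding S_def using W V by (simp add: transpose_mult[of _ r n _ r])
  have "3 / 4 * nsq x \<le> nsq (transpose_mat S *\<^sub>v x)"
  proof (rule square_inj_transpose_bound[OF S _ _ x])
    fix y :: "real vec" assume y: "y \<in> carrier_vec r"
    then have "S *\<^sub>v y = transpose_mat W *\<^sub>v (V *\<^sub>v y)"
      unfolding S_def using W V by (intro assoc_mult_mat_vec) auto
    then show "3 / 4 * nsq y \<le> nsq (S *\<^sub>v y)" using cl[OF y] by simp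
  qed simp
  also have "transpose_mat S *\<^sub>v x = transpose_mat V *\<^sub>v (W *\<^sub>v x)"
    unfolding St using W V x by (intro assoc_mult_mat_vec) auto
  finally have "d\<^sup>2 * (3 / 4 * nsq x) \<le> d\<^sup>2 * nsq (transpose_mat V *\<^sub>v (W *\<^sub>v x))"
    by (intro mult_left_mono) auto
  also have "\<dots> \<le> nsq (M *\<^sub>v (W *\<^sub>v x))"
    using W x by (intro nsq_M_ge) auto
  finally show ?thesis by (simp add: mult_ac)
qed

lemma close_frame_card:
  assumes "close_frame n r \<epsilon> s V W"
  shows "real (card (row_supp W)) \<le> real (card (row_supp V)) + s"
proof -
  have "card (row_supp W) \<le> card (row_supp V \<union> (row_supp W - row_supp V))"
    by (intro card_mono) auto
  also have "\<dots> \<le> card (row_supp V) + card (row_supp W - row_supp V)" by (rule card_Un_le)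
  finally show ?thesis using assms unfolding close_frame_def by linarith
qed

text \<open>The rows outside the support of \<open>U\<close> which survive the thresholding are counted by means of
  the two parts of \<open>W\<close>, on and off the support of \<open>V\<close>; the second part is small, so that the
  bound on their number does not deteriorate along the iteration.\<close>

lemma false_rows_card:
  assumes Z: "Z \<in> carrier_mat m n" and \<gamma>: "0 < \<gamma>"
    and ex: "excess_bound m n r Z \<gamma> B" and B: "0 \<le> B" "B \<le> C * \<gamma>\<^sup>2" and C: "1 \<le> C"
    and K: "real (card (row_supp V)) \<le> K" and s: "s = 4 * C * K"
    and \<epsilon>: "0 < \<epsilon>" "8000000 * C * \<epsilon> \<le> 1"
    and W: "close_frame n r \<epsilon> s V W"
    and F: "F \<subseteq> {..<m}" "\<And>i. i \<in> F \<Longrightarrow> \<gamma>\<^sup>2 < nsq (row (Z * W) i)"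
  shows "real (card F) \<le> s"
proof -
  define J where "J = row_supp V"
  define WJ where "WJ = restrict_rows J W"
  define e where "e = sqrt \<epsilon>"
  \<comment> \<open>The part of W off the support has Frobenius norm at most e, so dividing by e
    still gives a contraction, to which the uniform bound applies.\<close>
  define Wc where "Wc = (1 / e) \<cdot>\<^sub>m restrict_rows (- J) W"
  have e: "0 < e" "e\<^sup>2 = \<epsilon>" "e \<le> 1 / 1000"
  proof -
    show "0 < e" "e\<^sup>2 = \<epsilon>" using \<epsilon> by (auto simp: e_def)
    have "8000000 * \<epsilon> \<le> 8000000 * C * \<epsilon>" using C \<epsilon> by simp
    then have "8000000 * \<epsilon> \<le> 1" using \<epsilon>(2) by linarith
    then have "\<epsilon> \<le> (1 / 1000)\<^sup>2" using \<epsilon>(1) by (simp add: power2_eq_square)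
    then show "e \<le> 1 / 1000" unfolding e_def by (intro real_le_lsqrt) auto
  qed
  have Wm: "W \<in> carrier_mat n r" "orthonormal_cols W" using W by (auto simp: close_frame_def)
  have WJ: "WJ \<in> carrier_mat n r" using Wm by (simp add: WJ_def)
  have Wr: "restrict_rows (- J) W \<in> carrier_mat n r" using Wm by simp
  then have Wc: "Wc \<in> carrier_mat n r" by (simp add: Wc_def)
  have "contraction r WJ"
    unfolding contraction_def WJ_def using nsq_restrict_rows_le[OF Wm(1)] orthonormal_nsq[OF Wm]
    by (metis order.trans order_refl)
  have fWr: "fro2 (restrict_rows (- J) W) \<le> \<epsilon>"
  proof -
    have "{..<n} \<inter> - J = {..<n} - row_supp V" by (auto simp: J_def)
    then show ?thesis using W fro2_restrict_rows[OF Wm(1), of "- J"] by (simp add: close_frame_def)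
  qed
  have "contraction r Wc"
    unfolding contraction_def
  proof
    fix x :: "real vec" assume x: "x \<in> carrier_vec r"
    have "nsq (Wc *\<^sub>v x) = (1 / e)\<^sup>2 * nsq (restrict_rows (- J) W *\<^sub>v x)"
      unfolding Wc_def using Wr x by (simp add: smult_mat_mult_vec[of _ n r] nsq_smult)
    also have "nsq (restrict_rows (- J) W *\<^sub>v x) \<le> fro2 (restrict_rows (- J) W) * nsq x"
      by (rule nsq_mult_mat_vec_le_fro2[OF Wr x])
    also have "\<dots> \<le> \<epsilon> * nsq x" using fWr by (intro mult_right_mono) auto
    also have "(1 / e)\<^sup>2 * (\<epsilon> * nsq x) = nsq x" using e \<epsilon> by (simp add: power_divide)
    finally show "nsq (Wc *\<^sub>v x) \<le> nsq x" using e by (simp add: mult_left_mono)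
  qed
  have suppJ: "card (row_supp WJ) \<le> K"
  proof -
    have "row_supp WJ \<subseteq> row_supp V" using row_supp_restrict_rows[OF Wm(1), of J] by (auto simp: WJ_def J_def)
    then have "card (row_supp WJ) \<le> card (row_supp V)" by (intro card_mono) auto
    then show ?thesis using K by linarith
  qed
  have suppc: "card (row_supp Wc) \<le> s"
  proof -
    have "row_supp Wc \<subseteq> row_supp (restrict_rows (- J) W)"
      using Wr by (auto simp: row_supp_def Wc_def)
    also have "\<dots> = row_supp W - row_supp V"
      using row_supp_restrict_rows[OF Wm(1), of "- J"] by (auto simp: J_def)
    finally have "card (row_supp Wc) \<le> card (row_supp W - row_supp V)" by (intro card_mono) auto
    then show ?thesis using W unfolding close_frame_def by linarith
  qed
  have Wsum: "W = WJ + e \<cdot>\<^sub>m Wc"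
    using e Wm by (intro eq_matI) (auto simp: WJ_def Wc_def restrict_rows_def)
  have pt: "excess (\<gamma>\<^sup>2) (nsq (row (Z * W) i)) \<le> 3 * excess ((999 / 1000 * \<gamma>)\<^sup>2) (nsq (row (Z * WJ) i)) +
      2000000 * (\<epsilon> * excess (\<gamma>\<^sup>2) (nsq (row (Z * Wc) i)))" if i: "i < m" for i
  proof -
    have r: "row (Z * W) i = row (Z * WJ) i + e \<cdot>\<^sub>v row (Z * Wc) i"
    proof -
      have "Z * W = Z * WJ + e \<cdot>\<^sub>m (Z * Wc)"
        unfolding Wsum using Z WJ Wc
        by (simp add: mult_add_distrib_mat[of _ m n _ r] mult_smult_distrib[of _ m n _ r])
      then show ?thesis using Z WJ Wc i by (intro eq_vecI) auto
    qed
    define a b where "a = vnorm (row (Z * WJ) i)" and "b = vnorm (row (Z * Wc) i)"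
    have "vnorm (row (Z * W) i) \<le> a + vnorm (e \<cdot>\<^sub>v row (Z * Wc) i)"
      unfolding r a_def using Z WJ Wc i by (intro vnorm_triangle[of _ r]) auto
    also have "vnorm (e \<cdot>\<^sub>v row (Z * Wc) i) = e * b"
      unfolding vnorm_def b_def using e(1) by (simp only: nsq_smult real_sqrt_mult real_sqrt_abs abs_of_pos)
    finally have "vnorm (row (Z * W) i) \<le> a + e * b" .
    then have "excess (\<gamma>\<^sup>2) ((vnorm (row (Z * W) i))\<^sup>2) \<le> 3 * excess ((999 / 1000 * \<gamma>)\<^sup>2) (a\<^sup>2) +
        2000000 * excess ((\<gamma> / 1000)\<^sup>2) ((e * b)\<^sup>2)"
      using e \<gamma> by (intro excess_split) (auto simp: a_def b_def)
    also have "excess ((\<gamma> / 1000)\<^sup>2) ((e * b)\<^sup>2) \<le> e\<^sup>2 * excess (\<gamma>\<^sup>2) (b\<^sup>2)"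
      using e \<gamma> by (intro excess_scale) (auto simp: b_def)
    finally show ?thesis by (simp add: a_def b_def vnorm_power2 e)
  qed
  have "card F * \<gamma>\<^sup>2 = (\<Sum>i\<in>F. \<gamma>\<^sup>2)" by simp
  also have "\<dots> \<le> (\<Sum>i\<in>F. excess (\<gamma>\<^sup>2) (nsq (row (Z * W) i)))"
    using F by (intro sum_mono) (auto simp: excess_def intro: less_imp_le)
  also have "\<dots> \<le> (\<Sum>i<m. excess (\<gamma>\<^sup>2) (nsq (row (Z * W) i)))"
    using F by (intro sum_mono2) (auto intro: excess_nonneg)
  also have "\<dots> \<le> (\<Sum>i<m. 3 * excess ((999 / 1000 * \<gamma>)\<^sup>2) (nsq (row (Z * WJ) i)) +
      2000000 * (\<epsilon> * excess (\<gamma>\<^sup>2) (nsq (row (Z * Wc) i))))"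
    using pt by (intro sum_mono) auto
  also have "\<dots> = 3 * (\<Sum>i<m. excess ((999 / 1000 * \<gamma>)\<^sup>2) (nsq (row (Z * WJ) i))) +
      2000000 * \<epsilon> * (\<Sum>i<m. excess (\<gamma>\<^sup>2) (nsq (row (Z * Wc) i)))"
    by (simp add: sum.distrib sum_distrib_left mult.assoc)
  also have "\<dots> \<le> 3 * (B * K) + 2000000 * \<epsilon> * (B * s)"
  proof (intro add_mono mult_left_mono)
    have "(\<Sum>i<m. excess ((999 / 1000 * \<gamma>)\<^sup>2) (nsq (row (Z * WJ) i))) \<le> B * card (row_supp WJ)"
      using ex WJ \<open>contraction r WJ\<close> by (simp add: excess_bound_def)
    also have "\<dots> \<le> B * K" using suppJ B by (intro mult_left_mono) auto
    finally show "(\<Sum>i<m. excess ((999 / 1000 * \<gamma>)\<^sup>2) (nsq (row (Z * WJ) i))) \<le> B * K" .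
    have "(\<Sum>i<m. excess (\<gamma>\<^sup>2) (nsq (row (Z * Wc) i))) \<le> B * card (row_supp Wc)"
      by (rule excess_bound_upper[OF ex \<gamma> Wc \<open>contraction r Wc\<close>])
    also have "\<dots> \<le> B * s" using suppc B by (intro mult_left_mono) auto
    finally show "(\<Sum>i<m. excess (\<gamma>\<^sup>2) (nsq (row (Z * Wc) i))) \<le> B * s" .
  qed (use \<epsilon> in auto)
  \<comment> \<open>This is where s = 4 * C * K reproduces itself: by the choice of \<epsilon> the
    off-support part adds at most 1 to the 3, and 4 B K \<le> 4 C K \<gamma>^2.\<close>
  also have "\<dots> = B * K * (3 + 8000000 * C * \<epsilon>)" by (simp add: s algebra_simps)
  also have "\<dots> \<le> B * K * 4"
    using B K \<epsilon> by (intro mult_left_mono) auto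
  also have "\<dots> \<le> C * \<gamma>\<^sup>2 * K * 4" using B K by (intro mult_right_mono) auto
  finally have "card F * \<gamma>\<^sup>2 \<le> s * \<gamma>\<^sup>2" by (simp add: s mult_ac)
  then show ?thesis using \<gamma> by simp
qed

text \<open>Since A = Q R, the projection onto the complement of Q annihilates A = M W + E.
  Therefore (M - QQ'M) W = - (E - QQ'E): the new residual is governed by the thresholding error E
  alone. The accuracy of W enters only through its off-support rows inside E and through the factor
  4/3 lost in passing from the residual times W to the residual.\<close>

lemma thresholding_step:
  assumes \<eta>: "thresholding_fun \<eta>" and Z: "Z \<in> carrier_mat m n" and \<gamma>: "0 < \<gamma>"
    and ex: "excess_bound m n r Z \<gamma> B" and B: "0 \<le> B" "B \<le> C * \<gamma>\<^sup>2" and C: "1 \<le> C"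
    and K: "real (card (row_supp U)) \<le> K" "real (card (row_supp V)) \<le> K" and s: "s = 4 * C * K"
    and \<delta>: "\<delta> = 4 * \<gamma>\<^sup>2 * K + 4 * B * (K + s)"
    and \<epsilon>: "0 < \<epsilon>" "8000000 * C * \<epsilon> \<le> 1" "4 / 3 * \<delta> \<le> \<epsilon> * d\<^sup>2"
    and W: "close_frame n r \<epsilon> s V W"
    and QR: "is_qr (row_threshold \<eta> \<gamma> ((M + Z) * W)) Q R"
  shows "close_frame m r \<epsilon> s U Q" and "fro2 (M - Q * (transpose_mat Q * M)) \<le> 4 / 3 * \<delta>"
proof -
  have Wm: "W \<in> carrier_mat n r" "orthonormal_cols W" using W by (auto simp: close_frame_def)
  have Wcl: "\<And>x. x \<in> carrier_vec r \<Longrightarrow> 3 / 4 * nsq x \<le> nsq (transpose_mat W *\<^sub>v (V *\<^sub>v x))"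
    using W by (auto simp: close_frame_def)
  note Mc = M_carrier
  define X where "X = M + Z"
  have X: "X \<in> carrier_mat m n" using Mc Z by (simp add: X_def)
  define A where "A = row_threshold \<eta> \<gamma> (X * W)"
  have XW: "X * W \<in> carrier_mat m r" using X Wm by simp
  have A: "A \<in> carrier_mat m r" unfolding A_def by (rule row_threshold_carrier[OF XW])
  have Q: "Q \<in> carrier_mat m r" "orthonormal_cols Q" and R: "R \<in> carrier_mat r r" and QRA: "Q * R = A"
    using QR A unfolding is_qr_def X_def[symmetric] A_def[symmetric] by auto
  have QQ: "transpose_mat Q * Q = 1\<^sub>m r" using Q by (simp add: orthonormal_cols_def)
  define E where "E = A - M * W"
  have MW: "M * W \<in> carrier_mat m r" using Mc Wm by simp
  have E: "E \<in> carrier_mat m r" unfolding E_def by (rule minus_carrier_mat[OF MW])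
  have XWsum: "X * W = M * W + Z * W"
    unfolding X_def using Mc Z Wm by (intro add_mult_distrib_mat) auto
  have ZW: "Z * W \<in> carrier_mat m r" using Z Wm by simp
  have rowX: "row (X * W) i = row (M * W) i + row (Z * W) i" if "i < m" for i
    unfolding XWsum using that MW ZW by (intro row_add) auto
  have rowX0: "row (X * W) i = row (Z * W) i" if "i < m" "i \<notin> row_supp U" for i
    using rowX[OF that(1)] row_mult_zero[OF Mc Wm(1) that(1) row_M_zero[OF that]] ZW that by simp
  have rowE: "row E i = row A i - row (M * W) i" if "i < m" for i
    unfolding E_def by (rule row_minus[OF A MW that])
  \<comment> \<open>On the support the row of E splits into the shift by the thresholding, at most
    \<gamma>, and the noise row, whose energy is at most \<gamma>^2 plus its excess. Off the support
    the row of M * W vanishes, and what survives is noise above the threshold.\<close>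
  have E_row: "nsq (row E i) \<le> (if i \<in> row_supp U then 4 * \<gamma>\<^sup>2 else 0) + 4 * excess (\<gamma>\<^sup>2) (nsq (row (Z * W) i))"
    if i: "i < m" for i
  proof (cases "i \<in> row_supp U")
    case True
    have c: "row A i \<in> carrier_vec r" "row (M * W) i \<in> carrier_vec r" "row (Z * W) i \<in> carrier_vec r"
      using i A MW ZW by auto
    have "row E i = (row A i - row (X * W) i) + row (Z * W) i"
      unfolding rowE[OF i] rowX[OF i] using c by (intro eq_vecI) auto
    also have "nsq \<dots> \<le> 2 * nsq (row A i - row (X * W) i) + 2 * nsq (row (Z * W) i)"
      using c rowX[OF i] by (intro nsq_add_le[of _ r]) auto
    also have "nsq (row A i - row (X * W) i) \<le> \<gamma>\<^sup>2"
      unfolding A_def by (rule row_threshold_error(1)[OF \<eta> \<gamma> XW i])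
    also have "nsq (row (Z * W) i) \<le> \<gamma>\<^sup>2 + excess (\<gamma>\<^sup>2) (nsq (row (Z * W) i))"
      by (simp add: excess_def)
    finally have "nsq (row E i) \<le> 4 * \<gamma>\<^sup>2 + 2 * excess (\<gamma>\<^sup>2) (nsq (row (Z * W) i))" by simp
    also have "\<dots> \<le> 4 * \<gamma>\<^sup>2 + 4 * excess (\<gamma>\<^sup>2) (nsq (row (Z * W) i))"
      using excess_nonneg[of "nsq (row (Z * W) i)" "\<gamma>\<^sup>2"] by simp
    finally show ?thesis using True by simp
  next
    case False
    have "row (M * W) i = 0\<^sub>v r" by (rule row_mult_zero[OF Mc Wm(1) i row_M_zero[OF i False]])
    then have "row E i = row A i" unfolding rowE[OF i] using i A by (intro eq_vecI) auto
    then have "nsq (row E i) \<le> 4 * excess (\<gamma>\<^sup>2) (nsq (row (X * W) i))"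
      using row_threshold_error(2)[OF \<eta> \<gamma> XW i] by (simp add: A_def)
    then show ?thesis using False rowX0[OF i False] by simp
  qed
  have froE: "fro2 E \<le> \<delta>"
  proof -
    have "fro2 E = (\<Sum>i<m. nsq (row E i))" using E by (simp add: fro2_rows)
    also have "\<dots> \<le> (\<Sum>i<m. (if i \<in> row_supp U then 4 * \<gamma>\<^sup>2 else 0) + 4 * excess (\<gamma>\<^sup>2) (nsq (row (Z * W) i)))"
      using E_row by (intro sum_mono) auto
    also have "\<dots> = 4 * \<gamma>\<^sup>2 * card ({..<m} \<inter> row_supp U) + 4 * (\<Sum>i<m. excess (\<gamma>\<^sup>2) (nsq (row (Z * W) i)))"
      by (simp add: sum.distrib sum.If_cases sum_distrib_left)
    also have "\<dots> \<le> 4 * \<gamma>\<^sup>2 * K + 4 * (B * (K + s))"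
    proof (intro add_mono mult_left_mono)
      have "card ({..<m} \<inter> row_supp U) \<le> card (row_supp U)" by (intro card_mono) auto
      then show "real (card ({..<m} \<inter> row_supp U)) \<le> K" using K by linarith
      have "(\<Sum>i<m. excess (\<gamma>\<^sup>2) (nsq (row (Z * W) i))) \<le> B * card (row_supp W)"
        by (rule excess_bound_upper[OF ex \<gamma> Wm(1) contraction_orthonormal[OF Wm]])
      also have "\<dots> \<le> B * (K + s)" using close_frame_card[OF W] K B by (intro mult_left_mono) auto
      finally show "(\<Sum>i<m. excess (\<gamma>\<^sup>2) (nsq (row (Z * W) i))) \<le> B * (K + s)" .
    qed auto
    finally show ?thesis by (simp add: \<delta>)
  qed
  define G where "G = M - Q * (transpose_mat Q * M)"
  have G: "G \<in> carrier_mat m n" unfolding G_def by (rule proj_compl_carrier[OF Q(1) Mc])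
  \<comment> \<open>The projection QQ' fixes A, whose columns lie in the range of Q.\<close>
  have "G * W = - (E - Q * (transpose_mat Q * E))"
  proof -
    have QA: "Q * (transpose_mat Q * A) = A"
      using Q R QQ unfolding QRA[symmetric]
      by (simp add: assoc_mult_mat[of _ r m _ r _ r, symmetric])
    have "G * W = M * W - Q * (transpose_mat Q * M) * W"
      unfolding G_def using Mc Q Wm by (intro minus_mult_distrib_mat) auto
    also have "Q * (transpose_mat Q * M) * W = Q * (transpose_mat Q * (M * W))"
      using Mc Q Wm by (simp add: assoc_mult_mat[of _ m r _ n _ r] assoc_mult_mat[of _ r m _ n _ r])
    finally have GW: "G * W = M * W - Q * (transpose_mat Q * (M * W))" .
    have "transpose_mat Q * E = transpose_mat Q * A - transpose_mat Q * (M * W)"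
      unfolding E_def using Q A MW by (intro mult_minus_distrib_mat) auto
    then have "Q * (transpose_mat Q * E) = Q * (transpose_mat Q * A) - Q * (transpose_mat Q * (M * W))"
      using Q A MW by (simp add: mult_minus_distrib_mat[of _ m r _ r])
    then have "Q * (transpose_mat Q * E) = A - Q * (transpose_mat Q * (M * W))" by (simp add: QA)
    then show ?thesis
      unfolding GW E_def using A MW Q by (intro eq_matI) auto
  qed
  then have "fro2 (G * W) = fro2 (E - Q * (transpose_mat Q * E))"
    by (simp add: fro2_uminus)
  also have "\<dots> \<le> fro2 E" by (rule fro2_proj_compl_le[OF Q E])
  finally have froGW: "fro2 (G * W) \<le> \<delta>" using froE by linarith
  obtain H where H: "H \<in> carrier_mat m r" "G = H * transpose_mat V"
    using fro2_proj_compl_M(2)[OF Q] by (auto simp: G_def)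
  have Ht: "transpose_mat H \<in> carrier_mat r m" using H by simp
  have Gt: "transpose_mat G = V * transpose_mat H"
    unfolding H(2) using H V by (simp add: transpose_mult[of _ m r _ n])
  \<comment> \<open>G factors through \<open>transpose_mat V\<close>, so the transpose of G * W is
    (W'V) H'. The lower bound for W'V recovers the norm of H, which is that of G.\<close>
  have "3 / 4 * fro2 (transpose_mat H) \<le> fro2 ((transpose_mat W * V) * transpose_mat H)"
  proof (rule fro2_mult_left_ge[OF _ Ht])
    show "transpose_mat W * V \<in> carrier_mat r r" using Wm V by simp
    fix x :: "real vec" assume x: "x \<in> carrier_vec r"
    have "(transpose_mat W * V) *\<^sub>v x = transpose_mat W *\<^sub>v (V *\<^sub>v x)"
      using x Wm V by (intro assoc_mult_mat_vec) auto
    then show "3 / 4 * nsq x \<le> nsq ((transpose_mat W * V) *\<^sub>v x)" using Wcl[OF x] by simp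
  qed
  also have "(transpose_mat W * V) * transpose_mat H = transpose_mat (G * W)"
    using G Wm V Ht Gt by (simp add: transpose_mult[of _ m n _ r] assoc_mult_mat[of _ r n _ r _ m])
  also have "fro2 (transpose_mat H) = fro2 (transpose_mat G)"
    unfolding Gt by (rule fro2_orthonormal_mult[OF V Ht, symmetric])
  finally have "3 / 4 * fro2 G \<le> \<delta>" using froGW by simp
  then show froG: "fro2 (M - Q * (transpose_mat Q * M)) \<le> 4 / 3 * \<delta>" by (simp add: G_def)
  define N where "N = U - Q * (transpose_mat Q * U)"
  have N: "N \<in> carrier_mat m r" unfolding N_def by (rule proj_compl_carrier[OF Q(1) U(1)])
  have "d\<^sup>2 * fro2 N \<le> \<epsilon> * d\<^sup>2"
    using fro2_proj_compl_M(1)[OF Q] froG \<epsilon> by (simp add: N_def)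
  then have froN: "fro2 N \<le> \<epsilon>" using d by simp
  have \<epsilon>4: "\<epsilon> \<le> 1 / 4"
  proof -
    have "8000000 * \<epsilon> \<le> 8000000 * C * \<epsilon>" using C \<epsilon> by simp
    then show ?thesis using \<epsilon> by linarith
  qed
  show "close_frame m r \<epsilon> s U Q"
    unfolding close_frame_def
  proof (intro conjI ballI)
    show "Q \<in> carrier_mat m r" "orthonormal_cols Q" by fact+
    fix x :: "real vec" assume x: "x \<in> carrier_vec r"
    have Ux: "U *\<^sub>v x \<in> carrier_vec m" using U x by simp
    have "N *\<^sub>v x = U *\<^sub>v x - Q *\<^sub>v (transpose_mat Q *\<^sub>v (U *\<^sub>v x))"
      unfolding N_def using U Q x
      by (simp add: minus_mult_distrib_mat_vec[of _ m r] assoc_mult_mat_vec[of _ m r _ r] assoc_mult_mat_vec[of _ r m _ r])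
    then have "nsq (U *\<^sub>v x) = nsq (transpose_mat Q *\<^sub>v (U *\<^sub>v x)) + nsq (N *\<^sub>v x)"
      using orthonormal_proj_decomp[OF Q Ux] by simp
    moreover have "nsq (U *\<^sub>v x) = nsq x" by (rule orthonormal_nsq[OF U x])
    moreover have "nsq (N *\<^sub>v x) \<le> 1 / 4 * nsq x"
    proof -
      have "nsq (N *\<^sub>v x) \<le> fro2 N * nsq x" by (rule nsq_mult_mat_vec_le_fro2[OF N x])
      also have "\<dots> \<le> 1 / 4 * nsq x" using froN \<epsilon>4 by (intro mult_right_mono) auto
      finally show ?thesis .
    qed
    ultimately show "3 / 4 * nsq x \<le> nsq (transpose_mat Q *\<^sub>v (U *\<^sub>v x))" by simp
  next
    \<comment> \<open>Both \<open>fro2 P\<close> and \<open>fro2 N\<close> equal r minus the squared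
      norm of Q'U: two frames with equally many columns are equally far from each other. Off the
      support of U the rows of P and Q agree.\<close>
    define P where "P = Q - U * (transpose_mat U * Q)"
    have P: "P \<in> carrier_mat m r" unfolding P_def by (rule proj_compl_carrier[OF U(1) Q(1)])
    have "fro2 P = r - fro2 (transpose_mat U * Q)"
      unfolding P_def using fro2_proj_compl[OF U Q(1)] fro2_orthonormal[OF Q] by simp
    also have "fro2 (transpose_mat U * Q) = fro2 (transpose_mat Q * U)"
      using fro2_transpose[of "transpose_mat U * Q"] U Q by (simp add: transpose_mult[of _ r m _ r])
    also have "r - fro2 (transpose_mat Q * U) = fro2 N"
      unfolding N_def using fro2_proj_compl[OF Q U(1)] fro2_orthonormal[OF U] by simp
    finally have froP: "fro2 P \<le> \<epsilon>" using froN by simp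
    have "(\<Sum>i\<in>{..<m} - row_supp U. nsq (row Q i)) = (\<Sum>i\<in>{..<m} - row_supp U. nsq (row P i))"
    proof (intro sum.cong refl)
      fix i assume "i \<in> {..<m} - row_supp U"
      then have i: "i < m" "i \<notin> row_supp U" by auto
      have "row (U * (transpose_mat U * Q)) i = 0\<^sub>v r"
        using U Q i by (intro row_mult_zero[OF U(1)] row_notin_supp) auto
      then have "row P i = row Q i"
      proof -
        have "row P i = row Q i - row (U * (transpose_mat U * Q)) i"
          unfolding P_def using U Q i by (intro row_minus[of _ m r]) auto
        then show ?thesis using \<open>row (U * _) i = _\<close> Q i by simp
      qed
      then show "nsq (row Q i) = nsq (row P i)" by simp
    qed
    also have "\<dots> \<le> (\<Sum>i<m. nsq (row P i))" by (intro sum_mono2) auto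
    also have "\<dots> = fro2 P" using P by (simp add: fro2_rows)
    finally show "(\<Sum>i\<in>{..<m} - row_supp U. nsq (row Q i)) \<le> \<epsilon>" using froP by simp
  next
    \<comment> \<open>If A were rank deficient, a QR factor Q could have columns with arbitrary
      support. A kernel vector x of R would satisfy M W x = - E x, but M W is bounded below by 3/4
      d^2 and E above by \<delta>, in squared norms. With R invertible, Q = A R^(-1), so zero rows
      of A are zero rows of Q.\<close>
    have "det R \<noteq> 0"
    proof
      assume "det R = 0"
      then obtain x where x: "x \<in> carrier_vec r" "x \<noteq> 0\<^sub>v r" "R *\<^sub>v x = 0\<^sub>v r"
        using det_0_iff_vec_prod_zero[OF R] by blast
      have Ax: "A *\<^sub>v x = 0\<^sub>v m"
      proof -
        have "Q *\<^sub>v 0\<^sub>v r = 0\<^sub>v m" using Q(1) by (intro eq_vecI) auto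
        then show ?thesis
          using Q(1) R x unfolding QRA[symmetric] by (simp add: assoc_mult_mat_vec[of _ m r _ r])
      qed
      have "E *\<^sub>v x = A *\<^sub>v x - (M * W) *\<^sub>v x"
        unfolding E_def using A MW x by (intro minus_mult_distrib_mat_vec) auto
      then have Ex: "E *\<^sub>v x = - (M *\<^sub>v (W *\<^sub>v x))"
        using Ax Mc Wm x by (simp add: assoc_mult_mat_vec[of _ m n _ r])
      have "3 / 4 * d\<^sup>2 * nsq x \<le> nsq (M *\<^sub>v (W *\<^sub>v x))"
        by (rule injective_image[OF Wm(1) Wcl x(1)])
      also have "\<dots> = nsq (E *\<^sub>v x)" unfolding Ex using Mc Wm x by (simp add: nsq_sum)
      also have "\<dots> \<le> fro2 E * nsq x" by (rule nsq_mult_mat_vec_le_fro2[OF E x(1)])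
      also have "\<dots> \<le> \<delta> * nsq x" using froE by (intro mult_right_mono) auto
      finally have *: "3 / 4 * d\<^sup>2 * nsq x \<le> \<delta> * nsq x" .
      have "0 < nsq x" using nsq_eq_0_iff[OF x(1)] x(2) nsq_nonneg[of x] by linarith
      then have "3 / 4 * d\<^sup>2 \<le> \<delta>" using * by simp
      moreover have "\<epsilon> * d\<^sup>2 \<le> 1 / 4 * d\<^sup>2" using \<epsilon>4 by (intro mult_right_mono) auto
      moreover have "0 < d\<^sup>2" using d by simp
      ultimately show False using \<epsilon>(3) by linarith
    qed
    then obtain Ri where Ri: "Ri \<in> carrier_mat r r" "R * Ri = 1\<^sub>m r"
      using det_non_zero_imp_unit[OF R, unfolded Units_def ring_mat_def] by auto
    have QA: "Q = A * Ri"
      using Q R Ri unfolding QRA[symmetric] by (simp add: assoc_mult_mat[of _ m r _ r _ r])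
    show "real (card (row_supp Q - row_supp U)) \<le> s"
    proof (rule false_rows_card[OF Z \<gamma> ex B C K(2) s \<epsilon>(1,2) W])
      show "row_supp Q - row_supp U \<subseteq> {..<m}" using Q by (auto simp: row_supp_def)
      fix i assume i: "i \<in> row_supp Q - row_supp U"
      then have im: "i < m" and iU: "i \<notin> row_supp U" using Q by (auto simp: row_supp_def)
      show "\<gamma>\<^sup>2 < nsq (row (Z * W) i)"
      proof (rule ccontr)
        assume "\<not> ?thesis"
        then have "excess (\<gamma>\<^sup>2) (nsq (row (X * W) i)) = 0" using rowX0[OF im iU] by (simp add: excess_def)
        then have "nsq (row A i) \<le> 0"
          using row_threshold_error(2)[OF \<eta> \<gamma> XW im] by (simp add: A_def)
        then have "nsq (row A i) = 0" using nsq_nonneg[of "row A i"] by linarith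
        then have "row A i = 0\<^sub>v r" using nsq_eq_0_iff[of "row A i" r] A im by simp
        then have "row Q i = 0\<^sub>v r" unfolding QA using A Ri im by (intro row_mult_zero) auto
        then show False using i Q by (auto simp: row_supp_def)
      qed
    qed
  qed
qed

end

section \<open>The reconstruction from two close frames\<close>

lemma proj_mult_fro2_le:
  assumes Q: "Q \<in> carrier_mat m r" "orthonormal_cols Q" and B: "B \<in> carrier_mat m p"
  shows "fro2 (Q * (transpose_mat Q * B)) \<le> fro2 B"
proof -
  have "fro2 (Q * (transpose_mat Q * B)) = fro2 (transpose_mat Q * B)"
    using Q B by (intro fro2_orthonormal_mult) auto
  then show ?thesis using fro2_transpose_orthonormal_mult[OF Q B] by simp
qed

context low_rank
begin

text \<open>With the projections P on the left and R on the right, the error is P Z R - (M - P M) -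
  P (M - M R). The last two terms are residuals of the two frames; the first is noise seen through
  both frames.\<close>

lemma reconstruction_error:
  assumes Z: "Z \<in> carrier_mat m n" and \<gamma>: "0 < \<gamma>" and ex: "excess_bound m n r Z \<gamma> B" and B: "0 \<le> B"
    and K: "real (card (row_supp U)) \<le> K" "real (card (row_supp V)) \<le> K"
    and Q: "close_frame m r \<epsilon> s U Q" and W: "close_frame n r \<epsilon> s V W"
    and a: "fro2 (M - Q * (transpose_mat Q * M)) \<le> a"
      "fro2 (transpose_mat M - W * (transpose_mat W * transpose_mat M)) \<le> a"
  shows "fro2 (Q * transpose_mat Q * (M + Z) * (W * transpose_mat W) - M) \<le> 2 * (\<gamma>\<^sup>2 + B) * (K + s) + 8 * a"
proof -
  note Mc = M_carrier
  have Qm: "Q \<in> carrier_mat m r" "orthonormal_cols Q" using Q by (auto simp: close_frame_def)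
  have Wm: "W \<in> carrier_mat n r" "orthonormal_cols W" using W by (auto simp: close_frame_def)
  have Qt: "transpose_mat Q \<in> carrier_mat r m" and Wt: "transpose_mat W \<in> carrier_mat r n"
    using Qm Wm by auto
  define R where "R = W * transpose_mat W"
  have R: "R \<in> carrier_mat n n" unfolding R_def by (rule mult_carrier_mat[OF Wm(1) Wt])
  have Rt: "transpose_mat R = R"
    unfolding R_def using Wm Wt by (simp add: transpose_mult[of _ n r _ n])
  define P where "P A = Q * (transpose_mat Q * A)" for A
  have Pc: "P A \<in> carrier_mat m n" if "A \<in> carrier_mat m n" for A
    unfolding P_def by (rule mult_carrier_mat[OF Qm(1) mult_carrier_mat[OF Qt that]])
  have Pm: "P (A - A') = P A - P A'" "P (A + A') = P A + P A'"
    if "A \<in> carrier_mat m n" "A' \<in> carrier_mat m n" for A A'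
    unfolding P_def using that Qm(1) Qt
    by (simp_all add: mult_minus_distrib_mat[of _ r m _ n] mult_minus_distrib_mat[of _ m r _ n]
        mult_add_distrib_mat[of _ r m _ n] mult_add_distrib_mat[of _ m r _ n])
  have MR: "M * R \<in> carrier_mat m n" and ZR: "Z * R \<in> carrier_mat m n" using Mc Z R by auto
  have XR: "(M + Z) * R = M * R + Z * R"
    using Mc Z R by (intro add_mult_distrib_mat) auto
  have assoc: "Q * transpose_mat Q * (M + Z) * R = P ((M + Z) * R)"
  proof -
    have X: "M + Z \<in> carrier_mat m n" using Mc Z by simp
    have "Q * transpose_mat Q * (M + Z) = Q * (transpose_mat Q * (M + Z))"
      by (rule assoc_mult_mat[OF Qm(1) Qt X])
    also have "\<dots> * R = Q * (transpose_mat Q * (M + Z) * R)"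
      by (rule assoc_mult_mat[OF Qm(1) mult_carrier_mat[OF Qt X] R])
    also have "transpose_mat Q * (M + Z) * R = transpose_mat Q * ((M + Z) * R)"
      by (rule assoc_mult_mat[OF Qt X R])
    finally show ?thesis by (simp add: P_def)
  qed
  define T1 T2 T3 where "T1 = P (Z * R)" and "T2 = M - P M" and "T3 = P (M - M * R)"
  have T: "T1 \<in> carrier_mat m n" "T2 \<in> carrier_mat m n" "T3 \<in> carrier_mat m n"
    unfolding T1_def T2_def T3_def using Pc Mc MR ZR by (auto intro!: minus_carrier_mat Pc)
  have "P ((M + Z) * R) - M = T1 + (- (T2 + T3))"
    unfolding XR Pm(2)[OF MR ZR] T1_def T2_def T3_def Pm(1)[OF Mc MR]
    using Pc[OF MR] Pc[OF ZR] Pc[OF Mc] Mc by (intro eq_matI) auto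
  then have "fro2 (P ((M + Z) * R) - M) \<le> 2 * fro2 T1 + 2 * fro2 (- (T2 + T3))"
    using fro2_add_le[of T1 m n "- (T2 + T3)"] T by simp
  also have "fro2 (- (T2 + T3)) \<le> 2 * fro2 T2 + 2 * fro2 T3"
    unfolding fro2_uminus by (rule fro2_add_le[OF T(2,3)])
  also have "fro2 T2 \<le> a" using a(1) by (simp add: T2_def P_def)
  also have "fro2 T3 \<le> fro2 (M - M * R)"
    unfolding T3_def P_def by (rule proj_mult_fro2_le[OF Qm minus_carrier_mat[OF MR]])
  also have "fro2 (M - M * R) \<le> a"
  proof -
    have "transpose_mat (M - M * R) = transpose_mat M - transpose_mat (M * R)"
      using Mc MR by (intro eq_matI) auto
    also have "transpose_mat (M * R) = R * transpose_mat M"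
      using Mc R Rt by (simp add: transpose_mult[of _ m n _ n])
    also have "\<dots> = W * (transpose_mat W * transpose_mat M)"
      unfolding R_def using Mc by (intro assoc_mult_mat[OF Wm(1) Wt]) simp
    finally show ?thesis using a(2) fro2_transpose[of "M - M * R"] by simp
  qed
  also have "fro2 T1 \<le> (\<gamma>\<^sup>2 + B) * (K + s)"
  proof -
    have ZW: "Z * W \<in> carrier_mat m r" using Z Wm by simp
    have QZW: "transpose_mat Q * (Z * W) \<in> carrier_mat r r" by (rule mult_carrier_mat[OF Qt ZW])
    have "Z * R = Z * W * transpose_mat W"
      unfolding R_def by (rule assoc_mult_mat[symmetric, OF Z Wm(1) Wt])
    then have "transpose_mat Q * (Z * R) = transpose_mat Q * (Z * W) * transpose_mat W"
      using assoc_mult_mat[OF Qt ZW Wt] by simp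
    then have "fro2 T1 = fro2 (transpose_mat Q * (Z * W) * transpose_mat W)"
      unfolding T1_def P_def using fro2_orthonormal_mult[OF Qm mult_carrier_mat[OF Qt ZR]] by simp
    also have "\<dots> = fro2 (W * transpose_mat (transpose_mat Q * (Z * W)))"
    proof -
      have "transpose_mat (transpose_mat Q * (Z * W) * transpose_mat W) =
          W * transpose_mat (transpose_mat Q * (Z * W))"
        using transpose_mult[OF QZW Wt] by simp
      then show ?thesis using fro2_transpose[of "transpose_mat Q * (Z * W) * transpose_mat W"] by simp
    qed
    also have "\<dots> = fro2 (transpose_mat Q * (Z * W))"
      using fro2_orthonormal_mult[OF Wm, of "transpose_mat (transpose_mat Q * (Z * W))" r] QZW by simp
    \<comment> \<open>Only the at most K + s rows of Z * W in the support of Q are seen by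
      \<open>transpose_mat Q\<close>. Each contributes at most \<gamma>^2 plus its excess.\<close>
    also have "transpose_mat Q * (Z * W) = transpose_mat Q * restrict_rows (row_supp Q) (Z * W)"
      by (rule mult_restrict_rows[OF Qm(1) ZW order_refl, symmetric])
    also have "fro2 \<dots> \<le> fro2 (restrict_rows (row_supp Q) (Z * W))"
      by (rule fro2_transpose_orthonormal_mult[OF Qm restrict_rows_carrier[OF ZW]])
    also have "\<dots> = (\<Sum>i\<in>{..<m} \<inter> row_supp Q. nsq (row (Z * W) i))"
      by (rule fro2_restrict_rows[OF ZW])
    also have "\<dots> \<le> (\<Sum>i\<in>{..<m} \<inter> row_supp Q. \<gamma>\<^sup>2 + excess (\<gamma>\<^sup>2) (nsq (row (Z * W) i)))"
      by (intro sum_mono) (simp add: excess_def)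
    also have "\<dots> = \<gamma>\<^sup>2 * card ({..<m} \<inter> row_supp Q) + (\<Sum>i\<in>{..<m} \<inter> row_supp Q. excess (\<gamma>\<^sup>2) (nsq (row (Z * W) i)))"
      by (simp add: sum.distrib)
    also have "\<dots> \<le> \<gamma>\<^sup>2 * (K + s) + B * (K + s)"
    proof (intro add_mono mult_left_mono)
      have "card ({..<m} \<inter> row_supp Q) \<le> card (row_supp Q)" by (intro card_mono) auto
      moreover have "real (card (row_supp Q)) \<le> real (card (row_supp U)) + s"
        using low_rank.close_frame_card[OF low_rank_transpose Q] .
      ultimately show "real (card ({..<m} \<inter> row_supp Q)) \<le> K + s" using K by linarith
      have "(\<Sum>i\<in>{..<m} \<inter> row_supp Q. excess (\<gamma>\<^sup>2) (nsq (row (Z * W) i))) \<le> (\<Sum>i<m. excess (\<gamma>\<^sup>2) (nsq (row (Z * W) i)))"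
        by (intro sum_mono2) (auto intro: excess_nonneg)
      also have "\<dots> \<le> B * card (row_supp W)"
        by (rule excess_bound_upper[OF ex \<gamma> Wm(1) contraction_orthonormal[OF Wm]])
      also have "\<dots> \<le> B * (K + s)" using close_frame_card[OF W] K B by (intro mult_left_mono) auto
      finally show "(\<Sum>i\<in>{..<m} \<inter> row_supp Q. excess (\<gamma>\<^sup>2) (nsq (row (Z * W) i))) \<le> B * (K + s)" .
    qed auto
    finally show ?thesis by (simp add: algebra_simps)
  qed
  finally have "fro2 (P ((M + Z) * R) - M) \<le> 2 * ((\<gamma>\<^sup>2 + B) * (K + s)) + 8 * a" by simp
  then show ?thesis unfolding R_def[symmetric] assoc by (simp only: mult.assoc)
qed

text \<open>The difference vanishes on vectors orthogonal to the columns of both W and V, which S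
  stacks, so it has at most 2 r nonzero singular values. The power of 2 is at most 2 because 2 / q -
  1 \<le> 1.\<close>

lemma schatten_norm_reconstruction:
  assumes W: "W \<in> carrier_mat n r" and A: "A \<in> carrier_mat m n" and r: "1 \<le> r"
    and q: "1 \<le> q" "q \<le> 2"
    and Mhat: "Mhat = A * (W * transpose_mat W)"
  shows "(schatten_norm q (Mhat - M))\<^sup>2 \<le> 2 * real r powr (2 / q - 1) * fro2 (Mhat - M)"
proof -
  define S where "S = mat (2 * r) n (\<lambda>(i,j). if i < r then W $$ (j,i) else V $$ (j,i - r))"
  have S: "S \<in> carrier_mat (2 * r) n" by (simp add: S_def)
  have Wt: "transpose_mat W \<in> carrier_mat r n" using W by simp
  have WW: "W * transpose_mat W \<in> carrier_mat n n" by (rule mult_carrier_mat[OF W Wt])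
  have Mh: "Mhat \<in> carrier_mat m n" unfolding Mhat by (rule mult_carrier_mat[OF A WW])
  have D: "Mhat - M \<in> carrier_mat m n" by (rule minus_carrier_mat[OF M_carrier])
  have ker: "(Mhat - M) *\<^sub>v x = 0\<^sub>v m" if x: "x \<in> carrier_vec n" "S *\<^sub>v x = 0\<^sub>v (2 * r)" for x
  proof -
    have "(transpose_mat W *\<^sub>v x) $ i = (S *\<^sub>v x) $ i" if "i < r" for i
      using that x(1) W by (auto simp: S_def scalar_prod_def intro!: sum.cong)
    then have Wx: "transpose_mat W *\<^sub>v x = 0\<^sub>v r"
      using x(2) W by (intro eq_vecI) auto
    have "(transpose_mat V *\<^sub>v x) $ i = (S *\<^sub>v x) $ (i + r)" if "i < r" for i
      using that x(1) V by (auto simp: S_def scalar_prod_def intro!: sum.cong)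
    then have Vx: "transpose_mat V *\<^sub>v x = 0\<^sub>v r"
      using x(2) V by (intro eq_vecI) auto
    have "(W * transpose_mat W) *\<^sub>v x = W *\<^sub>v 0\<^sub>v r"
      using assoc_mult_mat_vec[OF W Wt x(1)] Wx by simp
    also have "\<dots> = 0\<^sub>v n" using W by (intro eq_vecI) auto
    finally have "Mhat *\<^sub>v x = A *\<^sub>v 0\<^sub>v n"
      unfolding Mhat using assoc_mult_mat_vec[OF A WW x(1)] by simp
    also have "\<dots> = 0\<^sub>v m" using A by (intro eq_vecI) auto
    finally have 1: "Mhat *\<^sub>v x = 0\<^sub>v m" .
    have "mat_diag r D *\<^sub>v 0\<^sub>v r = 0\<^sub>v r" by (intro eq_vecI) (auto simp: mat_diag_def)
    moreover have "U *\<^sub>v 0\<^sub>v r = 0\<^sub>v m" using U by (intro eq_vecI) auto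
    ultimately have 2: "M *\<^sub>v x = 0\<^sub>v m" using M_mult_vec[OF x(1)] Vx by simp
    have "(Mhat - M) *\<^sub>v x = Mhat *\<^sub>v x - M *\<^sub>v x"
      by (rule minus_mult_distrib_mat_vec[OF Mh M_carrier x(1)])
    then show ?thesis using 1 2 by simp
  qed
  have "(schatten_norm q (Mhat - M))\<^sup>2 \<le> real (2 * r) powr (2 / q - 1) * fro2 (Mhat - M)"
    using r q ker by (intro schatten_norm_low_rank[OF D S]) auto
  also have "\<dots> \<le> 2 * real r powr (2 / q - 1) * fro2 (Mhat - M)"
  proof (rule mult_right_mono)
    have "real (2 * r) powr (2 / q - 1) = 2 powr (2 / q - 1) * real r powr (2 / q - 1)"
      by (simp add: powr_mult)
    also have "(2 :: real) powr (2 / q - 1) \<le> 2 powr 1"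
      using q by (intro powr_mono) (auto simp: divide_le_eq)
    finally show "real (2 * r) powr (2 / q - 1) \<le> 2 * real r powr (2 / q - 1)"
      by (simp add: mult_right_mono)
  qed simp
  finally show ?thesis .
qed

lemma nsq_M_le:
  assumes D': "\<And>i. i < r \<Longrightarrow> D i \<le> c" and x: "x \<in> carrier_vec n"
  shows "nsq (M *\<^sub>v x) \<le> c\<^sup>2 * nsq x"
proof -
  define y where "y = transpose_mat V *\<^sub>v x"
  have y: "y \<in> carrier_vec r" using V x by (simp add: y_def)
  have "nsq (M *\<^sub>v x) = nsq (mat_diag r D *\<^sub>v y)"
    unfolding M_mult_vec[OF x] y_def[symmetric]
    by (rule orthonormal_nsq[OF U mult_mat_vec_carrier[OF mat_diag_dim y]])
  also have "\<dots> = (\<Sum>i<r. (D i * y $ i)\<^sup>2)"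
    using mat_diag_mult_vec[OF y] by (simp add: nsq_sum mat_diag_def)
  also have "\<dots> \<le> (\<Sum>i<r. c\<^sup>2 * (y $ i)\<^sup>2)"
  proof (rule sum_mono)
    fix i assume "i \<in> {..<r}"
    then have "0 \<le> D i" "D i \<le> c" using D[of i] d D' by auto
    then have "(D i)\<^sup>2 \<le> c\<^sup>2" by (intro power_mono) auto
    then show "(D i * y $ i)\<^sup>2 \<le> c\<^sup>2 * (y $ i)\<^sup>2"
      by (simp add: power_mult_distrib mult_right_mono)
  qed
  also have "\<dots> = c\<^sup>2 * nsq y" using y by (simp add: nsq_sum sum_distrib_left)
  also have "\<dots> \<le> c\<^sup>2 * nsq x"
    unfolding y_def by (intro mult_left_mono orthonormal_transpose_contraction[OF V x]) auto
  finally show ?thesis .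
qed

lemma nsq_M_V:
  assumes x: "x \<in> carrier_vec r"
  shows "d\<^sup>2 * nsq x \<le> nsq (M *\<^sub>v (V *\<^sub>v x))"
proof -
  have "transpose_mat V *\<^sub>v (V *\<^sub>v x) = x"
  proof -
    have Vt: "transpose_mat V \<in> carrier_mat r n" using V by simp
    have "transpose_mat V * V = 1\<^sub>m r" using V by (simp add: orthonormal_cols_def)
    then show ?thesis using assoc_mult_mat_vec[OF Vt V(1) x] x by simp
  qed
  then show ?thesis using nsq_M_ge[of "V *\<^sub>v x"] V x by simp
qed

lemma sing_val_M_bounds:
  assumes r: "1 \<le> r" "r \<le> n" and D': "\<And>i. i < r \<Longrightarrow> D i \<le> c"
  shows "d \<le> sing_val M r" "sing_val M r \<le> c"
proof -
  show "d \<le> sing_val M r"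
    using d nsq_M_V by (intro sing_val_ge[OF M_carrier r _ V]) auto
  have "0 \<le> c" using D[of 0] D'[of 0] d r by simp
  then show "sing_val M r \<le> c"
    using nsq_M_le[OF D'] by (intro sing_val_le[OF M_carrier r]) auto
qed

section \<open>Singular vectors of a perturbed matrix\<close>

context
  fixes X :: "real mat"
  assumes X: "X \<in> carrier_mat m n"
    and err: "\<And>x. x \<in> carrier_vec n \<Longrightarrow> nsq ((X - M) *\<^sub>v x) \<le> d\<^sup>2 / 100 * nsq x"
begin

lemma perturb:
  assumes x: "x \<in> carrier_vec n"
  shows "nsq (M *\<^sub>v x) \<le> 2 * nsq (X *\<^sub>v x) + d\<^sup>2 / 50 * nsq x"
    and "nsq (X *\<^sub>v x) \<le> 2 * nsq (M *\<^sub>v x) + d\<^sup>2 / 50 * nsq x"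
proof -
  note c = mult_mat_vec_carrier[OF M_carrier x] mult_mat_vec_carrier[OF X x]
  have e: "(X - M) *\<^sub>v x = X *\<^sub>v x - M *\<^sub>v x"
    by (rule minus_mult_distrib_mat_vec[OF X M_carrier x])
  define w where "w = X *\<^sub>v x - M *\<^sub>v x"
  have w: "w \<in> carrier_vec m" using c by (simp add: w_def)
  have ew: "nsq w \<le> d\<^sup>2 / 100 * nsq x" using err[OF x] by (simp add: w_def e)
  have "M *\<^sub>v x = X *\<^sub>v x + (-1) \<cdot>\<^sub>v w" "X *\<^sub>v x = M *\<^sub>v x + w"
    using c carrier_matD[OF X] carrier_matD[OF M_carrier] by (auto simp: w_def intro!: eq_vecI)
  then have "nsq (M *\<^sub>v x) \<le> 2 * nsq (X *\<^sub>v x) + 2 * nsq ((-1) \<cdot>\<^sub>v w)"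
    "nsq (X *\<^sub>v x) \<le> 2 * nsq (M *\<^sub>v x) + 2 * nsq w"
    using nsq_add_le[OF c(2), of "(-1) \<cdot>\<^sub>v w"] nsq_add_le[OF c(1) w] w by auto
  moreover have "nsq ((-1) \<cdot>\<^sub>v w) = nsq w" unfolding nsq_smult by simp
  ultimately show "nsq (M *\<^sub>v x) \<le> 2 * nsq (X *\<^sub>v x) + d\<^sup>2 / 50 * nsq x"
    and "nsq (X *\<^sub>v x) \<le> 2 * nsq (M *\<^sub>v x) + d\<^sup>2 / 50 * nsq x"
    using ew by linarith+
qed

lemma perturbed_V:
  assumes x: "x \<in> carrier_vec r"
  shows "(d / 2)\<^sup>2 * nsq x \<le> nsq (X *\<^sub>v (V *\<^sub>v x))"
proof -
  have Vx: "V *\<^sub>v x \<in> carrier_vec n" using V x by simp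
  have "d\<^sup>2 * nsq x \<le> 2 * nsq (X *\<^sub>v (V *\<^sub>v x)) + d\<^sup>2 / 50 * nsq x"
    using nsq_M_V[OF x] perturb(1)[OF Vx] orthonormal_nsq[OF V x] by simp
  moreover have "0 \<le> d\<^sup>2 * nsq x" by simp
  moreover have "(d / 2)\<^sup>2 * nsq x = d\<^sup>2 * nsq x / 4" by (simp add: power_divide)
  ultimately show ?thesis by linarith
qed

lemma sing_val_perturbed_bounds:
  assumes r: "1 \<le> r" "r \<le> n" and D': "\<And>i. i < r \<Longrightarrow> D i \<le> c"
  shows "d / 2 \<le> sing_val X r" "sing_val X r \<le> 2 * c"
proof -
  show "d / 2 \<le> sing_val X r"
    using d perturbed_V by (intro sing_val_ge[OF X r _ V]) auto
  have dc: "d \<le> c" using D[of 0] D'[of 0] r by simp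
  show "sing_val X r \<le> 2 * c"
  proof (rule sing_val_le[OF X r])
    show "0 \<le> 2 * c" using dc d by simp
    fix x :: "real vec" assume x: "x \<in> carrier_vec n"
    have "d\<^sup>2 \<le> c\<^sup>2" using d dc by (intro power_mono) auto
    then have "d\<^sup>2 * nsq x \<le> c\<^sup>2 * nsq x" by (intro mult_right_mono) auto
    moreover have "0 \<le> c\<^sup>2 * nsq x" by simp
    moreover have "(2 * c)\<^sup>2 * nsq x = 4 * (c\<^sup>2 * nsq x)" by (simp add: power_mult_distrib)
    ultimately show "nsq (X *\<^sub>v x) \<le> (2 * c)\<^sup>2 * nsq x"
      using perturb(2)[OF x] nsq_M_le[OF D' x] by linarith
  qed
qed

lemma svd_frame:
  assumes svd: "is_svd X n P s W"
  shows "sv_frame X n W s"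
proof -
  have P: "P \<in> carrier_mat m n" "orthonormal_cols P" and W: "W \<in> carrier_mat n n" "orthonormal_cols W"
    and s: "\<forall>i j. i \<le> j \<and> j < n \<longrightarrow> s j \<le> s i" "\<forall>i<n. 0 \<le> s i"
    and Xe: "X = P * mat_diag n s * transpose_mat W"
    using svd X unfolding is_svd_def by auto
  have "nsq (X *\<^sub>v x) = (\<Sum>i<n. (s i)\<^sup>2 * (col W i \<bullet> x)\<^sup>2)" if x: "x \<in> carrier_vec n" for x
  proof -
    define y where "y = transpose_mat W *\<^sub>v x"
    have Wt: "transpose_mat W \<in> carrier_mat n n" using W by simp
    have y: "y \<in> carrier_vec n" unfolding y_def by (rule mult_mat_vec_carrier[OF Wt x])
    have "X *\<^sub>v x = P * mat_diag n s *\<^sub>v y"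
      unfolding Xe y_def by (rule assoc_mult_mat_vec[OF mult_carrier_mat[OF P(1) mat_diag_dim] Wt x])
    also have "\<dots> = P *\<^sub>v (mat_diag n s *\<^sub>v y)"
      by (rule assoc_mult_mat_vec[OF P(1) mat_diag_dim y])
    finally have "nsq (X *\<^sub>v x) = nsq (mat_diag n s *\<^sub>v y)"
      using orthonormal_nsq[OF P mult_mat_vec_carrier[OF mat_diag_dim y]] by simp
    also have "\<dots> = (\<Sum>i<n. (s i * y $ i)\<^sup>2)"
    proof -
      have "(mat_diag n s *\<^sub>v y) $ i = s i * y $ i" if i: "i < n" for i
      proof -
        have "(mat_diag n s *\<^sub>v y) $ i = (\<Sum>j<n. (if i = j then s j else 0) * y $ j)"
          using i y by (simp add: mat_diag_def scalar_prod_def atLeast0LessThan)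
        also have "\<dots> = (\<Sum>j<n. if j = i then s i * y $ i else 0)"
          by (intro sum.cong) auto
        finally show ?thesis using i by simp
      qed
      then show ?thesis by (simp add: nsq_sum mat_diag_def)
    qed
    also have "\<dots> = (\<Sum>i<n. (s i)\<^sup>2 * (col W i \<bullet> x)\<^sup>2)"
      using W(1) by (intro sum.cong) (auto simp: y_def power_mult_distrib)
    finally show ?thesis .
  qed
  then show ?thesis using W s unfolding sv_frame_def by blast
qed

text \<open>There is a gap: s r \<le> d / 5, tested on the kernel of V', and s (r - 1) \<ge> d / 2.
  For y = V x the part w of y off the range of V0 is a combination of trailing singular vectors, so
  |X w|^2 \<le> d^2 |w|^2 / 25 and |M w|^2 \<le> d^2 |w|^2 / 10, which bounds |V'w|^2 by |w|^2 / 10.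
  But |w|^2 = w . y = x . V'w, hence |w|^2 \<le> |x|^2 / 10.\<close>

lemma leading_right_sv_close:
  assumes r: "1 \<le> r" "r < n" "n \<le> m" and lead: "leading_right_sv X r V0"
    and supp: "\<And>j. j < n \<Longrightarrow> j \<notin> row_supp V \<Longrightarrow> col X j = 0\<^sub>v m"
    and \<epsilon>: "0 \<le> \<epsilon>" "0 \<le> t"
  shows "close_frame n r \<epsilon> t V V0"
proof -
  have "dim_col X = n" "min (dim_row X) n = n" using X r by auto
  note dims = this
  obtain P s W where svd: "is_svd X n P s W" and V0: "V0 = mat n r (\<lambda>(i,j). W $$ (i,j))"
    using lead unfolding leading_right_sv_def dims by blast
  note fr = svd_frame[OF svd]
  note Q = sv_frameD[OF fr]
  have V0c: "V0 \<in> carrier_mat n r" by (simp add: V0)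
  have V0o: "orthonormal_cols V0" and colV0: "\<And>b. b < r \<Longrightarrow> col V0 b = col W b"
    using orthonormal_leading_cols[OF Q(1,2), of r] r by (auto simp: V0)
  have Vt: "transpose_mat V \<in> carrier_mat r n" using V by simp
  have s_small: "s r \<le> d / 5"
  proof (rule sv_frame_kernel_le[OF fr Vt])
    fix x :: "real vec" assume x: "x \<in> carrier_vec n" "transpose_mat V *\<^sub>v x = 0\<^sub>v r"
    have "mat_diag r D *\<^sub>v 0\<^sub>v r = 0\<^sub>v r" by (intro eq_vecI) (auto simp: mat_diag_def)
    moreover have "U *\<^sub>v 0\<^sub>v r = 0\<^sub>v m" using U by (intro eq_vecI) auto
    ultimately have "M *\<^sub>v x = 0\<^sub>v m" using M_mult_vec[OF x(1)] x(2) by simp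
    then have "nsq (X *\<^sub>v x) \<le> d\<^sup>2 / 50 * nsq x" using perturb(2)[OF x(1)] by simp
    also have "\<dots> \<le> (d / 5)\<^sup>2 * nsq x" by (intro mult_right_mono) (auto simp: power_divide)
    finally show "nsq (X *\<^sub>v x) \<le> (d / 5)\<^sup>2 * nsq x" .
  qed (use r d in auto)
  have s_large: "d / 2 \<le> s (r - 1)"
    using d r perturbed_V by (intro sv_frame_ge[OF fr _ _ _ V]) auto
  have proj: "nsq (V0' - V0 *\<^sub>v (transpose_mat V0 *\<^sub>v V0')) \<le> nsq x / 4"
    if x: "x \<in> carrier_vec r" and V0': "V0' = V *\<^sub>v x" for x V0'
  proof -
    define y where "y = V *\<^sub>v x"
    have y: "y \<in> carrier_vec n" using V x by (simp add: y_def)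
    define b where "b = transpose_mat V0 *\<^sub>v y"
    have b: "b \<in> carrier_vec r" using V0c y by (simp add: b_def)
    define p where "p = V0 *\<^sub>v b"
    have p: "p \<in> carrier_vec n" using V0c b by (simp add: p_def)
    define w where "w = y - p"
    have w: "w \<in> carrier_vec n" using y p by (simp add: w_def)
    have colp: "col W i \<bullet> p = (if i < r then col W i \<bullet> y else 0)" if i: "i < n" for i
    proof -
      have ci: "col W i \<in> carrier_vec n" using Q(1) i by simp
      have "p \<bullet> col W i = b \<bullet> (transpose_mat V0 *\<^sub>v col W i)"
        unfolding p_def by (rule scalar_prod_mult_mat_vec[OF V0c b ci])
      also have "\<dots> = (\<Sum>j<r. b $ j * (if j = i then 1 else 0))"
        using V0c i r colV0 orthonormal_col_scalar_prod[OF Q(1,2)]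
        by (auto simp: scalar_prod_def[of b] atLeast0LessThan intro!: sum.cong)
      also have "\<dots> = (\<Sum>j<r. if j = i then b $ i else 0)" by (intro sum.cong) auto
      also have "\<dots> = (if i < r then b $ i else 0)" by simp
      also have "\<dots> = (if i < r then col W i \<bullet> y else 0)"
        using V0c colV0 by (simp add: b_def)
      finally show ?thesis using comm_scalar_prod[OF p ci] by simp
    qed
    have colw: "col W i \<bullet> w = (if i < r then 0 else col W i \<bullet> y)" if i: "i < n" for i
    proof -
      have ci: "col W i \<in> carrier_vec n" using Q(1) i by simp
      have "col W i \<bullet> w = col W i \<bullet> y - col W i \<bullet> p"
        unfolding w_def by (rule scalar_prod_minus_distrib[OF ci y p])
      then show ?thesis using colp[OF i] by simp
    qed
    have "nsq (X *\<^sub>v w) = (\<Sum>i<n. (s i)\<^sup>2 * (col W i \<bullet> w)\<^sup>2)" by (rule Q(5)[OF w])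
    also have "\<dots> \<le> (\<Sum>i<n. (s r)\<^sup>2 * (col W i \<bullet> w)\<^sup>2)"
    proof (rule sum_mono)
      fix i assume i: "i \<in> {..<n}"
      show "(s i)\<^sup>2 * (col W i \<bullet> w)\<^sup>2 \<le> (s r)\<^sup>2 * (col W i \<bullet> w)\<^sup>2"
      proof (cases "i < r")
        case False
        then have "s i \<le> s r" "0 \<le> s i" using Q(3,4) i by auto
        then show ?thesis by (intro mult_right_mono power_mono) auto
      qed (use colw i in simp)
    qed
    also have "\<dots> = (s r)\<^sup>2 * nsq w"
      using nsq_orthonormal_coords[OF Q(1,2) w] by (simp add: sum_distrib_left)
    also have "\<dots> \<le> (d / 5)\<^sup>2 * nsq w"
      using s_small Q(3)[of r] r by (intro mult_right_mono power_mono) auto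
    finally have "nsq (X *\<^sub>v w) \<le> (d / 5)\<^sup>2 * nsq w" .
    then have "nsq (M *\<^sub>v w) \<le> d\<^sup>2 / 10 * nsq w"
      using perturb(1)[OF w] by (simp add: power_divide)
    then have "d\<^sup>2 * nsq (transpose_mat V *\<^sub>v w) \<le> d\<^sup>2 * (nsq w / 10)"
      using nsq_M_ge[OF w] by simp
    then have Vw: "nsq (transpose_mat V *\<^sub>v w) \<le> nsq w / 10" using d by simp
    have "w \<bullet> p = 0"
    proof -
      have "transpose_mat V0 *\<^sub>v w = 0\<^sub>v r"
        using V0c colV0 colw r by (intro eq_vecI) auto
      then have "p \<bullet> w = 0"
        unfolding p_def using scalar_prod_mult_mat_vec[OF V0c b w] b by simp
      then show ?thesis using comm_scalar_prod[OF w p] by simp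
    qed
    then have "nsq w = w \<bullet> y"
    proof -
      have "w \<bullet> (y - p) = w \<bullet> y - w \<bullet> p" by (rule scalar_prod_minus_distrib[OF w y p])
      then show ?thesis using \<open>w \<bullet> p = 0\<close> by (simp add: w_def)
    qed
    also have "\<dots> = x \<bullet> (transpose_mat V *\<^sub>v w)"
      using scalar_prod_mult_mat_vec[OF V(1) x w] comm_scalar_prod[OF w y] by (simp add: y_def)
    finally have "(nsq w)\<^sup>2 \<le> nsq x * nsq (transpose_mat V *\<^sub>v w)"
      using scalar_prod_Cauchy_Schwarz[OF x mult_mat_vec_carrier[OF Vt w]] by simp
    also have "\<dots> \<le> nsq x * (nsq w / 10)" using Vw by (intro mult_left_mono) auto
    finally have *: "nsq w * nsq w \<le> nsq w * (nsq x / 10)" by (simp add: power2_eq_square mult_ac)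
    have "nsq w \<le> nsq x / 10"
    proof (cases "nsq w = 0")
      case False
      then have "0 < nsq w" using nsq_nonneg[of w] by linarith
      then show ?thesis using * by simp
    qed simp
    then have "nsq w \<le> nsq x / 4" using nsq_nonneg[of x] by linarith
    then show ?thesis unfolding V0' w_def p_def b_def y_def .
  qed
  \<comment> \<open>At a zero column of X every right singular vector with nonzero singular value
    vanishes, and the leading ones have singular value at least d / 2. So both off-support
    quantities of \<open>close_frame\<close> are 0 at the start.\<close>
  have rows: "row V0 j = 0\<^sub>v r" if j: "j < n" "j \<notin> row_supp V" for j
  proof -
    have "X *\<^sub>v unit_vec n j = col X j"
      using X j by (intro eq_vecI) (auto simp: scalar_prod_right_unit)
    then have "nsq (X *\<^sub>v unit_vec n j) = 0" using supp[OF j] by simp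
    then have "(\<Sum>i<n. (s i)\<^sup>2 * (col W i \<bullet> unit_vec n j)\<^sup>2) = 0"
      using Q(5)[of "unit_vec n j"] by simp
    then have z: "(s i)\<^sup>2 * (col W i \<bullet> unit_vec n j)\<^sup>2 = 0" if "i < n" for i
      using that by (simp add: sum_nonneg_eq_0_iff)
    have "W $$ (j,i) = 0" if i: "i < r" for i
    proof -
      have "s (r - 1) \<le> s i" using i r by (intro Q(4)) auto
      then have "s i \<noteq> 0" using s_large d by linarith
      then have "col W i \<bullet> unit_vec n j = 0" using z[of i] i r by simp
      moreover have "col W i \<bullet> unit_vec n j = W $$ (j,i)"
        using i r j Q(1) by (simp add: scalar_prod_right_unit)
      ultimately show ?thesis by simp
    qed
    then show ?thesis using j by (intro eq_vecI) (auto simp: V0)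
  qed
  show ?thesis
    unfolding close_frame_def
  proof (intro conjI ballI)
    show "V0 \<in> carrier_mat n r" "orthonormal_cols V0" by fact+
    fix x :: "real vec" assume x: "x \<in> carrier_vec r"
    have y: "V *\<^sub>v x \<in> carrier_vec n" using V x by simp
    show "3 / 4 * nsq x \<le> nsq (transpose_mat V0 *\<^sub>v (V *\<^sub>v x))"
      using orthonormal_proj_decomp[OF V0c V0o y] proj[OF x refl] orthonormal_nsq[OF V x] by simp
  next
    have "(\<Sum>i\<in>{..<n} - row_supp V. nsq (row V0 i)) = 0" using rows by (intro sum.neutral) auto
    then show "(\<Sum>i\<in>{..<n} - row_supp V. nsq (row V0 i)) \<le> \<epsilon>" using \<epsilon> by simp
    have "card (row_supp V0 - row_supp V) = 0" using rows V0c by (auto simp: row_supp_def card_eq_0_iff)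
    then show "real (card (row_supp V0 - row_supp V)) \<le> t" using \<epsilon> by (simp only: of_nat_0)
  qed
qed

end

end

section \<open>The initial estimator\<close>

text \<open>It makes the bound for frames an operator norm bound for a block of Z: v / |v| followed
  by r - 1 zero columns is a contraction with the support of v, and each row energy is at most
  \<gamma>^2 plus its excess.\<close>

lemma excess_block:
  assumes ex: "excess_bound m n r Z \<gamma> B" and \<gamma>: "0 < \<gamma>" and B: "0 \<le> B" and r: "1 \<le> r"
    and Z: "Z \<in> carrier_mat m n" and v: "v \<in> carrier_vec n"
    and J: "finite J" "\<And>j. j < n \<Longrightarrow> j \<notin> J \<Longrightarrow> v $ j = 0" "real (card J) \<le> K"
    and S: "S \<subseteq> {..<m}" "real (card S) \<le> K"
  shows "(\<Sum>i\<in>S. (row Z i \<bullet> v)\<^sup>2) \<le> (\<gamma>\<^sup>2 + B) * K * nsq v"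
proof (cases "nsq v = 0")
  case True
  then have "v = 0\<^sub>v n" using nsq_eq_0_iff[OF v] by simp
  then have "row Z i \<bullet> v = 0" if "i \<in> S" for i using Z S that by auto
  then show ?thesis using True by simp
next
  case False
  define c where "c = vnorm v"
  have "0 < nsq v" using False nsq_nonneg[of v] by linarith
  then have c: "0 < c" "c\<^sup>2 = nsq v" by (simp_all add: c_def vnorm_power2 vnorm_def)
  define W where "W = mat n r (\<lambda>(j,q). if q = 0 then v $ j / c else 0)"
  have W: "W \<in> carrier_mat n r" by (simp add: W_def)
  have "contraction r W"
    unfolding contraction_def
  proof
    fix x :: "real vec" assume x: "x \<in> carrier_vec r"
    have "(W *\<^sub>v x) $ j = v $ j / c * x $ 0" if "j < n" for j
    proof -
      have "(W *\<^sub>v x) $ j = (\<Sum>q<r. (if q = 0 then v $ j / c else 0) * x $ q)"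
        using that x by (simp add: W_def scalar_prod_def atLeast0LessThan)
      also have "\<dots> = (\<Sum>q<r. if q = 0 then v $ j / c * x $ 0 else 0)" by (intro sum.cong) auto
      finally show ?thesis using r by simp
    qed
    then have "nsq (W *\<^sub>v x) = (\<Sum>j<n. (v $ j / c * x $ 0)\<^sup>2)" using W by (simp add: nsq_sum)
    also have "\<dots> = (\<Sum>j<n. (v $ j)\<^sup>2) * ((x $ 0)\<^sup>2 / c\<^sup>2)"
      by (simp add: power_mult_distrib power_divide sum_distrib_right sum_divide_distrib)
    also have "(\<Sum>j<n. (v $ j)\<^sup>2) = c\<^sup>2" using v by (simp add: c nsq_sum)
    also have "c\<^sup>2 * ((x $ 0)\<^sup>2 / c\<^sup>2) = (x $ 0)\<^sup>2" using c(1) by simp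
    also have "\<dots> \<le> nsq x"
      unfolding nsq_sum using x r by (intro member_le_sum) auto
    finally show "nsq (W *\<^sub>v x) \<le> nsq x" .
  qed
  have rowZW: "nsq (row (Z * W) i) = (row Z i \<bullet> v)\<^sup>2 / c\<^sup>2" if i: "i < m" for i
  proof -
    have e: "row (Z * W) i $ q = (if q = 0 then (row Z i \<bullet> v) / c else 0)" if "q < r" for q
      using i that Z W v
      by (auto simp: W_def scalar_prod_def sum_divide_distrib)
    have "nsq (row (Z * W) i) = (\<Sum>q<r. (row (Z * W) i $ q)\<^sup>2)" using Z W i by (simp add: nsq_sum)
    also have "\<dots> = (\<Sum>q<r. if q = 0 then (row Z i \<bullet> v)\<^sup>2 / c\<^sup>2 else 0)"
      using e by (intro sum.cong) (auto simp: power_divide)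
    finally show ?thesis using r by simp
  qed
  have "(\<Sum>i\<in>S. (row Z i \<bullet> v)\<^sup>2 / c\<^sup>2) = (\<Sum>i\<in>S. nsq (row (Z * W) i))"
    using S rowZW by (intro sum.cong) auto
  also have "\<dots> \<le> (\<Sum>i\<in>S. \<gamma>\<^sup>2 + excess (\<gamma>\<^sup>2) (nsq (row (Z * W) i)))"
    by (intro sum_mono) (simp add: excess_def)
  also have "\<dots> = \<gamma>\<^sup>2 * card S + (\<Sum>i\<in>S. excess (\<gamma>\<^sup>2) (nsq (row (Z * W) i)))" by (simp add: sum.distrib)
  also have "\<dots> \<le> \<gamma>\<^sup>2 * K + B * K"
  proof (intro add_mono mult_left_mono)
    have "(\<Sum>i\<in>S. excess (\<gamma>\<^sup>2) (nsq (row (Z * W) i))) \<le> (\<Sum>i<m. excess (\<gamma>\<^sup>2) (nsq (row (Z * W) i)))"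
      using S by (intro sum_mono2) (auto intro: excess_nonneg)
    also have "\<dots> \<le> B * card (row_supp W)"
      by (rule excess_bound_upper[OF ex \<gamma> W \<open>contraction r W\<close>])
    also have "\<dots> \<le> B * K"
    proof (rule mult_left_mono[OF _ B])
      have "j \<in> J" if "j \<in> row_supp W" for j
      proof (rule ccontr)
        assume "j \<notin> J"
        moreover have "j < n" using that W by (auto simp: row_supp_def)
        ultimately have "row W j = 0\<^sub>v r" using J(2) by (intro eq_vecI) (auto simp: W_def)
        then show False using that W by (auto simp: row_supp_def)
      qed
      then have "card (row_supp W) \<le> card J" using J(1) by (intro card_mono) auto
      then show "real (card (row_supp W)) \<le> K" using J(3) by linarith
    qed
    finally show "(\<Sum>i\<in>S. excess (\<gamma>\<^sup>2) (nsq (row (Z * W) i))) \<le> B * K" .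
  qed (use S in auto)
  finally have "(\<Sum>i\<in>S. (row Z i \<bullet> v)\<^sup>2) / c\<^sup>2 \<le> (\<gamma>\<^sup>2 + B) * K"
    by (simp add: sum_divide_distrib distrib_right)
  then show ?thesis unfolding c(2) using \<open>0 < nsq v\<close> by (simp only: pos_divide_le_eq)
qed

text \<open>Here a is the length of a signal row, p its product with the noise row and q the noise
  energy. Half of a^2 absorbs the cross term at the price of 16 \<sigma>^2 L, which is at most
  \<sigma>^2 sqrt (N L). In \<alpha> + 5 the \<alpha> comes from the screening level, 4 from the
  noise energy and 1 from the cross term.\<close>

lemma noncentral_bound:
  fixes a p q N L \<sigma> \<alpha> :: real
  assumes L: "0 < L" "256 * L \<le> N" and a: "0 \<le> a" and \<sigma>: "0 < \<sigma>"
    and 1: "a\<^sup>2 + 2 * p + q < \<sigma>\<^sup>2 * (N + \<alpha> * sqrt (N * L))"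
    and 2: "\<sigma>\<^sup>2 * (N - 4 * sqrt (N * L)) \<le> q" and 3: "- \<sigma> * sqrt (8 * L) * a \<le> p"
  shows "a\<^sup>2 \<le> 2 * (\<alpha> + 5) * (\<sigma>\<^sup>2 * sqrt (N * L))"
proof -
  define b where "b = \<sigma> * sqrt (8 * L)"
  have b2: "b\<^sup>2 = 8 * (\<sigma>\<^sup>2 * L)" using L by (simp add: b_def power_mult_distrib)
  have "0 \<le> (a / 2 - b)\<^sup>2 * 2" by simp
  then have ab: "2 * (a * b) \<le> a\<^sup>2 / 2 + 2 * b\<^sup>2" by (simp add: power2_eq_square algebra_simps)
  have "16 * L \<le> sqrt (N * L)"
  proof (rule real_le_rsqrt)
    have "256 * L * L \<le> N * L" using L by (intro mult_right_mono) auto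
    then show "(16 * L)\<^sup>2 \<le> N * L" by (simp add: power2_eq_square)
  qed
  then have "\<sigma>\<^sup>2 * (16 * L) \<le> \<sigma>\<^sup>2 * sqrt (N * L)" by (intro mult_left_mono) auto
  moreover have "- (a * b) \<le> p" using 3 by (simp add: b_def mult_ac)
  ultimately show ?thesis using 1 2 ab b2 by (simp add: algebra_simps)
qed

text \<open>The last bound is one-sided: only a negative product of signal and noise could push a
  strong row below the screening level.\<close>

definition tame_rows :: "nat \<Rightarrow> nat \<Rightarrow> real \<Rightarrow> real \<Rightarrow> real mat \<Rightarrow> real mat \<Rightarrow> bool" where
  "tame_rows m n \<sigma> L M Z \<longleftrightarrow>
     (\<forall>i<m. nsq (row Z i) < \<sigma>\<^sup>2 * (n + 4 * sqrt (n * L)) \<and>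
        \<sigma>\<^sup>2 * (n - 4 * sqrt (n * L)) \<le> nsq (row Z i) \<and>
        - \<sigma> * sqrt (8 * L) * vnorm (row M i) \<le> row M i \<bullet> row Z i)"

context low_rank
begin

text \<open>Off the support a row is pure noise and stays below the level because \<alpha> \<ge> 4.
  A discarded row in the support, of which there are at most k, has small energy by
  \<open>noncentral_bound\<close>.\<close>

lemma discarded_rows:
  fixes \<alpha> \<sigma> L :: real
  assumes Z: "Z \<in> carrier_mat m n" and \<sigma>: "0 < \<sigma>" and \<alpha>: "4 \<le> \<alpha>" and L: "0 < L" "256 * L \<le> real n"
    and tame: "tame_rows m n \<sigma> L M Z" and k: "card (row_supp U) \<le> k"
    and I: "I = {i. i < m \<and> \<sigma>\<^sup>2 * (n + \<alpha> * sqrt (n * L)) \<le> (vnorm (row (M + Z) i))\<^sup>2}"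
  shows "I \<subseteq> row_supp U"
    and "(\<Sum>i\<in>{..<m} - I. nsq (row M i)) \<le> k * (2 * (\<alpha> + 5) * (\<sigma>\<^sup>2 * sqrt (n * L)))"
proof -
  note Mc = M_carrier
  have rowX: "row (M + Z) i = row M i + row Z i" if "i < m" for i
    using that Mc Z by (intro row_add) auto
  have c: "row M i \<in> carrier_vec n" "row Z i \<in> carrier_vec n" if "i < m" for i
    using that Mc Z by auto
  have mono: "\<sigma>\<^sup>2 * (n + 4 * sqrt (n * L)) \<le> \<sigma>\<^sup>2 * (n + \<alpha> * sqrt (n * L))"
    using \<alpha> L by (intro mult_left_mono add_left_mono mult_right_mono) auto
  show "I \<subseteq> row_supp U"
  proof
    fix i assume i: "i \<in> I"
    then have im: "i < m" by (simp add: I)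
    show "i \<in> row_supp U"
    proof (rule ccontr)
      assume "i \<notin> row_supp U"
      then have "row (M + Z) i = row Z i"
        using rowX[OF im] row_M_zero[OF im] c[OF im] by simp
      then have "\<sigma>\<^sup>2 * (n + \<alpha> * sqrt (n * L)) \<le> nsq (row Z i)"
        using i by (simp add: I vnorm_power2)
      moreover have "nsq (row Z i) < \<sigma>\<^sup>2 * (n + 4 * sqrt (n * L))"
        using tame im by (simp add: tame_rows_def)
      ultimately show False using mono by linarith
    qed
  qed
  let ?b = "2 * (\<alpha> + 5) * (\<sigma>\<^sup>2 * sqrt (n * L))"
  have b0: "0 \<le> ?b" using \<alpha> L by simp
  have "(\<Sum>i\<in>{..<m} - I. nsq (row M i)) \<le> (\<Sum>i\<in>{..<m} - I. if i \<in> row_supp U then ?b else 0)"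
  proof (rule sum_mono)
    fix i assume i: "i \<in> {..<m} - I"
    then have im: "i < m" by simp
    show "nsq (row M i) \<le> (if i \<in> row_supp U then ?b else 0)"
    proof (cases "i \<in> row_supp U")
      case True
      have lt: "nsq (row M i + row Z i) < \<sigma>\<^sup>2 * (n + \<alpha> * sqrt (n * L))"
        using i im rowX[OF im] by (simp add: I vnorm_power2 not_le)
      have "(vnorm (row M i))\<^sup>2 \<le> ?b"
      proof (rule noncentral_bound[OF L _ \<sigma>])
        show "(vnorm (row M i))\<^sup>2 + 2 * (row M i \<bullet> row Z i) + nsq (row Z i) < \<sigma>\<^sup>2 * (n + \<alpha> * sqrt (n * L))"
          using lt nsq_add[OF c[OF im]] by (simp add: vnorm_power2)
        show "\<sigma>\<^sup>2 * (n - 4 * sqrt (n * L)) \<le> nsq (row Z i)"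
          "- \<sigma> * sqrt (8 * L) * vnorm (row M i) \<le> row M i \<bullet> row Z i"
          using tame im by (simp_all add: tame_rows_def)
      qed simp
      then show ?thesis using True by (simp add: vnorm_power2)
    next
      case False
      then show ?thesis using row_M_zero[OF im] by simp
    qed
  qed
  also have "\<dots> = card (({..<m} - I) \<inter> row_supp U) * ?b"
    by (simp add: sum.If_cases)
  also have "\<dots> \<le> k * ?b"
  proof (rule mult_right_mono[OF _ b0])
    have "card (({..<m} - I) \<inter> row_supp U) \<le> card (row_supp U)" by (intro card_mono) auto
    then show "real (card (({..<m} - I) \<inter> row_supp U)) \<le> real k" using k by simp
  qed
  finally show "(\<Sum>i\<in>{..<m} - I. nsq (row M i)) \<le> k * ?b" .
qed

text \<open>The difference splits into the kept noise entries, all inside the block of the two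
  supports, and the discarded entries of M with negative sign. The first part is bounded in operator
  norm by \<open>block\<close>, the second in Frobenius norm.\<close>

lemma init_mat_close:
  fixes \<alpha> \<sigma> L \<tau> :: real
  assumes Z: "Z \<in> carrier_mat m n" and \<sigma>: "0 < \<sigma>" and \<alpha>: "4 \<le> \<alpha>"
    and L: "L = ln m" "0 < L" "256 * L \<le> real n" and nm: "n \<le> m"
    and tame: "tame_rows m n \<sigma> L M Z" "tame_rows n m \<sigma> L (transpose_mat M) (transpose_mat Z)"
    and kl: "card (row_supp U) \<le> k" "card (row_supp V) \<le> l"
    and block: "\<And>v. v \<in> carrier_vec n \<Longrightarrow> (\<And>j. j < n \<Longrightarrow> j \<notin> row_supp V \<Longrightarrow> v $ j = 0) \<Longrightarrow>
       (\<Sum>i\<in>row_supp U. (row Z i \<bullet> v)\<^sup>2) \<le> \<tau> * nsq v" and \<tau>: "0 \<le> \<tau>"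
  defines "X0 \<equiv> init_mat \<alpha> \<sigma> (M + Z)"
  shows "X0 \<in> carrier_mat m n"
    and "\<And>j. j < n \<Longrightarrow> j \<notin> row_supp V \<Longrightarrow> col X0 j = 0\<^sub>v m"
    and "\<And>x. x \<in> carrier_vec n \<Longrightarrow> nsq ((X0 - M) *\<^sub>v x) \<le>
       (2 * \<tau> + 4 * (\<alpha> + 5) * (\<sigma>\<^sup>2 * (k * sqrt (n * L) + l * sqrt (m * L)))) * nsq x"
proof -
  note Mc = M_carrier
  interpret T: low_rank n m r V U "transpose_mat M" D d by (rule low_rank_transpose)
  define X where "X = M + Z"
  have X: "X \<in> carrier_mat m n" using Mc Z by (simp add: X_def)
  have Xt: "transpose_mat X = transpose_mat M + transpose_mat Z"
    unfolding X_def using Mc Z by (intro eq_matI) auto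
  define I J where "I = init_rows \<alpha> \<sigma> X" and "J = init_cols \<alpha> \<sigma> X"
  have I: "I = {i. i < m \<and> \<sigma>\<^sup>2 * (n + \<alpha> * sqrt (n * L)) \<le> (vnorm (row (M + Z) i))\<^sup>2}"
    unfolding I_def init_rows_def using X by (simp add: L(1) flip: X_def)
  have J: "J = {j. j < n \<and> \<sigma>\<^sup>2 * (m + \<alpha> * sqrt (m * L)) \<le>
      (vnorm (row (transpose_mat M + transpose_mat Z) j))\<^sup>2}"
    unfolding J_def init_cols_def Xt[symmetric] using X by (auto simp: L(1))
  have Lm: "256 * L \<le> real m" using L nm by linarith
  note Ib = discarded_rows[OF Z \<sigma> \<alpha> L(2,3) tame(1) kl(1) I]
  have Zt: "transpose_mat Z \<in> carrier_mat n m" using Z by simp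
  note Jb = T.discarded_rows[OF Zt \<sigma> \<alpha> L(2) Lm tame(2) kl(2) J]
  have X0: "X0 = mat m n (\<lambda>(i,j). if i \<in> I \<and> j \<in> J then X $$ (i,j) else 0)"
    unfolding X0_def init_mat_def I_def J_def X_def[symmetric] using X by simp
  show "X0 \<in> carrier_mat m n" by (simp add: X0)
  show "col X0 j = 0\<^sub>v m" if "j < n" "j \<notin> row_supp V" for j
    using that Jb(1) by (intro eq_vecI) (auto simp: X0)
  define Z0 where "Z0 = mat m n (\<lambda>(i,j). if i \<in> I \<and> j \<in> J then Z $$ (i,j) else 0)"
  define N where "N = mat m n (\<lambda>(i,j). if i \<in> I \<and> j \<in> J then 0 else - (M $$ (i,j)))"
  have Z0: "Z0 \<in> carrier_mat m n" and N: "N \<in> carrier_mat m n" by (simp_all add: Z0_def N_def)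
  have eq: "X0 - M = Z0 + N"
    using Mc Z by (intro eq_matI) (auto simp: X0 Z0_def N_def X_def)
  have froN: "fro2 N \<le> 2 * (\<alpha> + 5) * (\<sigma>\<^sup>2 * (k * sqrt (n * L) + l * sqrt (m * L)))"
  proof -
    have "fro2 N = (\<Sum>i<m. \<Sum>j<n. (N $$ (i,j))\<^sup>2)" using N by (simp add: fro2_def)
    also have "\<dots> \<le> (\<Sum>i<m. \<Sum>j<n. (if i \<in> I then 0 else (M $$ (i,j))\<^sup>2) + (if j \<in> J then 0 else (M $$ (i,j))\<^sup>2))"
      by (intro sum_mono) (auto simp: N_def)
    also have "\<dots> = (\<Sum>i<m. \<Sum>j<n. if i \<in> I then 0 else (M $$ (i,j))\<^sup>2) +
        (\<Sum>j<n. \<Sum>i<m. if j \<in> J then 0 else (M $$ (i,j))\<^sup>2)"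
      unfolding sum.distrib by (subst (2) sum.swap) simp
    also have "(\<Sum>i<m. \<Sum>j<n. if i \<in> I then 0 else (M $$ (i,j))\<^sup>2) = (\<Sum>i<m. if i \<in> I then 0 else nsq (row M i))"
      using Mc by (intro sum.cong) (auto simp: nsq_sum)
    also have "\<dots> = (\<Sum>i\<in>{..<m} - I. nsq (row M i))"
      by (subst sum.If_cases) (auto simp: Diff_eq)
    also have "(\<Sum>j<n. \<Sum>i<m. if j \<in> J then 0 else (M $$ (i,j))\<^sup>2) = (\<Sum>j<n. if j \<in> J then 0 else nsq (row (transpose_mat M) j))"
      using Mc by (intro sum.cong) (auto simp: nsq_sum)
    also have "\<dots> = (\<Sum>j\<in>{..<n} - J. nsq (row (transpose_mat M) j))"
      by (subst sum.If_cases) (auto simp: Diff_eq)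
    finally have "fro2 N \<le> k * (2 * (\<alpha> + 5) * (\<sigma>\<^sup>2 * sqrt (n * L))) + l * (2 * (\<alpha> + 5) * (\<sigma>\<^sup>2 * sqrt (m * L)))"
      using Ib(2) Jb(2) by linarith
    then show ?thesis by (simp add: algebra_simps)
  qed
  show "nsq ((X0 - M) *\<^sub>v x) \<le>
       (2 * \<tau> + 4 * (\<alpha> + 5) * (\<sigma>\<^sup>2 * (k * sqrt (n * L) + l * sqrt (m * L)))) * nsq x"
    if x: "x \<in> carrier_vec n" for x
  proof -
    \<comment> \<open>Z0 uses only the coordinates in J, which is contained in the support of V, so
      the block bound applies to this truncation of x.\<close>
    define v where "v = vec n (\<lambda>j. if j \<in> J then x $ j else 0)"
    have v: "v \<in> carrier_vec n" by (simp add: v_def)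
    have nv: "nsq v \<le> nsq x"
      using v x by (simp add: nsq_sum) (auto simp: v_def intro!: sum_mono)
    have ent: "(Z0 *\<^sub>v x) $ i = (if i \<in> I then row Z i \<bullet> v else 0)" if "i < m" for i
      using that Z x by (auto simp: Z0_def v_def scalar_prod_def intro!: sum.cong)
    have "nsq (Z0 *\<^sub>v x) = (\<Sum>i<m. ((Z0 *\<^sub>v x) $ i)\<^sup>2)" using Z0 by (simp add: nsq_sum)
    also have "\<dots> = (\<Sum>i<m. if i \<in> I then (row Z i \<bullet> v)\<^sup>2 else 0)"
      using ent by (intro sum.cong) auto
    also have "\<dots> = (\<Sum>i\<in>{..<m} \<inter> I. (row Z i \<bullet> v)\<^sup>2)" by (simp add: sum.inter_restrict)
    also have "\<dots> \<le> (\<Sum>i\<in>row_supp U. (row Z i \<bullet> v)\<^sup>2)"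
      using Ib(1) by (intro sum_mono2) auto
    also have "\<dots> \<le> \<tau> * nsq v"
      using Jb(1) by (intro block[OF v]) (auto simp: v_def)
    also have "\<dots> \<le> \<tau> * nsq x" using nv \<tau> by (rule mult_left_mono)
    finally have 1: "nsq (Z0 *\<^sub>v x) \<le> \<tau> * nsq x" .
    have 2: "nsq (N *\<^sub>v x) \<le> 2 * (\<alpha> + 5) * (\<sigma>\<^sup>2 * (k * sqrt (n * L) + l * sqrt (m * L))) * nsq x"
      using nsq_mult_mat_vec_le_fro2[OF N x] mult_right_mono[OF froN, of "nsq x"] by simp
    have "(X0 - M) *\<^sub>v x = Z0 *\<^sub>v x + N *\<^sub>v x"
      unfolding eq by (rule add_mult_distrib_mat_vec[OF Z0 N x])
    then have "nsq ((X0 - M) *\<^sub>v x) \<le> 2 * nsq (Z0 *\<^sub>v x) + 2 * nsq (N *\<^sub>v x)"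
      using nsq_add_le[OF mult_mat_vec_carrier[OF Z0 x] mult_mat_vec_carrier[OF N x]] by simp
    then show ?thesis using 1 2 by (simp add: algebra_simps)
  qed
qed

end

section \<open>The good event\<close>

lemma excess_bound_of_sparse_contr:
  fixes \<gamma> B :: real
  assumes "\<And>S V. S \<subseteq> {..<n} \<Longrightarrow> V \<in> sparse_contr n r S \<Longrightarrow>
      (\<Sum>i<m. excess ((999 / 1000 * \<gamma>)\<^sup>2) (rowsq n r z V i)) \<le> B * card S"
  shows "excess_bound m n r (mat m n z) \<gamma> B"
  unfolding excess_bound_def
proof (intro ballI impI)
  fix W :: "real mat" assume W: "W \<in> carrier_mat n r" and con: "contraction r W"
  define V where "V = (\<lambda>(j,q). if j < n \<and> q < r then W $$ (j,q) else 0)"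
  have "contr n r V"
    unfolding contr_def
  proof
    fix g :: "nat \<Rightarrow> real"
    have "(\<Sum>j<n. (\<Sum>q<r. V (j,q) * g q)\<^sup>2) = nsq (W *\<^sub>v vec r g)"
      using W by (simp add: nsq_sum scalar_prod_def atLeast0LessThan V_def)
    also have "\<dots> \<le> nsq (vec r g)" using con by (simp add: contraction_def)
    finally show "(\<Sum>j<n. (\<Sum>q<r. V (j,q) * g q)\<^sup>2) \<le> (\<Sum>q<r. (g q)\<^sup>2)" by (simp add: nsq_sum)
  qed
  moreover have "V p = 0" if "p \<notin> row_supp W \<times> {..<r}" for p
  proof (cases p)
    case (Pair j q)
    show ?thesis
    proof (cases "j < n \<and> q < r")
      case True
      then have "row W j = 0\<^sub>v r" using that W Pair by (intro row_notin_supp) auto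
      then have "row W j $ q = 0" using True by simp
      then show ?thesis using True W Pair by (simp add: V_def)
    qed (auto simp: V_def Pair)
  qed
  ultimately have "V \<in> sparse_contr n r (row_supp W)" by (simp add: sparse_contr_def)
  moreover have "row_supp W \<subseteq> {..<n}" using W by (auto simp: row_supp_def)
  ultimately have "(\<Sum>i<m. excess ((999 / 1000 * \<gamma>)\<^sup>2) (rowsq n r z V i)) \<le> B * card (row_supp W)"
    by (intro assms)
  moreover have "nsq (row (mat m n z * W) i) = rowsq n r z V i" if "i < m" for i
    using that W by (simp add: nsq_sum rowsq_def scalar_prod_def atLeast0LessThan V_def)
  ultimately show "(\<Sum>i<m. excess ((999 / 1000 * \<gamma>)\<^sup>2) (nsq (row (mat m n z * W) i))) \<le> B * card (row_supp W)"
    by simp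
qed

text \<open>Three deviation events per row, each of probability at most exp (- 3 L), cost 3 exp (- 2
  L) over m \<le> exp L rows; the uniform energy bound costs another 2 exp (- 2 L).\<close>

lemma row_events:
  fixes \<sigma> L \<beta> \<gamma> :: real
  assumes \<sigma>: "0 < \<sigma>" and L: "0 < L" "real m \<le> exp L" "real n \<le> exp L" "144 * L \<le> real n"
    and r: "1 \<le> r" and \<beta>: "4 \<le> \<beta>" and \<gamma>: "0 < \<gamma>"
    and g: "1.01 * \<sigma>\<^sup>2 * (r + 2 * sqrt (r * \<beta> * L) + 2 * \<beta> * L) \<le> \<gamma>\<^sup>2"
    and M: "M \<in> carrier_mat m n"
  shows "\<exists>E\<in>sets (gaussian_noise m n \<sigma>).
    measure (gaussian_noise m n \<sigma>) (space (gaussian_noise m n \<sigma>) - E) \<le> 5 * exp (- 2 * L) \<and>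
    (\<forall>z\<in>E. excess_bound m n r (mat m n z) \<gamma> (108000000 * \<sigma>\<^sup>2 * (r + L)) \<and> tame_rows m n \<sigma> L M (mat m n z))"
proof -
  define I where "I = {..<m} \<times> {..<n}"
  define P where "P = PiM I (\<lambda>_. gn \<sigma>)"
  have gP: "gaussian_noise m n \<sigma> = P" by (simp add: gaussian_noise_def P_def I_def)
  interpret prob_space P unfolding P_def by (rule prob_space_PiM_gn) fact
  have fI: "finite I" by (simp add: I_def)
  \<comment> \<open>The margin of the threshold pays for two reductions of the level by 999/1000,
    one for the net and one in \<open>excess_bound\<close>: 1.01 * 0.999^4 > 1.0059.\<close>
  have "1.005 * \<sigma>\<^sup>2 * (r + 2 * sqrt (r * \<beta> * L) + 2 * \<beta> * L) \<le> (999 / 1000 * (999 / 1000 * \<gamma>))\<^sup>2"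
  proof -
    have "0 \<le> \<sigma>\<^sup>2 * (r + 2 * sqrt (r * \<beta> * L) + 2 * \<beta> * L)" using \<beta> L by simp
    then show ?thesis using g by (simp add: power_mult_distrib power_divide)
  qed
  from excess_event[OF \<sigma> L(1,2,3) r \<beta> _ this] \<gamma> obtain E0 where E0: "E0 \<in> sets P"
    "measure P (space P - E0) \<le> 2 * exp (- 3 * L)"
    "\<And>z S V. z \<in> E0 \<Longrightarrow> S \<subseteq> {..<n} \<Longrightarrow> V \<in> sparse_contr n r S \<Longrightarrow>
       (\<Sum>i<m. excess ((999 / 1000 * \<gamma>)\<^sup>2) (rowsq n r z V i)) \<le> 108000000 * \<sigma>\<^sup>2 * (r + L) * card S"
    unfolding P_def I_def by auto
  define A where "A i = {i} \<times> {..<n}" for i :: nat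
  have A: "A i \<subseteq> I" "card (A i) = n" if "i < m" for i
    using that by (auto simp: A_def I_def)
  have sumA: "(\<Sum>p\<in>A i. f p) = (\<Sum>j<n. f (i,j))" for f :: "nat \<times> nat \<Rightarrow> real" and i
  proof -
    have "A i = Pair i ` {..<n}" by (auto simp: A_def)
    then show ?thesis by (simp add: sum.reindex inj_on_def)
  qed
  define c where "c p = M $$ p" for p
  define B1 where "B1 i = {z \<in> space P. \<sigma>\<^sup>2 * (n + 4 * sqrt (n * L)) \<le> (\<Sum>p\<in>A i. (z p)\<^sup>2)}" for i
  define B2 where "B2 i = {z \<in> space P. (\<Sum>p\<in>A i. (z p)\<^sup>2) \<le> \<sigma>\<^sup>2 * (n - 4 * sqrt (n * L))}" for i
  define B3 where "B3 i = {z \<in> space P. (\<Sum>p\<in>A i. c p * z p) < - \<sigma> * sqrt (8 * L) * sqrt (\<Sum>p\<in>A i. (c p)\<^sup>2)}" for i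
  have n0: "0 < n" using L by (cases n) auto
  have m1: "(\<lambda>z. \<Sum>p\<in>A i. (z p)\<^sup>2) \<in> borel_measurable P" if "i < m" for i
    unfolding P_def using A(1)[OF that]
    by (intro borel_measurable_sum borel_measurable_power measurable_gn_component) auto
  have m2: "(\<lambda>z. \<Sum>p\<in>A i. c p * z p) \<in> borel_measurable P" if "i < m" for i
    unfolding P_def using A(1)[OF that]
    by (intro borel_measurable_sum borel_measurable_times borel_measurable_const measurable_gn_component) auto
  have BM: "B1 i \<in> sets P" "B2 i \<in> sets P" "B3 i \<in> sets P" if i: "i < m" for i
    unfolding B1_def B2_def B3_def using m1[OF i] m2[OF i] by measurable
  have Bp: "measure P (B1 i) \<le> exp (- 3 * L)" "measure P (B2 i) \<le> exp (- 4 * L)"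
      "measure P (B3 i) \<le> exp (- 4 * L)" if i: "i < m" for i
  proof -
    show "measure P (B1 i) \<le> exp (- 3 * L)"
      using chi_squared_upper_tail[OF \<sigma> fI A(1)[OF i] L(1)] A(2)[OF i] L(4)
      unfolding B1_def P_def by simp
    show "measure P (B2 i) \<le> exp (- 4 * L)"
      using chi_squared_lower_tail[OF \<sigma> fI A(1)[OF i] L(1)] A(2)[OF i] n0
      unfolding B2_def P_def by simp
    show "measure P (B3 i) \<le> exp (- 4 * L)"
      using linear_lower_tail[OF \<sigma> fI A(1)[OF i] L(1), of c]
      unfolding B3_def P_def by simp
  qed
  define Bad where "Bad = (\<Union>i<m. B1 i \<union> B2 i \<union> B3 i)"
  have BadM: "Bad \<in> sets P" unfolding Bad_def using BM by (intro sets.finite_UN) auto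
  have "measure P Bad \<le> (\<Sum>i<m. measure P (B1 i \<union> B2 i \<union> B3 i))"
    unfolding Bad_def using BM by (intro finite_measure_subadditive_finite) auto
  also have "\<dots> \<le> (\<Sum>i<m. 3 * exp (- 3 * L))"
  proof (rule sum_mono)
    fix i assume "i \<in> {..<m}"
    then have i: "i < m" by simp
    have "measure P (B1 i \<union> B2 i \<union> B3 i) \<le> measure P (B1 i \<union> B2 i) + measure P (B3 i)"
      using BM[OF i] by (intro measure_Un_le) auto
    also have "measure P (B1 i \<union> B2 i) \<le> measure P (B1 i) + measure P (B2 i)"
      using BM[OF i] by (intro measure_Un_le) auto
    finally have "measure P (B1 i \<union> B2 i \<union> B3 i) \<le> exp (- 3 * L) + exp (- 4 * L) + exp (- 4 * L)"
      using Bp[OF i] by linarith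
    moreover have "exp (- 4 * L) \<le> exp (- 3 * L)" using L by simp
    ultimately show "measure P (B1 i \<union> B2 i \<union> B3 i) \<le> 3 * exp (- 3 * L)" by linarith
  qed
  also have "\<dots> = 3 * (m * exp (- 3 * L))" by simp
  also have "\<dots> \<le> 3 * (exp L * exp (- 3 * L))" using L by (intro mult_left_mono mult_right_mono) auto
  also have "\<dots> = 3 * exp (- 2 * L)" by (simp flip: exp_add)
  finally have PBad: "measure P Bad \<le> 3 * exp (- 2 * L)" .
  have "exp (- 3 * L) \<le> exp (- 2 * L)" using L by simp
  then have PE0: "measure P (space P - E0) \<le> 2 * exp (- 2 * L)" using E0(2) by linarith
  have "measure P (space P - (E0 - Bad)) \<le> measure P ((space P - E0) \<union> Bad)"
    using E0(1) BadM by (intro finite_measure_mono) auto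
  also have "\<dots> \<le> measure P (space P - E0) + measure P Bad"
    using E0(1) BadM by (intro measure_Un_le) auto
  finally have PE: "measure P (space P - (E0 - Bad)) \<le> 5 * exp (- 2 * L)" using PBad PE0 by linarith
  have good: "tame_rows m n \<sigma> L M (mat m n z)" if z: "z \<in> E0 - Bad" for z
    unfolding tame_rows_def
  proof (intro allI impI)
    fix i assume i: "i < m"
    have zs: "z \<in> space P" using z sets.sets_into_space[OF E0(1)] by auto
    have zB: "z \<notin> B1 i" "z \<notin> B2 i" "z \<notin> B3 i" using z i by (auto simp: Bad_def)
    have s1: "nsq (row (mat m n z) i) = (\<Sum>p\<in>A i. (z p)\<^sup>2)"
      using i by (simp add: nsq_sum sumA)
    have s2: "row M i \<bullet> row (mat m n z) i = (\<Sum>p\<in>A i. c p * z p)"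
      using i M by (simp add: scalar_prod_def sumA c_def atLeast0LessThan)
    have s3: "vnorm (row M i) = sqrt (\<Sum>p\<in>A i. (c p)\<^sup>2)"
      using i M by (simp add: vnorm_def nsq_sum sumA c_def)
    show "nsq (row (mat m n z) i) < \<sigma>\<^sup>2 * (n + 4 * sqrt (n * L)) \<and>
        \<sigma>\<^sup>2 * (n - 4 * sqrt (n * L)) \<le> nsq (row (mat m n z) i) \<and>
        - \<sigma> * sqrt (8 * L) * vnorm (row M i) \<le> row M i \<bullet> row (mat m n z) i"
      unfolding s1 s2 s3 using zB zs unfolding B1_def B2_def B3_def
      by (simp add: not_le not_less)
  qed
  show ?thesis
    unfolding gP
  proof (intro bexI[of _ "E0 - Bad"] conjI ballI)
    fix z assume z: "z \<in> E0 - Bad"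
    show "excess_bound m n r (mat m n z) \<gamma> (108000000 * \<sigma>\<^sup>2 * (r + L))"
      using E0(3) z by (intro excess_bound_of_sparse_contr) auto
  qed (use PE good E0(1) BadM in auto)
qed

text \<open>Events for columns are events for the rows of noise of the transposed shape; since all
  entries have the same law, swapping the indices preserves the product measure.\<close>

lemma gaussian_noise_transpose:
  assumes \<sigma>: "0 < \<sigma>" and E: "E \<in> sets (gaussian_noise n m \<sigma>)"
  shows "\<exists>E'\<in>sets (gaussian_noise m n \<sigma>).
    measure (gaussian_noise m n \<sigma>) (space (gaussian_noise m n \<sigma>) - E') =
      measure (gaussian_noise n m \<sigma>) (space (gaussian_noise n m \<sigma>) - E) \<and>
    (\<forall>z\<in>E'. \<exists>w\<in>E. transpose_mat (mat m n z) = mat n m w)"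
proof -
  define P where "P = gaussian_noise m n \<sigma>"
  define P' where "P' = gaussian_noise n m \<sigma>"
  define t where "t = (\<lambda>z :: nat \<times> nat \<Rightarrow> real. \<lambda>p\<in>{..<n} \<times> {..<m}. z (prod.swap p))"
  have distr: "distr P P' t = P'"
    unfolding P_def P'_def t_def gaussian_noise_def
    by (rule distr_PiM_reindex[where M = "\<lambda>_. gn \<sigma>"]) (auto intro: prob_space_gn[OF \<sigma>] simp: inj_on_def)
  have tm: "t \<in> measurable P P'"
    unfolding P_def P'_def t_def gaussian_noise_def
    by (intro measurable_restrict measurable_component_singleton) auto
  define E' where "E' = t -` E \<inter> space P"
  have E'M: "E' \<in> sets P" unfolding E'_def using tm E by (auto simp: P'_def)
  have "space P - E' = t -` (space P' - E) \<inter> space P"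
    unfolding E'_def using measurable_space[OF tm] by auto
  moreover have "measure (distr P P' t) (space P' - E) = measure P (t -` (space P' - E) \<inter> space P)"
    using tm E by (intro measure_distr) (auto simp: P'_def)
  ultimately have "measure P (space P - E') = measure P' (space P' - E)" using distr by simp
  moreover have "\<exists>w\<in>E. transpose_mat (mat m n z) = mat n m w" if "z \<in> E'" for z
    using that by (intro bexI[of _ "t z"]) (auto simp: E'_def t_def intro!: eq_matI)
  ultimately show ?thesis using E'M unfolding P_def P'_def by blast
qed

section \<open>The stopping time\<close>

text \<open>In logarithms everything is linear, and the terms in d and h combine to nonnegative
  multiples of 2 ln d - ln h. For T \<le> T' the gap 11/20 - 101/200 = 0.045 between the factors of
  L / ln 2 must absorb 1.1 ln 2 + 1.01 ln \<kappa>. Dividing by 0.045 gives about 24.5 ln 2 + 22.5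
  ln \<kappa>, rounded up to 13 ln 4 + 23 ln \<kappa>. The upper bound is less demanding.\<close>

lemma stopping_time_bounds:
  fixes L \<kappa> d g h sM s0 :: real
  assumes \<kappa>: "1 < \<kappa>" and L: "13 * ln 4 + 23 * ln \<kappa> + 2 \<le> L" and d: "0 < d"
    and g: "0 < g" "g \<le> h" "h \<le> exp L * g" "h \<le> d\<^sup>2"
    and sM: "d \<le> sM" "sM \<le> \<kappa> * d" and s0: "d / 2 \<le> s0" "s0 \<le> 2 * (\<kappa> * d)"
  defines "T \<equiv> 1.01 / 2 * (L / ln 2 + ln (sM\<^sup>2 / h))" and "T' \<equiv> 1.1 / 2 * (L / ln 2 + ln (s0\<^sup>2 / g))"
  shows "T \<le> T'" "T' \<le> 3 * T" "0 < T"
proof -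
  have lk: "0 < ln \<kappa>" using \<kappa> by simp
  have l2: "0 < ln (2::real)" "ln (2::real) < 1" by (auto simp: ln_2_less_1)
  have l4: "ln (4::real) = 2 * ln 2"
    using ln_realpow[of 2 2] by simp
  have L0: "0 < L" using L lk l2 l4 by linarith
  define L' where "L' = L / ln 2"
  have L': "L \<le> L'" unfolding L'_def using l2 L0 by (simp add: pos_le_divide_eq mult_left_le)
  have h: "0 < h" using g by linarith
  have gh: "ln g \<le> ln h" using g h by simp
  have hL: "ln h \<le> L + ln g"
  proof -
    have "ln h \<le> ln (exp L * g)" using g h by simp
    then show ?thesis using g by (simp add: ln_mult)
  qed
  have hd: "ln h \<le> 2 * ln d"
  proof -
    have "ln h \<le> ln (d\<^sup>2)" using g h d by simp
    then show ?thesis using d by (simp add: ln_realpow)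
  qed
  have pos: "0 < sM" "0 < s0" using sM s0 d by linarith+
  have m1: "ln d \<le> ln sM" using sM d pos by simp
  have m2: "ln sM \<le> ln \<kappa> + ln d"
  proof -
    have "ln sM \<le> ln (\<kappa> * d)" using sM pos d \<kappa> by simp
    then show ?thesis using d \<kappa> by (simp add: ln_mult)
  qed
  have s1: "ln d - ln 2 \<le> ln s0"
  proof -
    have "ln (d / 2) \<le> ln s0" using s0 pos d by simp
    then show ?thesis using d by (simp add: ln_div)
  qed
  have s2: "ln s0 \<le> ln 2 + ln \<kappa> + ln d"
  proof -
    have "ln s0 \<le> ln (2 * (\<kappa> * d))" using s0 pos d \<kappa> by simp
    then show ?thesis using d \<kappa> by (simp add: ln_mult)
  qed
  have T: "T = 101 / 200 * L' + 101 / 100 * ln sM - 101 / 200 * ln h"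
    unfolding T_def L'_def using pos h by (simp add: ln_div ln_realpow field_simps)
  have T': "T' = 11 / 20 * L' + 11 / 10 * ln s0 - 11 / 20 * ln g"
    unfolding T'_def L'_def using pos g by (simp add: ln_div ln_realpow field_simps)
  show "T \<le> T'" unfolding T T' using L l4 L' gh hd m2 s1 lk l2 by linarith
  have T3: "3 * T = 303 / 200 * L' + 303 / 100 * ln sM - 303 / 200 * ln h" unfolding T by simp
  show "T' \<le> 3 * T" unfolding T3 T' using L l4 L' hL hd m1 s2 lk l2 by linarith
  show "0 < T" unfolding T using L0 L' hd m1 by linarith
qed

section \<open>Analysis on the good event\<close>

text \<open>\<open>C1 = 6 \<cdot> 18 \<cdot> 10\<^sup>6\<close>: the exponential moment of the truncated energy is taken at
  \<open>10\<^sup>-\<^sup>6\<close>, the tail at \<open>18 (r + L)\<close> per column beats the cardinality of the net, and passing from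
  the net to all contractions costs a factor 6.\<close>

abbreviation (input) C1 :: real where "C1 \<equiv> 108000000"

text \<open>The constant in \<delta> \<le> C4 \<beta> * S * K for the error of a half-step, where S
  = \<sigma>^2 (r + L), after inserting \<gamma>^2 \<le> 4 \<beta> S, B = C1 S and s = 4 C1
  K.\<close>

definition C4 :: "real \<Rightarrow> real" where
  "C4 \<beta> = 16 * \<beta> + 4 * C1 * (1 + 4 * C1)"

text \<open>The same substitutions in \<open>reconstruction_error\<close>; 32 / 3 is 8 times the 4 /
  3 of \<open>thresholding_step\<close>.\<close>

definition C5 :: "real \<Rightarrow> real" where
  "C5 \<beta> = 2 * (4 * \<beta> + C1) * (1 + 4 * C1) + 32 / 3 * C4 \<beta>"

text \<open>A bound for sqrt (ln m / n), chosen so that the tolerance \<epsilon>, at most 8/3 * C4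
  \<beta> times this ratio, satisfies 8000000 * C1 * \<epsilon> \<le> 1.\<close>

definition small_ratio :: "real \<Rightarrow> real" where
  "small_ratio \<beta> = 1 / (32000000 * C1 * C4 \<beta>)"

lemma C4_ge: "4 \<le> \<beta> \<Longrightarrow> 4 * \<beta> + C1 \<le> C4 \<beta>" "4 \<le> \<beta> \<Longrightarrow> 1 \<le> C4 \<beta>"
  by (simp_all add: C4_def)

lemma small_ratio_bounds:
  assumes "4 \<le> \<beta>"
  shows "0 < small_ratio \<beta>" "32000000 * C1 * (C4 \<beta> * small_ratio \<beta>) = 1" "small_ratio \<beta> \<le> 1 / 16"
proof -
  have c: "1 \<le> C4 \<beta>" by (rule C4_ge) fact
  then show "0 < small_ratio \<beta>" by (simp add: small_ratio_def)
  show "32000000 * C1 * (C4 \<beta> * small_ratio \<beta>) = 1" using c by (simp add: small_ratio_def)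
  show "small_ratio \<beta> \<le> 1 / 16" using c by (simp add: small_ratio_def divide_le_eq)
qed

lemma threshold_level_bounds:
  fixes \<sigma> \<beta> :: real
  assumes \<sigma>: "0 < \<sigma>" and \<beta>: "4 \<le> \<beta>" and r: "1 \<le> r" and L: "0 < ln (real m)"
  shows "0 < threshold_level m r \<beta> \<sigma>"
    and "(threshold_level m r \<beta> \<sigma>)\<^sup>2 = 1.01 * \<sigma>\<^sup>2 * (r + 2 * sqrt (r * \<beta> * ln m) + 2 * \<beta> * ln m)"
    and "\<sigma>\<^sup>2 * (r + ln m) \<le> (threshold_level m r \<beta> \<sigma>)\<^sup>2"
    and "(threshold_level m r \<beta> \<sigma>)\<^sup>2 \<le> 4 * \<beta> * (\<sigma>\<^sup>2 * (r + ln m))"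
proof -
  define L where "L = ln (real m)"
  define S where "S = r + 2 * sqrt (r * \<beta> * L) + 2 * \<beta> * L"
  have L0: "0 < L" using L by (simp add: L_def)
  have bL: "4 * L \<le> \<beta> * L" using \<beta> L0 by simp
  have sq: "0 \<le> sqrt (r * \<beta> * L)" using \<beta> L0 by simp
  have r1: "1 \<le> real r" using r by simp
  have S1: "r + L \<le> S" unfolding S_def using bL sq L0 by linarith
  have S0: "0 < S" using S1 r1 L0 by linarith
  have S2: "1.01 * S \<le> 4 * \<beta> * (r + L)"
  proof -
    have "sqrt (r * (\<beta> * L)) \<le> (r + \<beta> * L) / 2"
      using \<beta> L0 by (intro arith_geo_mean_sqrt) auto
    then have "2 * sqrt (r * \<beta> * L) \<le> r + \<beta> * L" by (simp add: mult.assoc)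
    then have "S \<le> 2 * r + 3 * (\<beta> * L)" unfolding S_def by linarith
    moreover have "4 * real r \<le> \<beta> * r" using \<beta> r1 by simp
    moreover have "4 * \<beta> * (r + L) = 4 * (\<beta> * r) + 4 * (\<beta> * L)" by (simp add: algebra_simps)
    ultimately have "101 * S \<le> 400 * \<beta> * (r + L)" using bL L0 r1 by linarith
    then show ?thesis by simp
  qed
  have t: "threshold_level m r \<beta> \<sigma> = sqrt (1.01 * \<sigma>\<^sup>2 * S)"
    by (simp add: threshold_level_def S_def L_def)
  have p: "0 < 1.01 * \<sigma>\<^sup>2 * S" using S0 \<sigma> by simp
  show "0 < threshold_level m r \<beta> \<sigma>" unfolding t using p by simp
  have sq2: "(threshold_level m r \<beta> \<sigma>)\<^sup>2 = 1.01 * \<sigma>\<^sup>2 * S" unfolding t using p by simp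
  then show "(threshold_level m r \<beta> \<sigma>)\<^sup>2 = 1.01 * \<sigma>\<^sup>2 * (r + 2 * sqrt (r * \<beta> * ln m) + 2 * \<beta> * ln m)"
    by (simp only: S_def L_def)
  have "r + L \<le> 1.01 * S" using S1 S0 by simp
  then have "\<sigma>\<^sup>2 * (r + L) \<le> \<sigma>\<^sup>2 * (1.01 * S)" by (intro mult_left_mono) auto
  then show "\<sigma>\<^sup>2 * (r + ln m) \<le> (threshold_level m r \<beta> \<sigma>)\<^sup>2" unfolding sq2 by (simp add: L_def)
  have "\<sigma>\<^sup>2 * (1.01 * S) \<le> \<sigma>\<^sup>2 * (4 * \<beta> * (r + L))" using S2 by (intro mult_left_mono) auto
  then show "(threshold_level m r \<beta> \<sigma>)\<^sup>2 \<le> 4 * \<beta> * (\<sigma>\<^sup>2 * (r + ln m))"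
    unfolding sq2 by (simp add: L_def mult_ac)
qed

context low_rank
begin

text \<open>Each induction step consists of two half-steps, the second on transposed data. Claims
  about \<open>Us\<close> begin at 1, because \<open>Us 0\<close> is arbitrary.\<close>

lemma iterates_close:
  fixes \<gamma> B C K s \<delta> \<epsilon> :: real
  assumes \<eta>: "thresholding_fun \<eta>" and Z: "Z \<in> carrier_mat m n" and \<gamma>: "0 < \<gamma>"
    and ex: "excess_bound m n r Z \<gamma> B" "excess_bound n m r (transpose_mat Z) \<gamma> B"
    and B: "0 \<le> B" "B \<le> C * \<gamma>\<^sup>2" and C: "1 \<le> C"
    and K: "real (card (row_supp U)) \<le> K" "real (card (row_supp V)) \<le> K" and s: "s = 4 * C * K"
    and \<delta>: "\<delta> = 4 * \<gamma>\<^sup>2 * K + 4 * B * (K + s)"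
    and \<epsilon>: "0 < \<epsilon>" "8000000 * C * \<epsilon> \<le> 1" "4 / 3 * \<delta> \<le> \<epsilon> * d\<^sup>2"
    and V0: "close_frame n r \<epsilon> s V (Vs 0)" and it: "iterates \<eta> \<gamma> \<gamma> (M + Z) N Us Vs"
  shows "t \<le> N \<Longrightarrow> close_frame n r \<epsilon> s V (Vs t) \<and>
    (1 \<le> t \<longrightarrow> close_frame m r \<epsilon> s U (Us t) \<and>
       fro2 (M - Us t * (transpose_mat (Us t) * M)) \<le> 4 / 3 * \<delta> \<and>
       fro2 (transpose_mat M - Vs t * (transpose_mat (Vs t) * transpose_mat M)) \<le> 4 / 3 * \<delta>)"
proof (induction t)
  case 0
  then show ?case using V0 by simp
next
  case (Suc t)
  interpret T: low_rank n m r V U "transpose_mat M" D d by (rule low_rank_transpose)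
  have IH: "close_frame n r \<epsilon> s V (Vs t)" using Suc by simp
  have Zt: "transpose_mat Z \<in> carrier_mat n m" using Z by simp
  have Xt: "transpose_mat (M + Z) = transpose_mat M + transpose_mat Z"
    using M_carrier Z by (intro eq_matI) auto
  have "Suc t \<in> {1..N}" using Suc.prems by simp
  then obtain R R' where R: "is_qr (row_threshold \<eta> \<gamma> ((M + Z) * Vs t)) (Us (Suc t)) R"
    and R': "is_qr (row_threshold \<eta> \<gamma> ((transpose_mat M + transpose_mat Z) * Us (Suc t))) (Vs (Suc t)) R'"
    using it unfolding iterates_def Xt by force
  note 1 = thresholding_step[OF \<eta> Z \<gamma> ex(1) B C K s \<delta> \<epsilon> IH R]
  note 2 = T.thresholding_step[OF \<eta> Zt \<gamma> ex(2) B C K(2,1) s \<delta> \<epsilon> 1(1) R']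
  show ?case using 1 2 by simp
qed

text \<open>Everything is measured in units of S K with S = \<sigma>^2 (r + L) and K = k + l: both
  \<gamma>^2 and B are multiples of S, and the signal-to-noise condition makes S K a small fraction
  of d^2.\<close>

lemma good_event:
  fixes \<alpha> \<beta> \<sigma> c L \<gamma> :: real and k l :: nat
  defines "\<gamma> \<equiv> threshold_level m r \<beta> \<sigma>" and "L \<equiv> ln (real m)"
  assumes \<eta>: "thresholding_fun \<eta>" and Z: "Z \<in> carrier_mat m n"
    and \<sigma>: "0 < \<sigma>" and \<alpha>: "4 \<le> \<alpha>" and \<beta>: "4 \<le> \<beta>"
    and r: "1 \<le> r" "r < n" "n \<le> m" and L: "1 \<le> L" "L \<le> (small_ratio \<beta>)\<^sup>2 * n"
    and kl: "card (row_supp U) \<le> k" "card (row_supp V) \<le> l" "1 \<le> k"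
    and cond: "\<sigma>\<^sup>2 * r / d\<^sup>2 * (k * sqrt (n * L) + l * sqrt (m * L)) \<le> 1 / (1600 * (\<alpha> + 5))"
    and D': "\<And>i. i < r \<Longrightarrow> D i \<le> c"
    and ex: "excess_bound m n r Z \<gamma> (C1 * \<sigma>\<^sup>2 * (r + L))"
      "excess_bound n m r (transpose_mat Z) \<gamma> (C1 * \<sigma>\<^sup>2 * (r + L))"
    and tame: "tame_rows m n \<sigma> L M Z" "tame_rows n m \<sigma> L (transpose_mat M) (transpose_mat Z)"
  shows "d / 2 \<le> sing_val (init_mat \<alpha> \<sigma> (M + Z)) r" "sing_val (init_mat \<alpha> \<sigma> (M + Z)) r \<le> 2 * c"
    and "real (k + l) * \<gamma>\<^sup>2 \<le> d\<^sup>2"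
    and "\<And>Mhat q. 0 < T_hat r \<alpha> \<beta> \<sigma> (M + Z) \<Longrightarrow> algorithm_output \<eta> r \<alpha> \<beta> \<sigma> (M + Z) Mhat \<Longrightarrow>
       1 \<le> q \<Longrightarrow> q \<le> 2 \<Longrightarrow> (schatten_norm q (Mhat - M))\<^sup>2 \<le>
         2 * C5 \<beta> * \<sigma>\<^sup>2 * (r powr (2 / q) * (k + l + L) + r powr (2 / q - 1) * (k + l) * L)"
proof -
  have L0: "0 < L" using L by linarith
  have Lm: "0 < ln (real m)" using L0 by (simp add: L_def)
  note \<gamma>b = threshold_level_bounds[OF \<sigma> \<beta> r(1) Lm, folded \<gamma>_def L_def]
  note sm = small_ratio_bounds[OF \<beta>]
  define w where "w = small_ratio \<beta>"
  define S where "S = \<sigma>\<^sup>2 * (r + L)"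
  define K where "K = real (k + l)"
  define B where "B = C1 * \<sigma>\<^sup>2 * (r + L)"
  have B: "B = C1 * S" by (simp add: B_def S_def)
  have K1: "1 \<le> K" using kl by (simp add: K_def)
  have r1: "1 \<le> real r" using r by simp
  have S0: "0 < S" using \<sigma> r1 L0 by (simp add: S_def)
  have B0: "0 \<le> B" using S0 by (simp add: B)
  have w0: "0 < w" using sm by (simp add: w_def)
  have d2: "0 < d\<^sup>2" using d by simp
  \<comment> \<open>The condition controls K sqrt (n L), while the error involves K L. The gain w,
    available for large n, pays for all constants that depend on \<beta>.\<close>
  have nL: "L \<le> w * sqrt (n * L)"
  proof -
    have "L * L \<le> (w\<^sup>2 * n) * L" using L L0 by (intro mult_right_mono) (auto simp: w_def)
    then have "L \<le> sqrt (w\<^sup>2 * (n * L))"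
      by (intro real_le_rsqrt) (simp add: power2_eq_square mult.assoc)
    also have "\<dots> = w * sqrt (n * L)" using w0 by (simp add: real_sqrt_mult)
    finally show ?thesis .
  qed
  define Y where "Y = k * sqrt (n * L) + l * sqrt (m * L)"
  have condY: "\<sigma>\<^sup>2 * r * Y \<le> d\<^sup>2 / (1600 * (\<alpha> + 5))"
  proof -
    have "(\<sigma>\<^sup>2 * r * Y) / d\<^sup>2 \<le> 1 / (1600 * (\<alpha> + 5))" using cond by (simp add: Y_def)
    then have "\<sigma>\<^sup>2 * r * Y \<le> 1 / (1600 * (\<alpha> + 5)) * d\<^sup>2" using d2 by (simp only: pos_divide_le_eq)
    then show ?thesis by simp
  qed
  have Y0: "0 \<le> Y" using L0 by (simp add: Y_def)
  have KY: "K * sqrt (n * L) \<le> Y"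
  proof -
    have "sqrt (n * L) \<le> sqrt (m * L)" using r L0 by simp
    then have "l * sqrt (n * L) \<le> l * sqrt (m * L)" by (intro mult_left_mono) auto
    then show ?thesis by (simp add: K_def Y_def algebra_simps)
  qed
  have KLY: "K * L \<le> w * Y"
  proof -
    have "K * L \<le> K * (w * sqrt (n * L))" using nL K1 by (intro mult_left_mono) auto
    also have "\<dots> = w * (K * sqrt (n * L))" by simp
    also have "\<dots> \<le> w * Y" using KY w0 by (intro mult_left_mono) auto
    finally show ?thesis .
  qed
  \<comment> \<open>The sum r + L is at most 2 r L because both terms are at least 1; this brings in
    the product \<sigma>^2 r Y controlled by the condition.\<close>
  have SK: "S * K \<le> 2 * w * d\<^sup>2"
  proof -
    have "real r + L \<le> 2 * (r * L)"
    proof -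
      have "real r * 1 \<le> r * L" "1 * L \<le> r * L" using r1 L by (auto intro: mult_left_mono mult_right_mono)
      then show ?thesis by simp
    qed
    then have "S * K \<le> \<sigma>\<^sup>2 * (2 * (r * L)) * K"
      unfolding S_def using K1 by (intro mult_right_mono mult_left_mono) auto
    also have "\<dots> = 2 * (\<sigma>\<^sup>2 * r) * (K * L)" by simp
    also have "\<dots> \<le> 2 * (\<sigma>\<^sup>2 * r) * (w * Y)" using KLY by (intro mult_left_mono) auto
    also have "\<dots> = 2 * w * (\<sigma>\<^sup>2 * r * Y)" by simp
    also have "\<dots> \<le> 2 * w * d\<^sup>2"
    proof (rule mult_left_mono)
      have "d\<^sup>2 / (1600 * (\<alpha> + 5)) \<le> d\<^sup>2 / 1" using \<alpha> d2 by (intro divide_left_mono) auto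
      then show "\<sigma>\<^sup>2 * r * Y \<le> d\<^sup>2" using condY by simp
    qed (use w0 in simp)
    finally show ?thesis .
  qed
  define \<tau> where "\<tau> = (\<gamma>\<^sup>2 + B) * K"
  have \<gamma>S: "\<gamma>\<^sup>2 \<le> 4 * \<beta> * S" "S \<le> \<gamma>\<^sup>2" using \<gamma>b by (simp_all add: S_def)
  have \<tau>0: "0 \<le> \<tau>" using B0 K1 by (simp add: \<tau>_def)
  have \<tau>: "\<tau> \<le> d\<^sup>2 / 400"
  proof -
    have "\<tau> \<le> (4 * \<beta> * S + C1 * S) * K"
      unfolding \<tau>_def B using \<gamma>S K1 by (intro mult_right_mono) auto
    also have "\<dots> = (4 * \<beta> + C1) * (S * K)" by (simp add: algebra_simps)
    also have "\<dots> \<le> C4 \<beta> * (2 * w * d\<^sup>2)"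
    proof (rule mult_mono)
      show "0 \<le> S * K" using S0 K1 by simp
    qed (use C4_ge[OF \<beta>] SK in auto)
    also have "\<dots> = 2 * (C4 \<beta> * w) * d\<^sup>2" by simp
    also have "\<dots> \<le> 1 / 400 * d\<^sup>2" using sm(2) by (intro mult_right_mono) (auto simp: w_def)
    finally show ?thesis by simp
  qed
  show "real (k + l) * \<gamma>\<^sup>2 \<le> d\<^sup>2"
  proof -
    have "K * \<gamma>\<^sup>2 \<le> \<tau>" unfolding \<tau>_def using B0 K1 by (simp add: algebra_simps)
    then show ?thesis using \<tau> d2 unfolding K_def by linarith
  qed
  have Ks: "real (card (row_supp U)) \<le> K" "real (card (row_supp V)) \<le> K"
    using kl by (auto simp: K_def)
  have L256: "256 * L \<le> real n"
  proof -
    have "w\<^sup>2 \<le> (1 / 16)\<^sup>2" using sm(1,3) by (intro power_mono) (auto simp: w_def)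
    then have "w\<^sup>2 * n \<le> (1 / 16)\<^sup>2 * n" by (intro mult_right_mono) auto
    then show ?thesis using L(2) by (simp add: w_def power_divide)
  qed
  have block: "(\<Sum>i\<in>row_supp U. (row Z i \<bullet> v)\<^sup>2) \<le> \<tau> * nsq v"
    if "v \<in> carrier_vec n" "\<And>j. j < n \<Longrightarrow> j \<notin> row_supp V \<Longrightarrow> v $ j = 0" for v
  proof -
    have "row_supp U \<subseteq> {..<m}" using U by (auto simp: row_supp_def)
    then show ?thesis
      unfolding \<tau>_def B_def
      by (intro excess_block[OF ex(1) \<gamma>b(1) B0[unfolded B_def] r(1) Z that(1) _ _ Ks(2) _ Ks(1)])
         (use that(2) in auto)
  qed
  define X0 where "X0 = init_mat \<alpha> \<sigma> (M + Z)"
  have LL: "L = ln m" by (simp add: L_def)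
  have init: "X0 \<in> carrier_mat m n" "\<And>j. j < n \<Longrightarrow> j \<notin> row_supp V \<Longrightarrow> col X0 j = 0\<^sub>v m"
    "\<And>x. x \<in> carrier_vec n \<Longrightarrow>
      nsq ((X0 - M) *\<^sub>v x) \<le> (2 * \<tau> + 4 * (\<alpha> + 5) * (\<sigma>\<^sup>2 * Y)) * nsq x"
    unfolding X0_def Y_def
    using init_mat_close[OF Z \<sigma> \<alpha> LL L0 L256 r(3) tame kl(1,2) block \<tau>0] by blast+
  \<comment> \<open>The constant 1600 makes the screening term d^2 / 400; together with 2 * \<tau>
    \<le> d^2 / 200 this stays below d^2 / 100.\<close>
  have err: "nsq ((X0 - M) *\<^sub>v x) \<le> d\<^sup>2 / 100 * nsq x" if x: "x \<in> carrier_vec n" for x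
  proof -
    have "4 * (\<alpha> + 5) * (\<sigma>\<^sup>2 * Y) \<le> 4 * (\<alpha> + 5) * (\<sigma>\<^sup>2 * r * Y)"
    proof -
      have "\<sigma>\<^sup>2 * Y * 1 \<le> \<sigma>\<^sup>2 * Y * r" using Y0 r1 by (intro mult_left_mono) auto
      then show ?thesis using \<alpha> by (intro mult_left_mono) (auto simp: mult_ac)
    qed
    also have "\<dots> \<le> 4 * (\<alpha> + 5) * (d\<^sup>2 / (1600 * (\<alpha> + 5)))"
      using condY \<alpha> by (intro mult_left_mono) auto
    also have "\<dots> = d\<^sup>2 / 400" using \<alpha> by (simp add: field_simps)
    finally have "2 * \<tau> + 4 * (\<alpha> + 5) * (\<sigma>\<^sup>2 * Y) \<le> d\<^sup>2 / 100" using \<tau> d2 by linarith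
    then have "(2 * \<tau> + 4 * (\<alpha> + 5) * (\<sigma>\<^sup>2 * Y)) * nsq x \<le> d\<^sup>2 / 100 * nsq x"
      by (intro mult_right_mono) auto
    then show ?thesis using init(3)[OF x] by linarith
  qed
  have rn: "r \<le> n" using r by simp
  from sing_val_perturbed_bounds[OF init(1) err r(1) rn D']
  show "d / 2 \<le> sing_val (init_mat \<alpha> \<sigma> (M + Z)) r" "sing_val (init_mat \<alpha> \<sigma> (M + Z)) r \<le> 2 * c"
    by (simp_all add: X0_def)
  define s where "s = 4 * C1 * K"
  define \<delta> where "\<delta> = 4 * \<gamma>\<^sup>2 * K + 4 * B * (K + s)"
  define \<epsilon> where "\<epsilon> = 4 / 3 * \<delta> / d\<^sup>2"
  have s0: "0 \<le> s" using K1 by (simp add: s_def)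
  have \<delta>S: "\<delta> \<le> C4 \<beta> * (S * K)"
  proof -
    have "\<gamma>\<^sup>2 * K \<le> 4 * \<beta> * S * K" using \<gamma>S K1 by (intro mult_right_mono) auto
    then show ?thesis unfolding \<delta>_def B s_def C4_def by (simp add: algebra_simps)
  qed
  have \<delta>0: "0 < \<delta>"
  proof -
    have "0 < 4 * \<gamma>\<^sup>2 * K" using \<gamma>b(1) K1 by simp
    moreover have "0 \<le> 4 * B * (K + s)" using B0 K1 s0 by simp
    ultimately show ?thesis unfolding \<delta>_def by linarith
  qed
  have \<epsilon>: "0 < \<epsilon>" "8000000 * C1 * \<epsilon> \<le> 1" "4 / 3 * \<delta> \<le> \<epsilon> * d\<^sup>2"
  proof -
    show "0 < \<epsilon>" "4 / 3 * \<delta> \<le> \<epsilon> * d\<^sup>2" using \<delta>0 d2 by (simp_all add: \<epsilon>_def)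
    have "\<delta> \<le> C4 \<beta> * (2 * w * d\<^sup>2)"
      using \<delta>S mult_left_mono[OF SK, of "C4 \<beta>"] C4_ge(2)[OF \<beta>] by linarith
    then have "4 / 3 * \<delta> \<le> (8 / 3 * (C4 \<beta> * w)) * d\<^sup>2" by (simp add: algebra_simps)
    then have "\<epsilon> \<le> 8 / 3 * (C4 \<beta> * w)" unfolding \<epsilon>_def using d2 by (simp only: pos_divide_le_eq)
    then show "8000000 * C1 * \<epsilon> \<le> 1" using sm(2) by (simp add: w_def)
  qed
  show "(schatten_norm q (Mhat - M))\<^sup>2 \<le>
         2 * C5 \<beta> * \<sigma>\<^sup>2 * (r powr (2 / q) * (k + l + L) + r powr (2 / q - 1) * (k + l) * L)"
    if T: "0 < T_hat r \<alpha> \<beta> \<sigma> (M + Z)" and out: "algorithm_output \<eta> r \<alpha> \<beta> \<sigma> (M + Z) Mhat"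
      and q: "1 \<le> q" "q \<le> 2" for Mhat q
  proof -
    define N where "N = nat \<lceil>T_hat r \<alpha> \<beta> \<sigma> (M + Z)\<rceil>"
    \<comment> \<open>The accuracy statements hold from the first iteration on, so a positive
      stopping time is enough.\<close>
    have N1: "1 \<le> N" unfolding N_def using T by linarith
    have dX: "dim_row (M + Z) = m" using Z by simp
    obtain Us Vs where lead: "leading_right_sv X0 r (Vs 0)"
      and it: "iterates \<eta> \<gamma> \<gamma> (M + Z) N Us Vs"
      and Mh: "Mhat = Us N * transpose_mat (Us N) * (M + Z) * (Vs N * transpose_mat (Vs N))"
      using out unfolding algorithm_output_def Let_def dX \<gamma>_def[symmetric] N_def[symmetric] X0_def[symmetric]
      by blast
    have V0: "close_frame n r \<epsilon> s V (Vs 0)"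
      using \<epsilon>(1) s0 by (intro leading_right_sv_close[OF init(1) err r lead init(2)]) auto
    have BC: "B \<le> C1 * \<gamma>\<^sup>2" using \<gamma>S by (simp add: B)
    note ex' = ex[folded B_def]
    have "close_frame n r \<epsilon> s V (Vs N) \<and>
      (1 \<le> N \<longrightarrow> close_frame m r \<epsilon> s U (Us N) \<and>
         fro2 (M - Us N * (transpose_mat (Us N) * M)) \<le> 4 / 3 * \<delta> \<and>
         fro2 (transpose_mat M - Vs N * (transpose_mat (Vs N) * transpose_mat M)) \<le> 4 / 3 * \<delta>)"
      by (rule iterates_close[OF \<eta> Z \<gamma>b(1) ex' B0 BC _ Ks s_def \<delta>_def \<epsilon> V0 it]) auto
    then have cl: "close_frame m r \<epsilon> s U (Us N)" "close_frame n r \<epsilon> s V (Vs N)"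
        "fro2 (M - Us N * (transpose_mat (Us N) * M)) \<le> 4 / 3 * \<delta>"
        "fro2 (transpose_mat M - Vs N * (transpose_mat (Vs N) * transpose_mat M)) \<le> 4 / 3 * \<delta>"
      using N1 by auto
    have "fro2 (Mhat - M) \<le> 2 * (\<gamma>\<^sup>2 + B) * (K + s) + 8 * (4 / 3 * \<delta>)"
      unfolding Mh by (rule reconstruction_error[OF Z \<gamma>b(1) ex'(1) B0 Ks cl])
    also have "\<dots> \<le> C5 \<beta> * (S * K)"
    proof -
      have "2 * (\<gamma>\<^sup>2 + B) * (K + s) \<le> 2 * (4 * \<beta> * S + C1 * S) * (K + s)"
        unfolding B using \<gamma>S(1) K1 s0 by (intro mult_right_mono mult_left_mono add_mono) auto
      then show ?thesis using \<delta>S unfolding C5_def s_def by (simp add: algebra_simps)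
    qed
    finally have F: "fro2 (Mhat - M) \<le> C5 \<beta> * (S * K)" .
    have Um: "Us N \<in> carrier_mat m r" and Vm: "Vs N \<in> carrier_mat n r"
      using cl by (auto simp: close_frame_def)
    have XA: "Us N * transpose_mat (Us N) * (M + Z) \<in> carrier_mat m n"
    proof -
      have "transpose_mat (Us N) \<in> carrier_mat r m" "M + Z \<in> carrier_mat m n" using Um Z M_carrier by auto
      then show ?thesis using mult_carrier_mat[OF mult_carrier_mat[OF Um]] by blast
    qed
    have "(schatten_norm q (Mhat - M))\<^sup>2 \<le> 2 * real r powr (2 / q - 1) * fro2 (Mhat - M)"
      by (rule schatten_norm_reconstruction[OF Vm XA r(1) q Mh])
    also have "\<dots> \<le> 2 * real r powr (2 / q - 1) * (C5 \<beta> * (S * K))"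
      using F by (intro mult_left_mono) auto
    also have "\<dots> = 2 * C5 \<beta> * \<sigma>\<^sup>2 * (real r powr (2 / q - 1) * (r * K + K * L))"
      by (simp add: S_def algebra_simps)
    also have "\<dots> \<le> 2 * C5 \<beta> * \<sigma>\<^sup>2 * (real r powr (2 / q - 1) * (r * (K + L) + K * L))"
    proof -
      have "0 \<le> C5 \<beta>" using \<beta> by (simp add: C5_def C4_def)
      then show ?thesis using L0 r1 by (intro mult_left_mono) auto
    qed
    also have "\<dots> = 2 * C5 \<beta> * \<sigma>\<^sup>2 * (r powr (2 / q) * (k + l + L) + r powr (2 / q - 1) * (k + l) * L)"
    proof -
      have "real r powr (2 / q) = real r powr (2 / q - 1) * r"
        using r1 by (simp add: powr_diff)
      then show ?thesis by (simp add: K_def algebra_simps)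
    qed
    finally show ?thesis .
  qed
qed

end

section \<open>Choice of the constants and assembly of the event\<close>

theorem theorem2:
  shows "\<exists>c0>0. \<forall>c::real. 0 < c \<and> c \<le> c0 \<longrightarrow>
    (\<exists>C0>0::real. \<exists>c' C :: real \<Rightarrow> real \<Rightarrow> real.
      (\<forall>\<kappa> \<alpha>. 1 < \<kappa> \<and> 4 \<le> \<alpha> \<longrightarrow> 0 < c' \<kappa> \<alpha>) \<and>
      (\<forall>\<kappa> \<beta>. 1 < \<kappa> \<and> 4 \<le> \<beta> \<longrightarrow> 0 < C \<kappa> \<beta>) \<and>
      (\<forall>\<kappa> \<alpha> \<beta> \<eta>. 1 < \<kappa> \<and> 4 \<le> \<alpha> \<and> 4 \<le> \<beta> \<and> thresholding_fun \<eta> \<longrightarrow>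
        (\<exists>N0. \<forall>(m::nat) (n::nat) (k::nat) (l::nat) (r::nat) (d::real) (\<sigma>::real).
          N0 \<le> m \<and> N0 \<le> n \<and>
          1 \<le> r \<and> r \<le> k \<and> k \<le> m \<and> r \<le> l \<and> l \<le> n \<and> 0 < d \<and> 0 < \<sigma> \<and>
          n \<le> m \<and>
          ln (d / \<sigma>) \<le> c * m \<and>
          c \<le> ln m / ln n \<and> ln m / ln n \<le> 1 / c \<and>
          ln m \<le> c * real (min (m - k) (n - l)) \<and>
          real (max k l) \<le> c * real (min m n) \<and>
          \<sigma>\<^sup>2 * r / d\<^sup>2 * (k * sqrt (n * ln m) + l * sqrt (m * ln m)) \<le> c' \<kappa> \<alpha> \<longrightarrow>
          (\<forall>M \<in> param_space m n k l r d \<kappa>.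
            \<exists>E \<in> sets (gaussian_noise m n \<sigma>).
              measure (gaussian_noise m n \<sigma>) E \<ge> 1 - C0 / m\<^sup>2 \<and>
              (\<forall>z \<in> E. let X = M + mat m n z in
                 0 < sing_val (init_mat \<alpha> \<sigma> X) r \<and>
                 T_hat r \<alpha> \<beta> \<sigma> X \<in> {T_oracle k l r \<beta> \<sigma> M .. 3 * T_oracle k l r \<beta> \<sigma> M} \<and>
                 (\<forall>Mhat. algorithm_output \<eta> r \<alpha> \<beta> \<sigma> X Mhat \<longrightarrow>
                   (\<forall>q \<in> {1..2}.
                     (schatten_norm q (Mhat - M))\<^sup>2 \<le>
                       C \<kappa> \<beta> * \<sigma>\<^sup>2 *
                         (r powr (2 / q) * (k + l + ln m) +
                          r powr (2 / q - 1) * (k + l) * ln m))))))))"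
proof -
  \<comment> \<open>The constants are c0 = 1/2, C0 = 10, c' = 1 / (1600 (\<alpha> + 5)) and C = 2 *
    C5 \<beta>. The remaining dependence on c, \<kappa> and \<beta> is absorbed by the size of
    N0.\<close>
  have main: "\<exists>N0. \<forall>(m::nat) (n::nat) (k::nat) (l::nat) (r::nat) (d::real) (\<sigma>::real).
          N0 \<le> m \<and> N0 \<le> n \<and>
          1 \<le> r \<and> r \<le> k \<and> k \<le> m \<and> r \<le> l \<and> l \<le> n \<and> 0 < d \<and> 0 < \<sigma> \<and>
          n \<le> m \<and>
          ln (d / \<sigma>) \<le> c * m \<and>
          c \<le> ln m / ln n \<and> ln m / ln n \<le> 1 / c \<and>
          ln m \<le> c * real (min (m - k) (n - l)) \<and>
          real (max k l) \<le> c * real (min m n) \<and>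
          \<sigma>\<^sup>2 * r / d\<^sup>2 * (k * sqrt (n * ln m) + l * sqrt (m * ln m)) \<le> 1 / (1600 * (\<alpha> + 5)) \<longrightarrow>
          (\<forall>M \<in> param_space m n k l r d \<kappa>.
            \<exists>E \<in> sets (gaussian_noise m n \<sigma>).
              measure (gaussian_noise m n \<sigma>) E \<ge> 1 - 10 / m\<^sup>2 \<and>
              (\<forall>z \<in> E. let X = M + mat m n z in
                 0 < sing_val (init_mat \<alpha> \<sigma> X) r \<and>
                 T_hat r \<alpha> \<beta> \<sigma> X \<in> {T_oracle k l r \<beta> \<sigma> M .. 3 * T_oracle k l r \<beta> \<sigma> M} \<and>
                 (\<forall>Mhat. algorithm_output \<eta> r \<alpha> \<beta> \<sigma> X Mhat \<longrightarrow>
                   (\<forall>q \<in> {1..2}.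
                     (schatten_norm q (Mhat - M))\<^sup>2 \<le>
                       2 * C5 \<beta> * \<sigma>\<^sup>2 *
                         (r powr (2 / q) * (k + l + ln m) +
                          r powr (2 / q - 1) * (k + l) * ln m)))))"
    if c: "0 < c" "c \<le> 1 / 2" and par: "1 < \<kappa>" "4 \<le> \<alpha>" "4 \<le> \<beta>" "thresholding_fun \<eta>"
    for c \<kappa> \<alpha> \<beta> :: real and \<eta>
  proof -
    define \<Lambda> where "\<Lambda> = 13 * ln 4 + 23 * ln \<kappa> + 2"
    define \<theta> where "\<theta> = (small_ratio \<beta>)\<^sup>2"
    have \<theta>: "0 < \<theta>" using small_ratio_bounds(1)[OF par(3)] by (simp add: \<theta>_def)
    have "(\<lambda>n. ln (real n) / real n) \<longlonglongrightarrow> 0" by (rule lim_ln_over_n)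
    \<comment> \<open>Since ln m \<le> ln n / c, this yields L \<le> \<theta> n; N0 may depend on c
      and on \<beta>.\<close>
    then have "eventually (\<lambda>n. ln (real n) / real n < c * \<theta>) sequentially"
      using \<theta> c by (intro order_tendstoD) auto
    then obtain N1 where N1: "\<And>n. N1 \<le> n \<Longrightarrow> ln (real n) / real n < c * \<theta>"
      by (auto simp: eventually_sequentially)
    define N0 where "N0 = max (max N1 2) (nat \<lceil>exp \<Lambda>\<rceil>)"
    show ?thesis
    proof (rule exI[of _ N0], intro allI impI ballI)
      fix m n k l r :: nat and d \<sigma> :: real and M :: "real mat"
      assume H: "N0 \<le> m \<and> N0 \<le> n \<and>
          1 \<le> r \<and> r \<le> k \<and> k \<le> m \<and> r \<le> l \<and> l \<le> n \<and> 0 < d \<and> 0 < \<sigma> \<and>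
          n \<le> m \<and>
          ln (d / \<sigma>) \<le> c * m \<and>
          c \<le> ln m / ln n \<and> ln m / ln n \<le> 1 / c \<and>
          ln m \<le> c * real (min (m - k) (n - l)) \<and>
          real (max k l) \<le> c * real (min m n) \<and>
          \<sigma>\<^sup>2 * r / d\<^sup>2 * (k * sqrt (n * ln m) + l * sqrt (m * ln m)) \<le> 1 / (1600 * (\<alpha> + 5))"
      assume Mp: "M \<in> param_space m n k l r d \<kappa>"
      define L where "L = ln (real m)"
      have \<sigma>: "0 < \<sigma>" and d: "0 < d" and r1: "1 \<le> r" and nm: "n \<le> m" and k1: "1 \<le> k" and km: "k \<le> m" "l \<le> m"
        using H by auto
      have n2: "2 \<le> n" "N1 \<le> n" "nat \<lceil>exp \<Lambda>\<rceil> \<le> m" using H by (auto simp: N0_def)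
      have m0: "0 < real m" using n2 nm by simp
      have \<Lambda>L: "\<Lambda> \<le> L"
      proof -
        have "exp \<Lambda> \<le> real m" using n2(3) by linarith
        then show ?thesis unfolding L_def using m0 by (simp add: ln_ge_iff)
      qed
      have "0 < ln \<kappa>" "0 < ln (4::real)" using par by simp_all
      then have "2 \<le> \<Lambda>" unfolding \<Lambda>_def by linarith
      then have L1: "1 \<le> L" using \<Lambda>L by linarith
      have Ln: "L \<le> (small_ratio \<beta>)\<^sup>2 * n"
      proof -
        have lnn: "0 < ln (real n)" using n2 by simp
        have "L \<le> 1 / c * ln n" using H lnn by (simp add: L_def pos_divide_le_eq)
        moreover have "ln n \<le> c * \<theta> * n" using N1[OF n2(2)] n2(1) by (simp add: pos_divide_less_eq)
        then have "1 / c * ln n \<le> 1 / c * (c * \<theta> * n)" using c by (intro mult_left_mono) auto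
        ultimately show ?thesis using c by (simp add: \<theta>_def)
      qed
      \<comment> \<open>The gap used for the initial singular vectors lies between the indices r - 1
        and r, counted from 0, so index r must exist. It does because r \<le> k \<le> c n \<le> n /
        2.\<close>
      have rn: "r < n"
      proof -
        have "real k \<le> real (max k l)" by simp
        also have "\<dots> \<le> c * real (min m n)" using H by blast
        also have "\<dots> \<le> c * real n" using c by (intro mult_left_mono) auto
        also have "\<dots> \<le> 1 / 2 * real n" using c by (intro mult_right_mono) auto
        finally show ?thesis using H n2 by linarith
      qed
      have eL: "exp L = real m" using m0 by (simp add: L_def)
      have L256: "144 * L \<le> real n"
      proof -
        have "(small_ratio \<beta>)\<^sup>2 \<le> (1 / 16)\<^sup>2" using small_ratio_bounds[OF par(3)] by (intro power_mono) auto
        then have "(small_ratio \<beta>)\<^sup>2 * n \<le> (1 / 16)\<^sup>2 * n" by (intro mult_right_mono) auto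
        then show ?thesis using Ln L1 by (simp add: power_divide)
      qed
      obtain U D V where svd: "is_svd M r U D V" and supp: "card (row_supp U) \<le> k" "card (row_supp V) \<le> l"
        and dD: "d \<le> D (r - 1)" "D 0 \<le> \<kappa> * d" and Mc: "M \<in> carrier_mat m n"
        using Mp unfolding param_space_def by blast
      have Dmono: "D j \<le> D i" if "i \<le> j" "j < r" for i j using svd that by (auto simp: is_svd_def)
      interpret low_rank m n r U V M D d
      proof
        show "U \<in> carrier_mat m r" "orthonormal_cols U" "V \<in> carrier_mat n r" "orthonormal_cols V"
          "M = U * mat_diag r D * transpose_mat V"
          using svd Mc unfolding is_svd_def by auto
        show "d \<le> D i" if "i < r" for i using Dmono[of i "r - 1"] that dD(1) by linarith
      qed fact
      have D': "D i \<le> \<kappa> * d" if "i < r" for i using Dmono[of 0 i] that dD by simp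
      define \<gamma> where "\<gamma> = threshold_level m r \<beta> \<sigma>"
      have Lpos: "0 < ln (real m)" using L1 by (simp add: L_def)
      note \<gamma>b = threshold_level_bounds[OF \<sigma> par(3) r1 Lpos, folded \<gamma>_def L_def]
      define P where "P = gaussian_noise m n \<sigma>"
      interpret prob_space P
        unfolding P_def gaussian_noise_def by (rule prob_space_PiM_gn) fact
      have L0: "0 < L" using L1 by linarith
      have mL: "real m \<le> exp L" "real n \<le> exp L" using eL nm by auto
      have L256m: "144 * L \<le> real m" using L256 nm by linarith
      obtain E1 where E1: "E1 \<in> sets P" "measure P (space P - E1) \<le> 5 * exp (- 2 * L)"
        "\<And>z. z \<in> E1 \<Longrightarrow> excess_bound m n r (mat m n z) \<gamma> (C1 * \<sigma>\<^sup>2 * (r + L)) \<and> tame_rows m n \<sigma> L M (mat m n z)"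
        using row_events[OF \<sigma> L0 mL L256 r1 par(3) \<gamma>b(1) _ Mc] \<gamma>b(2) unfolding P_def by auto
      have Mt: "transpose_mat M \<in> carrier_mat n m" using Mc by simp
      obtain E' where E': "E' \<in> sets (gaussian_noise n m \<sigma>)"
        "measure (gaussian_noise n m \<sigma>) (space (gaussian_noise n m \<sigma>) - E') \<le> 5 * exp (- 2 * L)"
        "\<And>z. z \<in> E' \<Longrightarrow> excess_bound n m r (mat n m z) \<gamma> (C1 * \<sigma>\<^sup>2 * (r + L)) \<and>
           tame_rows n m \<sigma> L (transpose_mat M) (mat n m z)"
        using row_events[OF \<sigma> L0 mL(2,1) L256m r1 par(3) \<gamma>b(1) _ Mt] \<gamma>b(2) by auto
      obtain E2 where E2: "E2 \<in> sets P" "measure P (space P - E2) \<le> 5 * exp (- 2 * L)"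
        "\<And>z. z \<in> E2 \<Longrightarrow> \<exists>w\<in>E'. transpose_mat (mat m n z) = mat n m w"
        using gaussian_noise_transpose[OF \<sigma> E'(1)] E'(2) unfolding P_def by auto
      \<comment> \<open>The row events and the column events each fail with probability at most 5
        exp (- 2 L) = 5 / m^2, hence C0 = 10.\<close>
      have prob: "1 - 10 / m\<^sup>2 \<le> measure P (E1 \<inter> E2)"
      proof -
        have e2: "exp (- 2 * L) = 1 / m\<^sup>2"
        proof -
          have "exp (- 2 * L) = inverse (exp (L + L))" by (simp add: exp_minus[symmetric])
          also have "\<dots> = 1 / m\<^sup>2" by (simp only: exp_add eL) (simp add: power2_eq_square divide_inverse)
          finally show ?thesis .
        qed
        have "measure P (space P - (E1 \<inter> E2)) \<le> measure P ((space P - E1) \<union> (space P - E2))"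
          using E1(1) E2(1) by (intro finite_measure_mono) auto
        also have "\<dots> \<le> measure P (space P - E1) + measure P (space P - E2)"
          using E1(1) E2(1) by (intro measure_Un_le) auto
        finally have "measure P (space P - (E1 \<inter> E2)) \<le> 10 * exp (- 2 * L)"
          using E1(2) E2(2) by linarith
        moreover have "measure P (space P - (E1 \<inter> E2)) = 1 - measure P (E1 \<inter> E2)"
          using E1(1) E2(1) by (intro prob_compl) auto
        ultimately show ?thesis unfolding e2 by simp
      qed
      \<comment> \<open>The event restricts the noise alone, so the conclusion holds at once for
        every choice of singular vectors and QR factors and for every q.\<close>
      have good: "let X = M + mat m n z in
                 0 < sing_val (init_mat \<alpha> \<sigma> X) r \<and>
                 T_hat r \<alpha> \<beta> \<sigma> X \<in> {T_oracle k l r \<beta> \<sigma> M .. 3 * T_oracle k l r \<beta> \<sigma> M} \<and>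
                 (\<forall>Mhat. algorithm_output \<eta> r \<alpha> \<beta> \<sigma> X Mhat \<longrightarrow>
                   (\<forall>q \<in> {1..2}.
                     (schatten_norm q (Mhat - M))\<^sup>2 \<le>
                       2 * C5 \<beta> * \<sigma>\<^sup>2 *
                         (r powr (2 / q) * (k + l + ln m) +
                          r powr (2 / q - 1) * (k + l) * ln m)))"
        if z: "z \<in> E1 \<inter> E2" for z
      proof -
        define Z where "Z = mat m n z"
        have Z: "Z \<in> carrier_mat m n" by (simp add: Z_def)
        have ex1: "excess_bound m n r Z \<gamma> (C1 * \<sigma>\<^sup>2 * (r + L))" "tame_rows m n \<sigma> L M Z"
          using E1(3)[of z] z by (auto simp: Z_def)
        obtain w where "w \<in> E'" "transpose_mat Z = mat n m w" using E2(3)[of z] z by (auto simp: Z_def)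
        then have ex2: "excess_bound n m r (transpose_mat Z) \<gamma> (C1 * \<sigma>\<^sup>2 * (r + L))"
            "tame_rows n m \<sigma> L (transpose_mat M) (transpose_mat Z)"
          using E'(3)[of w] by auto
        have cond: "\<sigma>\<^sup>2 * r / d\<^sup>2 * (k * sqrt (n * L) + l * sqrt (m * L)) \<le> 1 / (1600 * (\<alpha> + 5))"
          using H unfolding L_def by simp
        note ge = good_event[OF par(4) Z \<sigma> par(2,3) r1 rn nm L1[unfolded L_def] Ln[unfolded L_def] supp k1
            cond[unfolded L_def] D' ex1(1)[unfolded L_def \<gamma>_def] ex2(1)[unfolded L_def \<gamma>_def]
            ex1(2)[unfolded L_def] ex2(2)[unfolded L_def]]
        have dX: "dim_row (M + Z) = m" using Z by simp
        have dM: "dim_row M = m" using Mc by simp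
        define s0 where "s0 = sing_val (init_mat \<alpha> \<sigma> (M + Z)) r"
        have s0: "d / 2 \<le> s0" "s0 \<le> 2 * (\<kappa> * d)" using ge(1,2) by (simp_all add: s0_def)
        have sM: "d \<le> sing_val M r" "sing_val M r \<le> \<kappa> * d"
          using sing_val_M_bounds[OF r1 _ D'] rn by auto
        define h where "h = max (k * \<gamma>\<^sup>2) (l * \<gamma>\<^sup>2)"
        have g0: "0 < \<gamma>\<^sup>2" using \<gamma>b(1) by simp
        have h: "\<gamma>\<^sup>2 \<le> h" "h \<le> exp L * \<gamma>\<^sup>2" "h \<le> d\<^sup>2"
        proof -
          have "1 * \<gamma>\<^sup>2 \<le> k * \<gamma>\<^sup>2" using k1 by (intro mult_right_mono) auto
          then show "\<gamma>\<^sup>2 \<le> h" by (simp add: h_def)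
          have "k * \<gamma>\<^sup>2 \<le> m * \<gamma>\<^sup>2" "l * \<gamma>\<^sup>2 \<le> m * \<gamma>\<^sup>2" using km by (auto intro!: mult_right_mono)
          then show "h \<le> exp L * \<gamma>\<^sup>2" by (simp add: h_def eL)
          have "k * \<gamma>\<^sup>2 \<le> real (k + l) * \<gamma>\<^sup>2" "l * \<gamma>\<^sup>2 \<le> real (k + l) * \<gamma>\<^sup>2" by (auto intro!: mult_right_mono)
          then show "h \<le> d\<^sup>2" using ge(3) unfolding h_def \<gamma>_def by linarith
        qed
        have T1: "T_hat r \<alpha> \<beta> \<sigma> (M + Z) = 1.1 / 2 * (L / ln 2 + ln (s0\<^sup>2 / \<gamma>\<^sup>2))"
          by (simp only: T_hat_def dX L_def s0_def \<gamma>_def)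
        have T2: "T_oracle k l r \<beta> \<sigma> M = 1.01 / 2 * (L / ln 2 + ln ((sing_val M r)\<^sup>2 / h))"
          by (simp only: T_oracle_def dM L_def h_def \<gamma>_def Let_def)
        note T = stopping_time_bounds[OF par(1) \<Lambda>L[unfolded \<Lambda>_def] d g0 h sM s0, folded T1 T2]
        have "0 < T_hat r \<alpha> \<beta> \<sigma> (M + Z)" using T by linarith
        moreover have "0 < s0" using s0 d by linarith
        ultimately show ?thesis
          unfolding Let_def Z_def[symmetric] using T ge(4) by (auto simp: s0_def)
      qed
      show "\<exists>E \<in> sets (gaussian_noise m n \<sigma>).
              measure (gaussian_noise m n \<sigma>) E \<ge> 1 - 10 / m\<^sup>2 \<and>
              (\<forall>z \<in> E. let X = M + mat m n z in
                 0 < sing_val (init_mat \<alpha> \<sigma> X) r \<and>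
                 T_hat r \<alpha> \<beta> \<sigma> X \<in> {T_oracle k l r \<beta> \<sigma> M .. 3 * T_oracle k l r \<beta> \<sigma> M} \<and>
                 (\<forall>Mhat. algorithm_output \<eta> r \<alpha> \<beta> \<sigma> X Mhat \<longrightarrow>
                   (\<forall>q \<in> {1..2}.
                     (schatten_norm q (Mhat - M))\<^sup>2 \<le>
                       2 * C5 \<beta> * \<sigma>\<^sup>2 *
                         (r powr (2 / q) * (k + l + ln m) +
                          r powr (2 / q - 1) * (k + l) * ln m))))"
        unfolding P_def[symmetric]
      proof (intro bexI[of _ "E1 \<inter> E2"] conjI ballI)
        show "E1 \<inter> E2 \<in> sets P" using E1(1) E2(1) by auto
      qed (fact prob, rule good)
    qed
  qed
  have pos: "0 < 2 * C5 \<beta>" if "4 \<le> \<beta>" for \<beta>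
  proof -
    have "0 \<le> 2 * (4 * \<beta> + C1) * (1 + 4 * C1)" "0 < 32 / 3 * C4 \<beta>" using that C4_ge(2)[OF that] by simp_all
    then show ?thesis unfolding C5_def by (intro mult_pos_pos add_nonneg_pos) auto
  qed
  show ?thesis
    by (rule exI[of _ "1 / 2"], rule conjI, simp, intro allI impI, rule exI[of _ 10], rule conjI, simp,
        rule exI[of _ "\<lambda>_ \<alpha>. 1 / (1600 * (\<alpha> + 5))"], rule exI[of _ "\<lambda>_ \<beta>. 2 * C5 \<beta>"],
        intro conjI allI impI, simp, rule pos, simp, rule main; simp)
qed

end
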